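(* Fix an integer $k\geq2$ and for each $n\geq1$ let $\mathcal{M}_n=M_k(\mathcal{R}_n)$ be the ring of $k\times k$ matrices over $\mathcal{R}_n=(\mathcal{P}(\omega^n)/I_{\omega^n},\triangle,\cap,\mathbf{1})$; these are $\omega^n$-automatic non-commutative rings. (1) In ZFC + CH, the rings $\mathcal{M}_n$, $n\geq1$, are pairwise isomorphic. (2) In ZFC + AT, the rings $\mathcal{M}_n$, $n\geq1$, are pairwise non-isomorphic.
   Context: $I_{\omega^n}=\{P\subseteq\omega^n\mid \mathrm{o.t.}(P)<\omega^n\}$ ($\mathrm{o.t.}$ = order type as a suborder of $(\omega^n,<)$); $\mathcal{R}_n$ is the quotient of $\mathcal{P}(\omega^n)$ by $A\approx B\iff A\triangle B\in I_{\omega^n}$, with addition $\triangle$ (symmetric difference), multiplication $\cap$ and unit $[\omega^n]$. $M_k(R)$ carries matrix addition and multiplication. CH is the continuum hypothesis. AT is Just's axiom: for every ${\bf\Sigma}^1_1$-ideal $I$ of subsets of $\omega$ (subsets identified with points of $2^\omega$), every $H:\mathcal{P}(\omega)\to\mathcal{P}(\omega)$ preserving intersections modulo $I$ (i.e. $H(X)\triangle H(Y)\in I$ whenever $X\triangle Y$ is finite, and $H(X\cap Y)\triangle(H(X)\cap H(Y))\in I$), and every uncountable family $\mathcal{A}$ of pairwise almost disjoint infinite subsets of $\omega$, there exist $A\in\mathcal{A}$ and a finite decomposition $A=\bigcup_{i<m}A_i$ with continuous $F_i:\mathcal{P}(A_i)\to\mathcal{P}(\omega)$ such that $F_i(X)\triangle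 H(X)\in I$ for all $X\subseteq A_i$. A structure is $\omega^n$-automatic if it has a presentation (domain a regular $\omega^n$-language modulo an equivalence relation, relations and graphs of operations regular $\omega^n$-languages over product alphabets) by ordinal Büchi automata reading words of length $\omega^n$. *)

theory Defs
  imports "HOL-Algebra.QuotRing" "HOL-Analysis.Function_Topology"
begin

unbundle cardinal_syntax

section \<open>The ordinals \<open>\<omega>\<^sup>n\<close> and the rings \<open>\<R>\<^sub>n\<close>\<close>

text \<open>
  The ordinal \<open>\<omega>\<^sup>n\<close> is the (reflexive) lexicographic well-order on the lists of natural numbers of
  length \<open>n\<close>: the list \<open>[a\<^sub>1, \<dots>, a\<^sub>n]\<close> stands for
  \<open>\<omega>\<^bsup>n-1\<^esup>\<cdot>a\<^sub>1 + \<dots> + \<omega>\<cdot>a\<^bsub>n-1\<^esub> + a\<^sub>n\<close>.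
\<close>

definition omega_pow :: "nat \<Rightarrow> nat list rel"
  where "omega_pow n = lexn less_than n \<union> Id_on {xs. length xs = n}"

lemma Field_omega_pow: "Field (omega_pow n) = {xs. length xs = n}"
  unfolding omega_pow_def Field_def by (auto simp: lexn_conv Id_on_def)

lemma Well_order_omega_pow: "Well_order (omega_pow n)"
proof -
  have irr: "(xs, xs) \<notin> lexn less_than n" for xs
    using wf_lexn[OF wf_less_than, of n] by auto
  have tr: "trans (lexn less_than n)"
    by (rule lexn_transI) (rule trans_less_than)
  have tot: "total_on {xs. length xs = n} (lexn less_than n)"
  proof (rule total_onI)
    fix xs ys :: "nat list"
    assume len: "xs \<in> {xs. length xs = n}" "ys \<in> {xs. length xs = n}" and "xs \<noteq> ys"
    then have "(xs, ys) \<in> lenlex less_than \<or> (ys, xs) \<in> lenlex less_than"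
      using total_lenlex[OF total_less_than] unfolding total_on_def by blast
    then show "(xs, ys) \<in> lexn less_than n \<or> (ys, xs) \<in> lexn less_than n"
      using len by (auto simp: lenlex_conv lex_def lexn_conv)
  qed
  have "omega_pow n - Id = lexn less_than n"
    using irr unfolding omega_pow_def by (auto simp: Id_on_def)
  then have wf: "wf (omega_pow n - Id)"
    using wf_lexn[OF wf_less_than, of n] by simp
  have "refl_on {xs. length xs = n} (omega_pow n)"
    unfolding refl_on_def omega_pow_def by (auto simp: lexn_conv)
  moreover have "trans (omega_pow n)"
    using tr unfolding omega_pow_def trans_def by auto
  moreover have "antisym (omega_pow n)"
    using irr tr unfolding omega_pow_def antisym_def trans_def by blast
  moreover have "total_on {xs. length xs = n} (omega_pow n)"
    using tot unfolding omega_pow_def total_on_def by auto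
  moreover have "omega_pow n \<subseteq> {xs. length xs = n} \<times> {xs. length xs = n}"
    unfolding omega_pow_def by (auto simp: lexn_conv)
  ultimately show ?thesis
    using wf unfolding Field_omega_pow well_order_on_def linear_order_on_def
      partial_order_on_def preorder_on_def by simp
qed

definition omega_ideal :: "nat \<Rightarrow> nat list set set"
  where "omega_ideal n = {P. P \<subseteq> Field (omega_pow n) \<and> Restr (omega_pow n) P <o omega_pow n}"

definition omega_equiv :: "nat \<Rightarrow> nat list set rel"
  where "omega_equiv n = {(A, B). A \<subseteq> Field (omega_pow n) \<and> B \<subseteq> Field (omega_pow n) \<and>
                                  sym_diff A B \<in> omega_ideal n}"

definition powerset_ring :: "'a set \<Rightarrow> 'a set ring"
  where "powerset_ring W = \<lparr>carrier = Pow W, mult = (\<inter>), one = W, zero = {}, add = sym_diff\<rparr>"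

definition omega_ring :: "nat \<Rightarrow> nat list set set ring"
  where "omega_ring n = powerset_ring (Field (omega_pow n)) Quot omega_ideal n"

lemma omega_coset_eq_class:
  assumes "A \<subseteq> Field (omega_pow n)"
  shows "omega_ideal n +>\<^bsub>powerset_ring (Field (omega_pow n))\<^esub> A = omega_equiv n `` {A}"
proof -
  have inv: "sym_diff A (sym_diff P A) = P" "sym_diff (sym_diff A P) A = P" for P
    by blast+
  have sub: "P \<subseteq> Field (omega_pow n)" if "P \<in> omega_ideal n" for P
    using that by (simp add: omega_ideal_def)
  have "omega_ideal n +>\<^bsub>powerset_ring (Field (omega_pow n))\<^esub> A =
      {B. \<exists>P\<in>omega_ideal n. B = sym_diff P A}"
    unfolding a_r_coset_def r_coset_def powerset_ring_def by auto
  also have "\<dots> = {B. B \<subseteq> Field (omega_pow n) \<and> sym_diff A B \<in> omega_ideal n}"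
  proof (intro Collect_cong iffI)
    fix B assume "\<exists>P\<in>omega_ideal n. B = sym_diff P A"
    then obtain P where P: "P \<in> omega_ideal n" "B = sym_diff P A" by blast
    have "B \<subseteq> Field (omega_pow n)" using P(2) sub[OF P(1)] assms by blast
    moreover have "sym_diff A B = P" unfolding P(2) by (rule inv)
    ultimately show "B \<subseteq> Field (omega_pow n) \<and> sym_diff A B \<in> omega_ideal n"
      using P(1) by (simp only:)
  next
    fix B assume "B \<subseteq> Field (omega_pow n) \<and> sym_diff A B \<in> omega_ideal n"
    then show "\<exists>P\<in>omega_ideal n. B = sym_diff P A"
      using inv(2)[of B] by metis
  qed
  also have "\<dots> = omega_equiv n `` {A}"
    using assms unfolding omega_equiv_def Image_def by simp
  finally show ?thesis .
qed

lemma carrier_omega_ring: "carrier (omega_ring n) = Pow (Field (omega_pow n)) // omega_equiv n"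
proof -
  have "carrier (omega_ring n) =
    (\<Union>A\<in>Pow (Field (omega_pow n)).
      {omega_ideal n +>\<^bsub>powerset_ring (Field (omega_pow n))\<^esub> A})"
    unfolding omega_ring_def FactRing_def A_RCOSETS_def RCOSETS_def a_r_coset_def
    by (simp add: powerset_ring_def)
  then show ?thesis
    unfolding quotient_def by (auto simp: omega_coset_eq_class)
qed


section \<open>Matrix rings\<close>

definition matrix_ring :: "nat \<Rightarrow> ('a, 'm) ring_scheme \<Rightarrow> (nat \<times> nat \<Rightarrow> 'a) ring"
  where "matrix_ring k R =
    \<lparr>carrier = {..<k} \<times> {..<k} \<rightarrow>\<^sub>E carrier R,
     mult = (\<lambda>A B. \<lambda>(i, j)\<in>{..<k} \<times> {..<k}. \<Oplus>\<^bsub>R\<^esub>l\<in>{..<k}. A (i, l) \<otimes>\<^bsub>R\<^esub> B (l, j)),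
     one = (\<lambda>(i, j)\<in>{..<k} \<times> {..<k}. if i = j then \<one>\<^bsub>R\<^esub> else \<zero>\<^bsub>R\<^esub>),
     zero = (\<lambda>(i, j)\<in>{..<k} \<times> {..<k}. \<zero>\<^bsub>R\<^esub>),
     add = (\<lambda>A B. \<lambda>(i, j)\<in>{..<k} \<times> {..<k}. A (i, j) \<oplus>\<^bsub>R\<^esub> B (i, j))\<rparr>"


definition omega_matrix_ring :: "nat \<Rightarrow> nat \<Rightarrow> (nat \<times> nat \<Rightarrow> nat list set set) ring"
  where "omega_matrix_ring k n = matrix_ring k (omega_ring n)"


section \<open>Ordinal Buechi automata\<close>

text \<open>
  A word whose length is the ordinal \<open>r\<close> is an extensional function on \<open>Field r\<close>, and a run is a
  sequence of states indexed by \<open>r + 1\<close>; the new last position of \<open>r + 1\<close> is \<open>None\<close>.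
\<close>

definition ord_plus_one :: "'p rel \<Rightarrow> 'p option rel"
  where "ord_plus_one r = map_prod Some Some ` r \<union> insert None (Some ` Field r) \<times> {None}"

definition is_first :: "'p rel \<Rightarrow> 'p \<Rightarrow> bool"
  where "is_first r p \<longleftrightarrow> p \<in> Field r \<and> (\<forall>q\<in>Field r. (p, q) \<in> r)"

definition is_next :: "'p rel \<Rightarrow> 'p \<Rightarrow> 'p \<Rightarrow> bool"
  where "is_next r p q \<longleftrightarrow> (p, q) \<in> r - Id \<and> (\<nexists>m. (p, m) \<in> r - Id \<and> (m, q) \<in> r - Id)"

definition is_limit :: "'p rel \<Rightarrow> 'p \<Rightarrow> bool"
  where "is_limit r p \<longleftrightarrow> p \<in> Field r \<and> \<not> is_first r p \<and> (\<nexists>q. is_next r q p)"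

definition cofinal_states :: "'p rel \<Rightarrow> ('p \<Rightarrow> 'q) \<Rightarrow> 'p \<Rightarrow> 'q set"
  where "cofinal_states r x p =
    {q. \<forall>m. (m, p) \<in> r - Id \<longrightarrow> (\<exists>v. (m, v) \<in> r - Id \<and> (v, p) \<in> r - Id \<and> x v = q)}"

record ('q, 'a) ordinal_automaton =
  alphabet :: "'a set"
  states :: "'q set"
  init :: 'q
  succ_trans :: "('q \<times> 'a \<times> 'q) set"
  lim_trans :: "('q set \<times> 'q) set"
  final :: "'q set"

definition ordinal_buchi :: "('q, 'a) ordinal_automaton \<Rightarrow> bool"
  where "ordinal_buchi A \<longleftrightarrow>
    finite (alphabet A) \<and> finite (states A) \<and> init A \<in> states A \<and>
    succ_trans A \<subseteq> states A \<times> alphabet A \<times> states A \<and>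
    lim_trans A \<subseteq> Pow (states A) \<times> states A \<and>
    final A \<subseteq> states A"

definition is_run ::
    "('q, 'a) ordinal_automaton \<Rightarrow> 'p rel \<Rightarrow> ('p \<Rightarrow> 'a) \<Rightarrow> ('p option \<Rightarrow> 'q) \<Rightarrow> bool"
  where "is_run A r w x \<longleftrightarrow>
    (\<forall>p\<in>Field (ord_plus_one r). x p \<in> states A) \<and>
    (\<forall>p. is_first (ord_plus_one r) p \<longrightarrow> x p = init A) \<and>
    (\<forall>p\<in>Field r. \<forall>q. is_next (ord_plus_one r) (Some p) q \<longrightarrow>
       (x (Some p), w p, x q) \<in> succ_trans A) \<and>
    (\<forall>p. is_limit (ord_plus_one r) p \<longrightarrow>
       (cofinal_states (ord_plus_one r) x p, x p) \<in> lim_trans A)"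

definition language :: "('q, 'a) ordinal_automaton \<Rightarrow> 'p rel \<Rightarrow> ('p \<Rightarrow> 'a) set"
  where "language A r =
    {w \<in> Field r \<rightarrow>\<^sub>E alphabet A. \<exists>x. is_run A r w x \<and> x None \<in> final A}"

text \<open>Since automata are finite, taking natural numbers as states is no restriction.\<close>

definition regular :: "'p rel \<Rightarrow> 'a set \<Rightarrow> ('p \<Rightarrow> 'a) set \<Rightarrow> bool"
  where "regular r \<Sigma> L \<longleftrightarrow>
    (\<exists>A :: (nat, 'a) ordinal_automaton. ordinal_buchi A \<and> alphabet A = \<Sigma> \<and> L = language A r)"


section \<open>Automatic structures\<close>

text \<open>
  An \<open>m\<close>-tuple of words over \<open>\<Sigma>\<close> is read as one word over the product alphabet \<open>\<Sigma>\<^sup>m\<close>, whose letters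
  are the lists of length \<open>m\<close> over \<open>\<Sigma>\<close>.
\<close>

definition product_alphabet :: "nat \<Rightarrow> 'a set \<Rightarrow> 'a list set"
  where "product_alphabet m \<Sigma> = {as. length as = m \<and> set as \<subseteq> \<Sigma>}"

definition convolution :: "'p rel \<Rightarrow> ('p \<Rightarrow> 'a) list \<Rightarrow> 'p \<Rightarrow> 'a list"
  where "convolution r us = (\<lambda>p\<in>Field r. map (\<lambda>u. u p) us)"

text \<open>
  A structure is a domain \<open>D\<close> with a list \<open>Rs\<close> of relations, each with its arity \<open>m\<close> and given as a set
  of lists of length \<open>m\<close>. The bijection \<open>f\<close> is the isomorphism from the quotient structure on \<open>L // E\<close>
  to the given structure. Alphabets being finite, letters may be taken to be natural numbers.
\<close>

definition automatic_structure :: "'p rel \<Rightarrow> 'd set \<Rightarrow> (nat \<times> 'd list set) list \<Rightarrow> bool"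
  where "automatic_structure r D Rs \<longleftrightarrow>
    (\<exists>(\<Sigma> :: nat set) L E f.
       regular r \<Sigma> L \<and>
       equiv L E \<and>
       regular r (product_alphabet 2 \<Sigma>) {convolution r [u, v] | u v. (u, v) \<in> E} \<and>
       bij_betw f (L // E) D \<and>
       (\<forall>(m, R)\<in>set Rs.
          regular r (product_alphabet m \<Sigma>)
            {convolution r us | us.
               length us = m \<and> set us \<subseteq> L \<and> map (\<lambda>u. f (E `` {u})) us \<in> R}))"

definition automatic_ring :: "'p rel \<Rightarrow> ('d, 'm) ring_scheme \<Rightarrow> bool"
  where "automatic_ring r R \<longleftrightarrow>
    automatic_structure r (carrier R)
      [(3, {[x, y, x \<oplus>\<^bsub>R\<^esub> y] | x y. x \<in> carrier R \<and> y \<in> carrier R}),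
       (3, {[x, y, x \<otimes>\<^bsub>R\<^esub> y] | x y. x \<in> carrier R \<and> y \<in> carrier R}),
       (1, {[\<one>\<^bsub>R\<^esub>]})]"


section \<open>The continuum hypothesis and Just's axiom\<close>

definition CH :: bool
  where "CH \<longleftrightarrow> |UNIV :: nat set set| =o cardSuc |UNIV :: nat set|"

definition char_fun :: "nat set \<Rightarrow> nat \<Rightarrow> bool"
  where "char_fun X = (\<lambda>i. i \<in> X)"

text \<open>
  Boldface \<open>\<Sigma>\<^sup>1\<^sub>1\<close> subsets of the Cantor space are the projections of closed subsets of its product
  with the Baire space.
\<close>

definition Sigma11 :: "(nat \<Rightarrow> bool) set \<Rightarrow> bool"
  where "Sigma11 S \<longleftrightarrow> (\<exists>C :: ((nat \<Rightarrow> bool) \<times> (nat \<Rightarrow> nat)) set. closed C \<and> S = fst ` C)"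

definition set_ideal :: "nat set set \<Rightarrow> bool"
  where "set_ideal I \<longleftrightarrow> {} \<in> I \<and> (\<forall>X\<in>I. \<forall>Y\<in>I. X \<union> Y \<in> I) \<and> (\<forall>X\<in>I. \<forall>Y\<subseteq>X. Y \<in> I)"

definition preserves_inter_mod :: "nat set set \<Rightarrow> (nat set \<Rightarrow> nat set) \<Rightarrow> bool"
  where "preserves_inter_mod I H \<longleftrightarrow>
    (\<forall>X Y. finite (sym_diff X Y) \<longrightarrow> sym_diff (H X) (H Y) \<in> I) \<and>
    (\<forall>X Y. sym_diff (H (X \<inter> Y)) (H X \<inter> H Y) \<in> I)"

definition continuous_on_powerset :: "nat set \<Rightarrow> (nat set \<Rightarrow> nat set) \<Rightarrow> bool"
  where "continuous_on_powerset A F \<longleftrightarrow>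
    continuous_on (char_fun ` Pow A) (\<lambda>x. char_fun (F {i. x i}))"

definition AT :: bool
  where "AT \<longleftrightarrow>
    (\<forall>I H \<A>.
       set_ideal I \<and> Sigma11 (char_fun ` I) \<and> preserves_inter_mod I H \<and>
       uncountable \<A> \<and> (\<forall>A\<in>\<A>. infinite A) \<and>
       (\<forall>A\<in>\<A>. \<forall>B\<in>\<A>. A \<noteq> B \<longrightarrow> finite (A \<inter> B)) \<longrightarrow>
       (\<exists>A\<in>\<A>. \<exists>(m::nat) As Fs.
          A = (\<Union>i<m. As i) \<and>
          (\<forall>i<m. continuous_on_powerset (As i) (Fs i) \<and>
             (\<forall>X\<subseteq>As i. sym_diff (Fs i X) (H X) \<in> I))))"

end

theory Submission
  imports Defs "HOL-Library.Countable_Set_Type"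
begin

text \<open>
  A subset \<open>A\<close> of \<open>\<omega>\<^sup>n\<close> has order type \<open>\<omega>\<^sup>n\<close> iff
  \<open>\<exists>\<^sub>\<infinity>a\<^sub>1. \<dots> \<exists>\<^sub>\<infinity>a\<^sub>n. [a\<^sub>1, \<dots>, a\<^sub>n] \<in> A\<close>. An ordinal automaton can evaluate these quantifiers from
  the inside out, one at each limit position, so that \<open>M\<^sub>k(\<R>\<^sub>n)\<close> is presented by words over the finite
  ring \<open>M\<^sub>k(\<F>\<^sub>2)\<close>.

  A commutative ring is isomorphic to the centre of its matrix rings, so both (1) and (2) are statements
  on the Boolean rings \<open>\<R>\<^sub>n\<close>.

  Since \<open>\<R>\<^sub>n\<^sub>+\<^sub>1\<close> is the power \<open>\<R>\<^sub>n\<^sup>\<omega>\<close> modulo finite sets, it is countably saturated; under CH, a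
  back-and-forth argument of length \<open>\<omega>\<^sub>1\<close> yields isomorphisms.

  Under AT, an isomorphism \<open>\<R>\<^sub>m \<cong> \<R>\<^sub>n\<close> with \<open>n < m\<close> has a continuous lifting on a set of order
  type \<open>\<omega>\<^sup>m\<close>. This is a continuous reduction of \<open>I\<close> in \<open>\<omega>\<^sup>m\<close> to \<open>I\<close> in \<open>\<omega>\<^sup>n\<close>. As the
  complement of the latter continuously reduces to the former, the ideal on \<open>\<omega>\<^sup>m\<close> would be reducible to
  its own complement, which a fixed point argument excludes.
\<close>

section \<open>Order types of subsets of \<open>\<omega>\<^sup>n\<close>\<close>

text \<open>The ideals for different exponents have to be told apart by topology alone. Each
  quantifier \<open>\<exists>\<^sub>\<infinity>\<close> amounts to a forall-exists pair, so full
  order type in omega^n is a Pi^0_{2n} condition, and for m > n its negation should be within reach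
  of the condition for m. The difficulty is that a plain existential quantifier must be expressed by
  \<open>\<exists>\<^sub>\<infinity>\<close>, which counts witnesses; hence the witnesses are made
  unique. No universal set is needed after that. A reduction of a condition to its own negation is
  refuted by a self-referential set, defined by recursion once every position is moved so far up its
  last coordinate that the reduction consults earlier positions only. Such a move is free, since an
  injection of the last coordinate preserves infinitely many. AT yields continuous liftings only on
  the pieces of one member of the family. This suffices: some piece has full type and contains an
  order copy of omega^m on which full type means the same as in omega^m. An injective ring
  homomorphism carries membership in the ideal both ways, so the lifting is a reduction.\<close>

primrec big :: "nat \<Rightarrow> nat list set \<Rightarrow> bool"
  where
    "big 0 A \<longleftrightarrow> [] \<in> A"
  | "big (Suc n) A \<longleftrightarrow> (\<exists>\<^sub>\<infinity>a. big n {xs. a # xs \<in> A})"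

lemma big_mono: "big n A \<Longrightarrow> A \<subseteq> B \<Longrightarrow> big n B"
proof (induction n arbitrary: A B)
  case (Suc n)
  show ?case
    using Suc.prems(1) unfolding big.simps
  proof (rule INFM_mono)
    show "big n {xs. a # xs \<in> B}" if "big n {xs. a # xs \<in> A}" for a
      using Suc.prems(2) by (intro Suc.IH[OF that]) auto
  qed
qed auto

lemma big_Un: "big n (A \<union> B) \<longleftrightarrow> big n A \<or> big n B"
proof (induction n arbitrary: A B)
  case (Suc n)
  have "{xs. a # xs \<in> A \<union> B} = {xs. a # xs \<in> A} \<union> {xs. a # xs \<in> B}" for a
    by blast
  then show ?case
    by (simp add: Suc.IH INFM_disj_distrib)
qed auto

lemma not_big_empty [simp]: "\<not> big n {}"
  by (induction n) auto

lemma big_UN: "finite I \<Longrightarrow> big n (\<Union>i\<in>I. A i) \<longleftrightarrow> (\<exists>i\<in>I. big n (A i))"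
  by (induction I rule: finite_induct) (auto simp: big_Un)

lemma big_lists: "big n {xs. length xs = n}"
  by (induction n) (auto simp: INFM_nat)

text \<open>Lists of another length never count, so \<open>big n\<close> and the classes built on it
  can be applied to arbitrary sets of lists, such as \<open>UNIV\<close> or a complement, without
  cutting them down to omega^n.\<close>

lemma big_Int_lists: "big n (A \<inter> {xs. length xs = n}) \<longleftrightarrow> big n A"
proof (induction n arbitrary: A)
  case (Suc n)
  have "{xs. a # xs \<in> A \<inter> {xs. length xs = Suc n}} = {xs. a # xs \<in> A} \<inter> {xs. length xs = n}" for a
    by auto
  then show ?case
    by (simp add: Suc.IH)
qed auto

lemma not_big_finite: "finite A \<Longrightarrow> n > 0 \<Longrightarrow> \<not> big n A"
proof (induction n arbitrary: A)
  case (Suc n)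
  have "finite {a. {xs. a # xs \<in> A} \<noteq> {}}"
    by (rule finite_subset[OF _ finite_imageI[OF Suc.prems(1), of hd]]) force
  then have "finite {a. big n {xs. a # xs \<in> A}}"
    by (rule finite_subset[rotated]) (metis (lifting) Collect_mono not_big_empty)
  then show ?case
    by (simp add: Inf_many_def)
qed simp

section \<open>Increasing maps of the lexicographic order\<close>

lemma Cons_in_lexn:
  "(x # xs, y # ys) \<in> lexn less_than (Suc n) \<longleftrightarrow>
     length xs = n \<and> length ys = n \<and> (x < y \<or> x = y \<and> (xs, ys) \<in> lexn less_than n)"
  by (auto intro!: image_eqI[of _ _ "((x, xs), (y, ys))"])

lemma lexn_irrefl: "(xs, xs) \<notin> lexn less_than n"
  using wf_lexn[OF wf_less_than, of n] by auto

text \<open>At a least counterexample \<open>z\<close>, monotonicity would make \<open>f z\<close> a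
  smaller one. This is the rigidity of well-orders that excludes embeddings into proper initial
  segments.\<close>

lemma lexn_self_map_unbounded:
  assumes "\<And>x y. (x, y) \<in> lexn less_than n \<Longrightarrow> (f x, f y) \<in> lexn less_than n"
  shows "(f z, z) \<notin> lexn less_than n"
  using wf_lexn[OF wf_less_than, of n]
proof (induction z rule: wf_induct_rule)
  case (less z)
  then show ?case using assms by blast
qed

text \<open>Infinitely many first coordinates have a big section; they are enumerated increasingly
  and each section is treated recursively. The clause on images is there to transfer a reduction
  from a big set back to all of omega^n.\<close>

lemma big_imp_embedding:
  assumes "big n P"
  shows "\<exists>f. (\<forall>x. length x = n \<longrightarrow> f x \<in> P \<and> length (f x) = n) \<and>
    (\<forall>x y. (x, y) \<in> lexn less_than n \<longrightarrow> (f x, f y) \<in> lexn less_than n) \<and>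
    (\<forall>X. X \<subseteq> {xs. length xs = n} \<longrightarrow> big n (f ` X) = big n X)"
  using assms
proof (induction n arbitrary: P)
  case 0
  then show ?case by (intro exI[of _ id]) auto
next
  case (Suc n)
  let ?S = "{a. big n {xs. a # xs \<in> P}}"
  have inf: "infinite ?S"
    using Suc.prems by (simp add: Inf_many_def)
  have "\<forall>a\<in>?S. \<exists>f. (\<forall>x. length x = n \<longrightarrow> a # f x \<in> P \<and> length (f x) = n) \<and>
    (\<forall>x y. (x, y) \<in> lexn less_than n \<longrightarrow> (f x, f y) \<in> lexn less_than n) \<and>
    (\<forall>X. X \<subseteq> {xs. length xs = n} \<longrightarrow> big n (f ` X) = big n X)"
  proof
    fix a assume "a \<in> ?S"
    then have "big n {xs. a # xs \<in> P}" by simp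
    from Suc.IH[OF this] show "\<exists>f. (\<forall>x. length x = n \<longrightarrow> a # f x \<in> P \<and> length (f x) = n) \<and>
      (\<forall>x y. (x, y) \<in> lexn less_than n \<longrightarrow> (f x, f y) \<in> lexn less_than n) \<and>
      (\<forall>X. X \<subseteq> {xs. length xs = n} \<longrightarrow> big n (f ` X) = big n X)"
      unfolding mem_Collect_eq .
  qed
  from bchoice[OF this] obtain f where f: "\<And>a x. a \<in> ?S \<Longrightarrow> length x = n \<Longrightarrow> a # f a x \<in> P \<and> length (f a x) = n"
    "\<And>a x y. a \<in> ?S \<Longrightarrow> (x, y) \<in> lexn less_than n \<Longrightarrow> (f a x, f a y) \<in> lexn less_than n"
    "\<And>a X. a \<in> ?S \<Longrightarrow> X \<subseteq> {xs. length xs = n} \<Longrightarrow> big n (f a ` X) = big n X"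
  proof (elim exE, goal_cases)
    case (1 f)
    show thesis by (rule 1(1)[of f]; use 1(2) in blast)
  qed
  define e where "e = enumerate ?S"
  have e: "e a \<in> ?S" for a
    using enumerate_in_set[OF inf] by (simp add: e_def)
  have mono: "e a < e b \<longleftrightarrow> a < b" for a b
    using inf by (simp add: e_def)
  have inj: "inj e"
    using inf unfolding e_def by (intro strict_mono_imp_inj_on strict_mono_enumerate)
  define g where "g x = e (hd x) # f (e (hd x)) (tl x)" for x
  have "g x \<in> P \<and> length (g x) = Suc n" if "length x = Suc n" for x
    using f(1)[OF e, of "tl x" "hd x"] that by (simp add: g_def)
  moreover have "(g x, g y) \<in> lexn less_than (Suc n)" if "(x, y) \<in> lexn less_than (Suc n)" for x y
  proof -
    have "length x = Suc n" "length y = Suc n"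
      using lexn_length[OF that] by auto
    then obtain a as b bs where [simp]: "x = a # as" "y = b # bs" and len: "length as = n" "length bs = n"
      by (auto simp: length_Suc_conv)
    show ?thesis
      using that f(2)[OF e, of as bs] f(1)[OF e, of as] f(1)[OF e, of bs] len
      by (auto simp: g_def Cons_in_lexn mono simp del: lexn.simps(2))
  qed
  moreover have "big (Suc n) (g ` X) = big (Suc n) X" if "X \<subseteq> {xs. length xs = Suc n}" for X
  proof -
    have "e a # ys \<in> g ` X \<longleftrightarrow> ys \<in> f (e a) ` {xs. a # xs \<in> X}" for a ys
    proof
      assume "e a # ys \<in> g ` X"
      then obtain x where x: "x \<in> X" "e a = e (hd x)" "ys = f (e (hd x)) (tl x)"
        by (auto simp: g_def)
      moreover have "x = hd x # tl x"
        using that x(1) by (cases x) auto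
      ultimately have "a # tl x \<in> X" "ys = f (e a) (tl x)"
        using injD[OF inj] by metis+
      then show "ys \<in> f (e a) ` {xs. a # xs \<in> X}" by blast
    next
      assume "ys \<in> f (e a) ` {xs. a # xs \<in> X}"
      then obtain xs where "a # xs \<in> X" "ys = f (e a) xs" by blast
      then show "e a # ys \<in> g ` X"
        by (intro image_eqI[of _ _ "a # xs"]) (auto simp: g_def)
    qed
    then have sec: "{xs. e a # xs \<in> g ` X} = f (e a) ` {xs. a # xs \<in> X}" for a
      by blast
    have "big n {xs. e a # xs \<in> g ` X} = big n {xs. a # xs \<in> X}" for a
      unfolding sec using that by (intro f(3) e) auto
    moreover have "{xs. c # xs \<in> g ` X} = {}" if "c \<notin> range e" for c
      using that by (auto simp: g_def)
    ultimately have "big n {xs. c # xs \<in> g ` X} \<longleftrightarrow> c \<in> e ` {a. big n {xs. a # xs \<in> X}}" for c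
      using inj by (cases "c \<in> range e") (auto simp: inj_eq)
    then have "{c. big n {xs. c # xs \<in> g ` X}} = e ` {a. big n {xs. a # xs \<in> X}}"
      by blast
    then show ?thesis
      using inj by (simp add: Inf_many_def finite_image_iff[OF inj_on_subset[OF inj subset_UNIV]])
  qed
  ultimately show ?case by (intro exI[of _ g]) blast
qed

text \<open>From some \<open>N\<close> on, all sections are small and thus bounded by induction. The
  blocks below \<open>N\<close> stay in place and all later ones are lined up inside the single
  block \<open>N\<close>, so that the image ends before block \<open>N + 1\<close>. There is room
  because a sum of omega many ordinals below omega^n is at most omega^n.\<close>

lemma not_big_imp_bounded_embedding:
  assumes "\<not> big n P" "P \<subseteq> {xs. length xs = n}"
  shows "\<exists>f z. length z = n \<and> (\<forall>x\<in>P. (f x, z) \<in> lexn less_than n) \<and>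
    (\<forall>x\<in>P. \<forall>y\<in>P. (x, y) \<in> lexn less_than n \<longrightarrow> (f x, f y) \<in> lexn less_than n)"
  using assms
proof (induction n arbitrary: P)
  case 0
  then show ?case by auto
next
  case (Suc n)
  let ?P = "\<lambda>a. {xs. a # xs \<in> P}"
  obtain N where N: "\<not> big n (?P a)" if "a \<ge> N" for a
    using Suc.prems(1) by (auto simp: INFM_nat_le)
  have P_sub: "?P a \<subseteq> {xs. length xs = n}" for a
    using Suc.prems(2) by auto
  have "\<forall>a. a \<ge> N \<longrightarrow> (\<exists>f z. length z = n \<and> (\<forall>x\<in>?P a. (f x, z) \<in> lexn less_than n) \<and>
    (\<forall>x\<in>?P a. \<forall>y\<in>?P a. (x, y) \<in> lexn less_than n \<longrightarrow> (f x, f y) \<in> lexn less_than n))"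
    using Suc.IH[OF N P_sub] by blast
  then obtain f z where fz: "\<And>a. a \<ge> N \<Longrightarrow> length (z a) = n"
    "\<And>a x. a \<ge> N \<Longrightarrow> a # x \<in> P \<Longrightarrow> (f a x, z a) \<in> lexn less_than n"
    "\<And>a x y. a \<ge> N \<Longrightarrow> a # x \<in> P \<Longrightarrow> a # y \<in> P \<Longrightarrow> (x, y) \<in> lexn less_than n \<Longrightarrow>
        (f a x, f a y) \<in> lexn less_than n"
    by simp metis
  \<comment> \<open>\<open>hd (z b)\<close> bounds the leading coordinate in the image of section
    \<open>b\<close>; shifting the leading coordinate of section \<open>a\<close> by
    \<open>h a\<close> therefore puts it strictly above all earlier sections.\<close>
  define h where "h a = (\<Sum>b<a. Suc (hd (z b)))" for a
  have h: "h a + hd (z a) < h b" if "a < b" for a b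
  proof -
    have "h a + Suc (hd (z a)) = h (Suc a)" by (simp add: h_def)
    also have "\<dots> \<le> h b" unfolding h_def using that by (intro sum_mono2) auto
    finally show ?thesis by simp
  qed
  define g where "g x = (if hd x < N then x else
      let y = f (hd x) (tl x) in N # (h (hd x) + hd y) # tl y)" for x
  have hd_le: "hd xs \<le> hd ys" if "(xs, ys) \<in> lexn less_than n" for xs ys
    using that lexn_length[OF that]
    by (cases n; cases xs; cases ys) (auto simp: Cons_in_lexn simp del: lexn.simps(2))
  \<comment> \<open>For \<open>n = 0\<close> nothing lies below \<open>z a\<close>, so the sections
    from \<open>N\<close> on are empty. If one of them has an element, \<open>hd\<close> and
    \<open>tl\<close> are applied to nonempty lists.\<close>
  have npos: "n > 0" and len: "length (f a x) = n" if "a \<ge> N" "a # x \<in> P" for a x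
    using fz(2)[OF that] lexn_length by (cases n; auto)+
  have shift: "((c + hd xs) # tl xs, (c + hd ys) # tl ys) \<in> lexn less_than n"
    if "(xs, ys) \<in> lexn less_than n" for xs ys c
    using that lexn_length[OF that]
    by (cases n; cases xs; cases ys) (auto simp: Cons_in_lexn simp del: lexn.simps(2))
  have shift': "((c + hd xs) # tl xs, (d + hd ys) # tl ys) \<in> lexn less_than n"
    if "c + hd xs < d" "length xs = n" "length ys = n" "n > 0" for xs ys c d
    using that by (cases n; cases xs; cases ys) (auto simp: Cons_in_lexn simp del: lexn.simps(2))
  have "(g x, Suc N # replicate n 0) \<in> lexn less_than (Suc n)" if x: "x \<in> P" for x
  proof -
    obtain a as where [simp]: "x = a # as" and "length as = n"
      using x Suc.prems(2) by (auto simp: length_Suc_conv)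
    then show ?thesis
      using x len[of a as] npos[of a as]
      by (auto simp: g_def Let_def Cons_in_lexn simp del: lexn.simps(2))
  qed
  moreover have "(g x, g y) \<in> lexn less_than (Suc n)"
    if x: "x \<in> P" and y: "y \<in> P" and xy: "(x, y) \<in> lexn less_than (Suc n)" for x y
  proof -
    obtain a as b bs where [simp]: "x = a # as" "y = b # bs" and l: "length as = n" "length bs = n"
      using lexn_length[OF xy] by (auto simp: length_Suc_conv)
    have ab: "a < b \<or> a = b \<and> (as, bs) \<in> lexn less_than n"
      using xy by (simp add: Cons_in_lexn del: lexn.simps(2))
    consider "b < N" | "a < N" "N \<le> b" | "N \<le> a" "a = b" | "N \<le> a" "a < b"
      using ab by (meson linorder_not_less)
    then show ?thesis
    proof cases
      case 1
      then show ?thesis using ab xy by (auto simp: g_def)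
    next
      case 2
      then show ?thesis using y l len[of b bs] npos[of b bs]
        by (auto simp: g_def Let_def Cons_in_lexn simp del: lexn.simps(2))
    next
      case 3
      then have "(f a as, f a bs) \<in> lexn less_than n"
        using fz(3) x y ab by auto
      note * = shift[OF this, of "h a"]
      show ?thesis
        using 3 * lexn_length[OF *]
        by (simp add: g_def Let_def Cons_in_lexn del: lexn.simps(2))
    next
      case 4
      have "h a + hd (f a as) < h b"
        using hd_le[OF fz(2)[of a as]] h[of a b] 4 x by simp
      from shift'[OF this] have *: "((h a + hd (f a as)) # tl (f a as), (h b + hd (f b bs)) # tl (f b bs)) \<in> lexn less_than n"
        using len[of a as] len[of b bs] npos[of a as] 4 x y by auto
      then show ?thesis
        using 4 lexn_length[OF *] by (simp add: g_def Let_def Cons_in_lexn del: lexn.simps(2))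
    qed
  qed
  ultimately show ?case
    by (intro exI[of _ g] exI[of _ "Suc N # replicate n 0"]) auto
qed

lemma omega_pow_minus_Id: "omega_pow n - Id = lexn less_than n"
  using lexn_irrefl unfolding omega_pow_def by (auto simp: Id_on_def)

lemma embed_omega_pow_strict:
  assumes "embed (Restr (omega_pow n) P) (Restr (omega_pow n) Q) f" "x \<in> P" "y \<in> P"
    "(x, y) \<in> lexn less_than n"
  shows "(f x, f y) \<in> lexn less_than n"
proof -
  have wo: "Well_order (Restr (omega_pow n) P)" for P
    using Well_order_omega_pow by (rule Well_order_Restr)
  have xy: "(x, y) \<in> Restr (omega_pow n) P"
    using assms by (simp add: omega_pow_def)
  have "compat (Restr (omega_pow n) P) (Restr (omega_pow n) Q) f"
    using embed_compat[OF assms(1)] .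
  then have "(f x, f y) \<in> omega_pow n"
    using xy by (auto simp: compat_def)
  moreover have "f x \<noteq> f y"
  proof -
    have "inj_on f (Field (Restr (omega_pow n) P))"
      using embed_inj_on[OF wo assms(1)] .
    moreover have "x \<noteq> y" using assms(4) lexn_irrefl by auto
    ultimately show ?thesis using xy by (auto simp: inj_on_def Field_def)
  qed
  ultimately show ?thesis
    using omega_pow_minus_Id by blast
qed

lemma Restr_omega_pow_lists: "Restr (omega_pow n) {xs. length xs = n} = omega_pow n"
  using Field_omega_pow[of n] by (auto simp: Field_def)

text \<open>Both directions refute an increasing self-map of omega^n that sends some
  \<open>z\<close> below itself. A big \<open>P\<close> contains an order copy of omega^n, which an
  embedding of \<open>P\<close> would carry below \<open>z\<close>; into a small \<open>P\<close>,
  an embedding of omega^n could be followed by the squeezing map below \<open>z\<close>.\<close>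

lemma omega_ideal_eq: "omega_ideal n = {P. P \<subseteq> {xs. length xs = n} \<and> \<not> big n P}"
proof -
  have wo: "Well_order (Restr (omega_pow n) P)" for P
    using Well_order_omega_pow by (rule Well_order_Restr)
  have "Restr (omega_pow n) P <o omega_pow n \<longleftrightarrow> \<not> big n P" if P: "P \<subseteq> {xs. length xs = n}" for P
  proof
    assume less: "Restr (omega_pow n) P <o omega_pow n"
    then obtain z where z: "Restr (omega_pow n) P =o Restr (omega_pow n) (underS (omega_pow n) z)"
      using ordLess_iff_ordIso_Restr[OF Well_order_omega_pow wo] by blast
    then obtain f where f: "embed (Restr (omega_pow n) P) (Restr (omega_pow n) (underS (omega_pow n) z)) f"
      unfolding ordIso_def BNF_Wellorder_Embedding.iso_def by blast
    have fz: "(f x, z) \<in> lexn less_than n" if "x \<in> P" for x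
    proof -
      have "(x, x) \<in> Restr (omega_pow n) P"
        using that P by (auto simp: omega_pow_def)
      then have "f x \<in> underS (omega_pow n) z"
        using embed_in_Field[OF f, of x] by (auto simp: Field_def)
      then show ?thesis
        unfolding underS_def using omega_pow_minus_Id by blast
    qed
    have "length z = n" if "P \<noteq> {}"
      using fz lexn_length that by blast
    show "\<not> big n P"
    proof
      assume "big n P"
      from big_imp_embedding[OF this] obtain g where
        g: "\<And>x. length x = n \<Longrightarrow> g x \<in> P"
           "\<And>x y. (x, y) \<in> lexn less_than n \<Longrightarrow> (g x, g y) \<in> lexn less_than n"
        by auto
      have "(f (g x), f (g y)) \<in> lexn less_than n" if "(x, y) \<in> lexn less_than n" for x y
        using embed_omega_pow_strict[OF f g(1) g(1) g(2)[OF that]] lexn_length[OF that] by blast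
      from lexn_self_map_unbounded[of n "\<lambda>x. f (g x)", OF this]
      have "(f (g z), z) \<notin> lexn less_than n" .
      moreover have "P \<noteq> {}"
        using \<open>big n P\<close> by auto
      ultimately show False
        using fz g(1) \<open>P \<noteq> {} \<Longrightarrow> length z = n\<close> by blast
    qed
  next
    assume "\<not> big n P"
    from not_big_imp_bounded_embedding[OF this P] obtain g z where
      g: "length z = n" "\<And>x. x \<in> P \<Longrightarrow> (g x, z) \<in> lexn less_than n"
         "\<And>x y. x \<in> P \<Longrightarrow> y \<in> P \<Longrightarrow> (x, y) \<in> lexn less_than n \<Longrightarrow> (g x, g y) \<in> lexn less_than n"
      by blast
    have "\<not> omega_pow n \<le>o Restr (omega_pow n) P"
    proof
      assume "omega_pow n \<le>o Restr (omega_pow n) P"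
      then obtain f where f: "embed (Restr (omega_pow n) {xs. length xs = n}) (Restr (omega_pow n) P) f"
        unfolding ordLeq_def Restr_omega_pow_lists by blast
      have fP: "f x \<in> P" if "length x = n" for x
        using embed_in_Field[OF f[unfolded Restr_omega_pow_lists], of x] that Field_omega_pow
        by (auto simp: Field_def)
      have "(g (f x), g (f y)) \<in> lexn less_than n" if "(x, y) \<in> lexn less_than n" for x y
        using embed_omega_pow_strict[OF f _ _ that] g(3) fP lexn_length[OF that] by blast
      from lexn_self_map_unbounded[of n "\<lambda>x. g (f x)", OF this]
      show False using g(1,2) fP by blast
    qed
    then show "Restr (omega_pow n) P <o omega_pow n"
      using not_ordLeq_iff_ordLess[OF wo Well_order_omega_pow] by blast
  qed
  then show ?thesis
    unfolding omega_ideal_def Field_omega_pow by auto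
qed

section \<open>The rings \<open>\<R>\<^sub>n\<close>\<close>

lemma cring_powerset_ring: "cring (powerset_ring W)"
proof (rule cringI)
  show "abelian_group (powerset_ring W)"
  proof (rule abelian_groupI)
    show "\<exists>y\<in>carrier (powerset_ring W). y \<oplus>\<^bsub>powerset_ring W\<^esub> x = \<zero>\<^bsub>powerset_ring W\<^esub>"
      if "x \<in> carrier (powerset_ring W)" for x
      using that by (intro bexI[of _ x]) (auto simp: powerset_ring_def)
  qed (auto simp: powerset_ring_def)
  show "comm_monoid (powerset_ring W)"
    by (rule comm_monoidI) (auto simp: powerset_ring_def)
qed (auto simp: powerset_ring_def)

lemma ideal_omega_ideal:
  "ideal (omega_ideal n) (powerset_ring (Field (omega_pow n)))"
proof -
  let ?P = "powerset_ring (Field (omega_pow n))"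
  interpret cring ?P by (rule cring_powerset_ring)
  have neg: "\<ominus>\<^bsub>?P\<^esub> A = A" if "A \<subseteq> Field (omega_pow n)" for A
    by (rule minus_equality) (use that in \<open>auto simp: powerset_ring_def\<close>)
  have sd: "\<not> big n (sym_diff A B)" if "\<not> big n A" "\<not> big n B" for A B
    using that big_mono[of n "sym_diff A B" "A \<union> B"] by (auto simp: big_Un)
  show ?thesis
  proof (rule idealI)
    show "ring ?P" by (rule ring_axioms)
    show "subgroup (omega_ideal n) (add_monoid ?P)"
    proof
      show "inv\<^bsub>add_monoid ?P\<^esub> x \<in> omega_ideal n" if "x \<in> omega_ideal n" for x
        using neg[of x] that unfolding a_inv_def by (auto simp: omega_ideal_eq Field_omega_pow)
    qed (use sd in \<open>auto simp: powerset_ring_def omega_ideal_eq Field_omega_pow\<close>)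
    show "x \<otimes>\<^bsub>?P\<^esub> a \<in> omega_ideal n" "a \<otimes>\<^bsub>?P\<^esub> x \<in> omega_ideal n"
      if "a \<in> omega_ideal n" "x \<in> carrier ?P" for a x
      using that big_mono[of n "a \<inter> x" a]
      by (auto simp: powerset_ring_def omega_ideal_eq Int_commute)
  qed
qed

lemma cring_omega_ring: "cring (omega_ring n)"
  unfolding omega_ring_def
  by (rule ideal.quotient_is_cring[OF ideal_omega_ideal cring_powerset_ring])

text \<open>The intersection makes the class total on sets of lists, so \<open>UNIV\<close>,
  \<open>{}\<close> or any constructed set is a representative, without a carrier condition.\<close>

definition omega_class :: "nat \<Rightarrow> nat list set \<Rightarrow> nat list set set"
  where "omega_class n A = omega_equiv n `` {A \<inter> {xs. length xs = n}}"

lemma omega_class_coset: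
  "omega_class n A = omega_ideal n +>\<^bsub>powerset_ring (Field (omega_pow n))\<^esub> (A \<inter> {xs. length xs = n})"
  unfolding omega_class_def by (rule omega_coset_eq_class[symmetric]) (simp add: Field_omega_pow)

lemma carrier_omega_ring_eq: "carrier (omega_ring n) = range (omega_class n)"
proof -
  have "Pow {xs :: nat list. length xs = n} = range (\<lambda>A. A \<inter> {xs. length xs = n})"
    by blast
  then show ?thesis
    unfolding carrier_omega_ring Field_omega_pow quotient_def by (auto simp: omega_class_def)
qed

lemma omega_class_closed [simp]: "omega_class n A \<in> carrier (omega_ring n)"
  by (simp add: carrier_omega_ring_eq)

lemma omega_class_eq_iff: "omega_class n A = omega_class n B \<longleftrightarrow> \<not> big n (sym_diff A B)"
proof -
  let ?W = "{xs :: nat list. length xs = n}"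
  have mem: "(A \<inter> ?W, C) \<in> omega_equiv n \<longleftrightarrow> C \<subseteq> ?W \<and> \<not> big n (sym_diff A C)" for A C
  proof (cases "C \<subseteq> ?W")
    case True
    then have "sym_diff (A \<inter> ?W) C = sym_diff A C \<inter> ?W" by blast
    then show ?thesis
      using True big_Int_lists[of n "sym_diff A C"]
      unfolding omega_equiv_def omega_ideal_eq Field_omega_pow by auto
  qed (simp add: omega_equiv_def Field_omega_pow)
  have tr: "big n (sym_diff A C)" if "big n (sym_diff B C)" "\<not> big n (sym_diff A B)" for A B C
    using that big_mono[of n "sym_diff B C" "sym_diff A B \<union> sym_diff A C"] by (auto simp: big_Un)
  show ?thesis
  proof
    assume eq: "omega_class n A = omega_class n B"
    have "sym_diff B (B \<inter> ?W) \<inter> ?W = {}" by blast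
    then have "\<not> big n (sym_diff B (B \<inter> ?W))"
      using big_Int_lists[of n "sym_diff B (B \<inter> ?W)"] not_big_empty by metis
    then have "B \<inter> ?W \<in> omega_class n B"
      unfolding omega_class_def Image_singleton_iff mem by blast
    then have "\<not> big n (sym_diff A (B \<inter> ?W) \<inter> ?W)"
      unfolding eq[symmetric] unfolding omega_class_def Image_singleton_iff mem
      by (simp add: big_Int_lists)
    moreover have "sym_diff A (B \<inter> ?W) \<inter> ?W = sym_diff A B \<inter> ?W" by blast
    ultimately show "\<not> big n (sym_diff A B)" by (simp add: big_Int_lists)
  next
    assume nb: "\<not> big n (sym_diff A B)"
    then have nb': "\<not> big n (sym_diff B A)" by (simp add: Un_commute)
    show "omega_class n A = omega_class n B"
    proof (rule Set.set_eqI)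
      fix C
      have "big n (sym_diff B C) \<longleftrightarrow> big n (sym_diff A C)"
        using tr[OF _ nb] tr[OF _ nb'] by blast
      then show "C \<in> omega_class n A \<longleftrightarrow> C \<in> omega_class n B"
        unfolding omega_class_def Image_singleton_iff mem by simp
    qed
  qed
qed

lemma omega_ring_simps [simp]:
  "omega_class n A \<otimes>\<^bsub>omega_ring n\<^esub> omega_class n B = omega_class n (A \<inter> B)"
  "omega_class n A \<oplus>\<^bsub>omega_ring n\<^esub> omega_class n B = omega_class n (sym_diff A B)"
  "\<one>\<^bsub>omega_ring n\<^esub> = omega_class n UNIV"
  "\<zero>\<^bsub>omega_ring n\<^esub> = omega_class n {}"
proof -
  let ?P = "powerset_ring (Field (omega_pow n))" and ?W = "{xs :: nat list. length xs = n}"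
  interpret ideal "omega_ideal n" ?P by (rule ideal_omega_ideal)
  have cl: "A \<inter> ?W \<in> carrier ?P" for A
    by (simp add: powerset_ring_def Field_omega_pow)
  have m: "(A \<inter> ?W) \<otimes>\<^bsub>?P\<^esub> (B \<inter> ?W) = (A \<inter> B) \<inter> ?W" for A B
    by (auto simp: powerset_ring_def)
  have a: "(A \<inter> ?W) \<oplus>\<^bsub>?P\<^esub> (B \<inter> ?W) = sym_diff A B \<inter> ?W" for A B
    by (auto simp: powerset_ring_def)
  show "omega_class n A \<otimes>\<^bsub>omega_ring n\<^esub> omega_class n B = omega_class n (A \<inter> B)"
    unfolding omega_class_coset omega_ring_def FactRing_def
    using rcoset_mult_add[OF cl cl] by (simp add: m)
  show "omega_class n A \<oplus>\<^bsub>omega_ring n\<^esub> omega_class n B = omega_class n (sym_diff A B)"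
    unfolding omega_class_coset omega_ring_def FactRing_def
    using a_rcos_sum[OF cl cl] by (simp add: a)
  show "\<one>\<^bsub>omega_ring n\<^esub> = omega_class n UNIV"
    unfolding omega_class_coset omega_ring_def FactRing_def
    by (simp add: powerset_ring_def Field_omega_pow)
  show "\<zero>\<^bsub>omega_ring n\<^esub> = omega_class n {}"
    unfolding omega_class_coset omega_ring_def FactRing_def
    using a_rcos_zero[OF ideal_axioms, of "{}"] by (simp add: omega_ideal_eq)
qed

lemma omega_ring_nontrivial: "\<one>\<^bsub>omega_ring n\<^esub> \<noteq> \<zero>\<^bsub>omega_ring n\<^esub>"
  using big_mono[OF big_lists, of n UNIV] by (simp add: omega_class_eq_iff)

section \<open>Matrix rings\<close>

lemma (in abelian_monoid) finsum_swap:
  assumes "finite A" "finite B" "\<And>i j. i \<in> A \<Longrightarrow> j \<in> B \<Longrightarrow> f i j \<in> carrier G"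
  shows "(\<Oplus>i\<in>A. \<Oplus>j\<in>B. f i j) = (\<Oplus>j\<in>B. \<Oplus>i\<in>A. f i j)"
  using assms(1,3)
proof (induction A rule: finite_induct)
  case (insert x A)
  then have "(\<Oplus>i\<in>insert x A. \<Oplus>j\<in>B. f i j) = (\<Oplus>j\<in>B. f x j) \<oplus> (\<Oplus>j\<in>B. \<Oplus>i\<in>A. f i j)"
    by (subst finsum_insert) (auto intro!: finsum_closed)
  also have "\<dots> = (\<Oplus>j\<in>B. f x j \<oplus> (\<Oplus>i\<in>A. f i j))"
    using insert.prems by (subst finsum_addf) (auto intro!: finsum_closed)
  also have "\<dots> = (\<Oplus>j\<in>B. \<Oplus>i\<in>insert x A. f i j)"
    using insert by (intro finsum_cong') (auto intro!: finsum_closed simp: finsum_insert Pi_def)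
  finally show ?case .
qed (simp add: assms)

lemma matrix_ring_eqI:
  assumes "A \<in> carrier (matrix_ring k R)" "B \<in> carrier (matrix_ring k R)"
    "\<And>i j. i < k \<Longrightarrow> j < k \<Longrightarrow> A (i, j) = B (i, j)"
  shows "A = B"
  using assms by (intro PiE_ext[of A "{..<k} \<times> {..<k}" "\<lambda>_. carrier R"]) (auto simp: matrix_ring_def)

lemma matrix_ring_entry [simp]:
  assumes "i < k" "j < k"
  shows "(A \<otimes>\<^bsub>matrix_ring k R\<^esub> B) (i, j) = (\<Oplus>\<^bsub>R\<^esub>l\<in>{..<k}. A (i, l) \<otimes>\<^bsub>R\<^esub> B (l, j))"
    "(A \<oplus>\<^bsub>matrix_ring k R\<^esub> B) (i, j) = A (i, j) \<oplus>\<^bsub>R\<^esub> B (i, j)"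
    "\<zero>\<^bsub>matrix_ring k R\<^esub> (i, j) = \<zero>\<^bsub>R\<^esub>"
    "\<one>\<^bsub>matrix_ring k R\<^esub> (i, j) = (if i = j then \<one>\<^bsub>R\<^esub> else \<zero>\<^bsub>R\<^esub>)"
  using assms by (auto simp: matrix_ring_def)

lemma matrix_ring_carrierD:
  "A \<in> carrier (matrix_ring k R) \<Longrightarrow> i < k \<Longrightarrow> j < k \<Longrightarrow> A (i, j) \<in> carrier R"
  by (auto simp: matrix_ring_def)

context ring
begin

lemma finsum_delta:
  assumes "finite A" "i \<in> A" "x \<in> carrier R"
  shows "(\<Oplus>l\<in>A. if i = l then x else \<zero>) = x"
  using add.finprod_singleton[of i A "\<lambda>_. x"] assms by simp

lemma matrix_ring_closed:
  assumes "A \<in> carrier (matrix_ring k R)" "B \<in> carrier (matrix_ring k R)"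
  shows "A \<otimes>\<^bsub>matrix_ring k R\<^esub> B \<in> carrier (matrix_ring k R)"
    "A \<oplus>\<^bsub>matrix_ring k R\<^esub> B \<in> carrier (matrix_ring k R)"
  using assms by (auto simp: matrix_ring_def PiE_iff intro!: finsum_closed)

lemma matrix_ring_units_closed:
  "\<zero>\<^bsub>matrix_ring k R\<^esub> \<in> carrier (matrix_ring k R)" "\<one>\<^bsub>matrix_ring k R\<^esub> \<in> carrier (matrix_ring k R)"
  by (auto simp: matrix_ring_def)

lemma matrix_ring_is_ring: "ring (matrix_ring k R)"
proof (rule ringI)
  note cl = matrix_ring_closed matrix_ring_units_closed
  note ent = matrix_ring_carrierD[where k = k and R = R]
  show "abelian_group (matrix_ring k R)"
  proof (rule abelian_groupI; (intro cl; assumption)?)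
    show "\<exists>y\<in>carrier (matrix_ring k R). y \<oplus>\<^bsub>matrix_ring k R\<^esub> x = \<zero>\<^bsub>matrix_ring k R\<^esub>"
      if x: "x \<in> carrier (matrix_ring k R)" for x
    proof (rule bexI)
      let ?y = "\<lambda>(i, j)\<in>{..<k} \<times> {..<k}. \<ominus> x (i, j)"
      show y: "?y \<in> carrier (matrix_ring k R)"
        using x by (auto simp: matrix_ring_def)
      show "?y \<oplus>\<^bsub>matrix_ring k R\<^esub> x = \<zero>\<^bsub>matrix_ring k R\<^esub>"
        using x by (intro matrix_ring_eqI[of _ k R] cl y) (auto simp: l_neg ent)
    qed
  qed (auto intro!: matrix_ring_eqI[of _ k R] cl simp: a_ac ent)
  show "Group.monoid (matrix_ring k R)"
  proof (rule monoidI; (intro cl; assumption)?)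
    fix A B C
    assume ABC: "A \<in> carrier (matrix_ring k R)" "B \<in> carrier (matrix_ring k R)" "C \<in> carrier (matrix_ring k R)"
    show "A \<otimes>\<^bsub>matrix_ring k R\<^esub> B \<otimes>\<^bsub>matrix_ring k R\<^esub> C = A \<otimes>\<^bsub>matrix_ring k R\<^esub> (B \<otimes>\<^bsub>matrix_ring k R\<^esub> C)"
    proof (rule matrix_ring_eqI[of _ k R])
      fix i j assume ij: "i < k" "j < k"
      have "(\<Oplus>l\<in>{..<k}. (A \<otimes>\<^bsub>matrix_ring k R\<^esub> B) (i, l) \<otimes> C (l, j)) =
        (\<Oplus>l\<in>{..<k}. \<Oplus>m\<in>{..<k}. A (i, m) \<otimes> B (m, l) \<otimes> C (l, j))"
        using ABC ij by (intro finsum_cong') (auto simp: finsum_ldistr ent intro!: finsum_closed)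
      also have "\<dots> = (\<Oplus>m\<in>{..<k}. \<Oplus>l\<in>{..<k}. A (i, m) \<otimes> B (m, l) \<otimes> C (l, j))"
        using ABC ij by (intro finsum_swap) (auto simp: ent)
      also have "\<dots> = (\<Oplus>m\<in>{..<k}. A (i, m) \<otimes> (B \<otimes>\<^bsub>matrix_ring k R\<^esub> C) (m, j))"
        using ABC ij
        by (intro finsum_cong') (auto simp: finsum_rdistr ent m_assoc intro!: finsum_closed finsum_cong')
      finally show "(A \<otimes>\<^bsub>matrix_ring k R\<^esub> B \<otimes>\<^bsub>matrix_ring k R\<^esub> C) (i, j) =
          (A \<otimes>\<^bsub>matrix_ring k R\<^esub> (B \<otimes>\<^bsub>matrix_ring k R\<^esub> C)) (i, j)"
        using ij by simp
    qed (intro cl ABC)+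
  next
    fix A assume A: "A \<in> carrier (matrix_ring k R)"
    show "\<one>\<^bsub>matrix_ring k R\<^esub> \<otimes>\<^bsub>matrix_ring k R\<^esub> A = A"
    proof (rule matrix_ring_eqI[of _ k R])
      fix i j assume ij: "i < k" "j < k"
      have "(\<Oplus>l\<in>{..<k}. \<one>\<^bsub>matrix_ring k R\<^esub> (i, l) \<otimes> A (l, j)) = (\<Oplus>l\<in>{..<k}. if i = l then A (i, j) else \<zero>)"
        using A ij by (intro finsum_cong') (auto simp: ent)
      also have "\<dots> = A (i, j)"
        using A ij by (intro finsum_delta) (auto simp: ent)
      finally show "(\<one>\<^bsub>matrix_ring k R\<^esub> \<otimes>\<^bsub>matrix_ring k R\<^esub> A) (i, j) = A (i, j)"
        using ij by simp
    qed (intro cl A)+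
    show "A \<otimes>\<^bsub>matrix_ring k R\<^esub> \<one>\<^bsub>matrix_ring k R\<^esub> = A"
    proof (rule matrix_ring_eqI[of _ k R])
      fix i j assume ij: "i < k" "j < k"
      have "(\<Oplus>l\<in>{..<k}. A (i, l) \<otimes> \<one>\<^bsub>matrix_ring k R\<^esub> (l, j)) = (\<Oplus>l\<in>{..<k}. if j = l then A (i, j) else \<zero>)"
        using A ij by (intro finsum_cong') (auto simp: ent)
      also have "\<dots> = A (i, j)"
        using A ij by (intro finsum_delta) (auto simp: ent)
      finally show "(A \<otimes>\<^bsub>matrix_ring k R\<^esub> \<one>\<^bsub>matrix_ring k R\<^esub>) (i, j) = A (i, j)"
        using ij by simp
    qed (intro cl A)+
  qed
  fix A B C
  assume ABC: "A \<in> carrier (matrix_ring k R)" "B \<in> carrier (matrix_ring k R)" "C \<in> carrier (matrix_ring k R)"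
  show "(A \<oplus>\<^bsub>matrix_ring k R\<^esub> B) \<otimes>\<^bsub>matrix_ring k R\<^esub> C =
      A \<otimes>\<^bsub>matrix_ring k R\<^esub> C \<oplus>\<^bsub>matrix_ring k R\<^esub> B \<otimes>\<^bsub>matrix_ring k R\<^esub> C"
  proof (rule matrix_ring_eqI[of _ k R])
    fix i j assume ij: "i < k" "j < k"
    have "(\<Oplus>l\<in>{..<k}. (A \<oplus>\<^bsub>matrix_ring k R\<^esub> B) (i, l) \<otimes> C (l, j)) =
        (\<Oplus>l\<in>{..<k}. A (i, l) \<otimes> C (l, j) \<oplus> B (i, l) \<otimes> C (l, j))"
      using ABC ij by (intro finsum_cong') (auto simp: l_distr ent)
    also have "\<dots> = (\<Oplus>l\<in>{..<k}. A (i, l) \<otimes> C (l, j)) \<oplus> (\<Oplus>l\<in>{..<k}. B (i, l) \<otimes> C (l, j))"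
      using ABC ij by (intro finsum_addf) (auto simp: ent)
    finally show "((A \<oplus>\<^bsub>matrix_ring k R\<^esub> B) \<otimes>\<^bsub>matrix_ring k R\<^esub> C) (i, j) =
      (A \<otimes>\<^bsub>matrix_ring k R\<^esub> C \<oplus>\<^bsub>matrix_ring k R\<^esub> B \<otimes>\<^bsub>matrix_ring k R\<^esub> C) (i, j)"
      using ij by simp
  qed (intro cl ABC)+
  show "C \<otimes>\<^bsub>matrix_ring k R\<^esub> (A \<oplus>\<^bsub>matrix_ring k R\<^esub> B) =
      C \<otimes>\<^bsub>matrix_ring k R\<^esub> A \<oplus>\<^bsub>matrix_ring k R\<^esub> C \<otimes>\<^bsub>matrix_ring k R\<^esub> B"
  proof (rule matrix_ring_eqI[of _ k R])
    fix i j assume ij: "i < k" "j < k"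
    have "(\<Oplus>l\<in>{..<k}. C (i, l) \<otimes> (A \<oplus>\<^bsub>matrix_ring k R\<^esub> B) (l, j)) =
        (\<Oplus>l\<in>{..<k}. C (i, l) \<otimes> A (l, j) \<oplus> C (i, l) \<otimes> B (l, j))"
      using ABC ij by (intro finsum_cong') (auto simp: r_distr ent)
    also have "\<dots> = (\<Oplus>l\<in>{..<k}. C (i, l) \<otimes> A (l, j)) \<oplus> (\<Oplus>l\<in>{..<k}. C (i, l) \<otimes> B (l, j))"
      using ABC ij by (intro finsum_addf) (auto simp: ent)
    finally show "(C \<otimes>\<^bsub>matrix_ring k R\<^esub> (A \<oplus>\<^bsub>matrix_ring k R\<^esub> B)) (i, j) =
      (C \<otimes>\<^bsub>matrix_ring k R\<^esub> A \<oplus>\<^bsub>matrix_ring k R\<^esub> C \<otimes>\<^bsub>matrix_ring k R\<^esub> B) (i, j)"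
      using ij by simp
  qed (intro cl ABC)+
qed

definition elementary :: "nat \<Rightarrow> nat \<Rightarrow> nat \<Rightarrow> nat \<times> nat \<Rightarrow> 'a"
  where "elementary k p q = (\<lambda>(i, j)\<in>{..<k} \<times> {..<k}. if i = p \<and> j = q then \<one> else \<zero>)"

lemma elementary_closed: "elementary k p q \<in> carrier (matrix_ring k R)"
  by (auto simp: elementary_def matrix_ring_def)

lemma elementary_mult:
  assumes "A \<in> carrier (matrix_ring k R)" "p < k" "q < k" "i < k" "j < k"
  shows "(elementary k p q \<otimes>\<^bsub>matrix_ring k R\<^esub> A) (i, j) = (if i = p then A (q, j) else \<zero>)"
    "(A \<otimes>\<^bsub>matrix_ring k R\<^esub> elementary k p q) (i, j) = (if j = q then A (i, p) else \<zero>)"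
proof -
  note ent = matrix_ring_carrierD[OF assms(1)]
  have "(\<Oplus>l\<in>{..<k}. elementary k p q (i, l) \<otimes> A (l, j)) =
      (\<Oplus>l\<in>{..<k}. if q = l then (if i = p then A (q, j) else \<zero>) else \<zero>)"
    using assms by (intro finsum_cong') (auto simp: ent elementary_def)
  also have "\<dots> = (if i = p then A (q, j) else \<zero>)"
    using assms by (intro finsum_delta) (auto simp: ent)
  finally show "(elementary k p q \<otimes>\<^bsub>matrix_ring k R\<^esub> A) (i, j) = (if i = p then A (q, j) else \<zero>)"
    using assms by simp
  have "(\<Oplus>l\<in>{..<k}. A (i, l) \<otimes> elementary k p q (l, j)) =
      (\<Oplus>l\<in>{..<k}. if p = l then (if j = q then A (i, p) else \<zero>) else \<zero>)"
    using assms by (intro finsum_cong') (auto simp: ent elementary_def)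
  also have "\<dots> = (if j = q then A (i, p) else \<zero>)"
    using assms by (intro finsum_delta) (auto simp: ent)
  finally show "(A \<otimes>\<^bsub>matrix_ring k R\<^esub> elementary k p q) (i, j) = (if j = q then A (i, p) else \<zero>)"
    using assms by simp
qed

text \<open>The matrix units satisfy E_00 E_01 = E_01, whereas E_01 E_00 = 0.\<close>

lemma matrix_ring_noncommutative:
  assumes "k \<ge> 2" "\<one> \<noteq> \<zero>"
  shows "\<exists>A\<in>carrier (matrix_ring k R). \<exists>B\<in>carrier (matrix_ring k R).
    A \<otimes>\<^bsub>matrix_ring k R\<^esub> B \<noteq> B \<otimes>\<^bsub>matrix_ring k R\<^esub> A"
proof (intro bexI)
  have "(elementary k 0 0 \<otimes>\<^bsub>matrix_ring k R\<^esub> elementary k 0 1) (0, 1) = \<one>"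
    "(elementary k 0 1 \<otimes>\<^bsub>matrix_ring k R\<^esub> elementary k 0 0) (0, 1) = \<zero>"
    using assms(1) by (auto simp: elementary_mult elementary_closed simp del: matrix_ring_entry) (auto simp: elementary_def)
  then show "elementary k 0 0 \<otimes>\<^bsub>matrix_ring k R\<^esub> elementary k 0 1 \<noteq>
      elementary k 0 1 \<otimes>\<^bsub>matrix_ring k R\<^esub> elementary k 0 0"
    using assms(2) by metis
qed (rule elementary_closed)+

definition scalar :: "nat \<Rightarrow> 'a \<Rightarrow> nat \<times> nat \<Rightarrow> 'a"
  where "scalar k x = (\<lambda>(i, j)\<in>{..<k} \<times> {..<k}. if i = j then x else \<zero>)"

lemma scalar_closed: "x \<in> carrier R \<Longrightarrow> scalar k x \<in> carrier (matrix_ring k R)"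
  by (auto simp: scalar_def matrix_ring_def)

lemma scalar_mult_entry:
  assumes "x \<in> carrier R" "A \<in> carrier (matrix_ring k R)" "i < k" "j < k"
  shows "(scalar k x \<otimes>\<^bsub>matrix_ring k R\<^esub> A) (i, j) = x \<otimes> A (i, j)"
    "(A \<otimes>\<^bsub>matrix_ring k R\<^esub> scalar k x) (i, j) = A (i, j) \<otimes> x"
proof -
  note ent = matrix_ring_carrierD[OF assms(2)]
  have "(\<Oplus>l\<in>{..<k}. scalar k x (i, l) \<otimes> A (l, j)) = (\<Oplus>l\<in>{..<k}. if i = l then x \<otimes> A (i, j) else \<zero>)"
    using assms by (intro finsum_cong') (auto simp: ent scalar_def)
  also have "\<dots> = x \<otimes> A (i, j)"
    using assms by (intro finsum_delta) (auto simp: ent)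
  finally show "(scalar k x \<otimes>\<^bsub>matrix_ring k R\<^esub> A) (i, j) = x \<otimes> A (i, j)"
    using assms by simp
  have "(\<Oplus>l\<in>{..<k}. A (i, l) \<otimes> scalar k x (l, j)) = (\<Oplus>l\<in>{..<k}. if j = l then A (i, j) \<otimes> x else \<zero>)"
    using assms by (intro finsum_cong') (auto simp: ent scalar_def)
  also have "\<dots> = A (i, j) \<otimes> x"
    using assms by (intro finsum_delta) (auto simp: ent)
  finally show "(A \<otimes>\<^bsub>matrix_ring k R\<^esub> scalar k x) (i, j) = A (i, j) \<otimes> x"
    using assms by simp
qed

lemma scalar_ring_hom: "scalar k \<in> ring_hom R (matrix_ring k R)"
proof (rule ring_hom_memI)
  fix x y assume xy: "x \<in> carrier R" "y \<in> carrier R"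
  show "scalar k (x \<otimes> y) = scalar k x \<otimes>\<^bsub>matrix_ring k R\<^esub> scalar k y"
    using xy by (intro matrix_ring_eqI[of _ k R] scalar_closed matrix_ring_closed m_closed)
      (simp_all add: scalar_mult_entry scalar_closed del: matrix_ring_entry, simp_all add: scalar_def)
  show "scalar k (x \<oplus> y) = scalar k x \<oplus>\<^bsub>matrix_ring k R\<^esub> scalar k y"
    using xy by (intro matrix_ring_eqI[of _ k R] scalar_closed matrix_ring_closed a_closed)
      (simp_all add: scalar_def)
next
  show "scalar k \<one> = \<one>\<^bsub>matrix_ring k R\<^esub>"
    by (intro matrix_ring_eqI[of _ k R] scalar_closed matrix_ring_units_closed) (simp_all add: scalar_def)
qed (rule scalar_closed)

text \<open>A single comparison suffices: entry \<open>(i, 0)\<close> of the product of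
  \<open>A\<close> with the matrix unit at \<open>(j, 0)\<close> is \<open>A (i, j)\<close> in one
  order; in the other it is \<open>A (0, 0)\<close> if \<open>i = j\<close> and zero
  otherwise.\<close>

lemma central_matrix_is_scalar:
  assumes A: "A \<in> carrier (matrix_ring k R)" and k: "k > 0"
    and central: "\<And>B. B \<in> carrier (matrix_ring k R) \<Longrightarrow> A \<otimes>\<^bsub>matrix_ring k R\<^esub> B = B \<otimes>\<^bsub>matrix_ring k R\<^esub> A"
  shows "A = scalar k (A (0, 0))"
proof (rule matrix_ring_eqI[OF A])
  show "scalar k (A (0, 0)) \<in> carrier (matrix_ring k R)"
    using matrix_ring_carrierD[OF A] k by (intro scalar_closed) auto
  fix i j assume ij: "i < k" "j < k"
  have "(A \<otimes>\<^bsub>matrix_ring k R\<^esub> elementary k j 0) (i, 0) = (elementary k j 0 \<otimes>\<^bsub>matrix_ring k R\<^esub> A) (i, 0)"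
    using central[OF elementary_closed] by simp
  then show "A (i, j) = scalar k (A (0, 0)) (i, j)"
    using A ij k by (simp add: elementary_mult scalar_def del: matrix_ring_entry)
qed

end

lemma matrix_ring_iso:
  assumes R: "cring R" and S: "cring S" and "R \<simeq> S"
  shows "matrix_ring k R \<simeq> matrix_ring k S"
proof -
  interpret R: cring R by fact
  interpret S: cring S by fact
  obtain h where h: "h \<in> ring_hom R S" "bij_betw h (carrier R) (carrier S)"
    using assms(3) unfolding is_ring_iso_def ring_iso_def by blast
  interpret h: ring_hom_cring R S h
    using h(1) by unfold_locales
  define g where "g A = (\<lambda>p\<in>{..<k} \<times> {..<k}. h (A p))" for A
  have gcl: "g A \<in> carrier (matrix_ring k S)" if "A \<in> carrier (matrix_ring k R)" for A
    using that h.hom_closed unfolding g_def matrix_ring_def by (simp add: PiE_iff)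
  note ent = matrix_ring_carrierD[where k = k and R = R]
  have hom: "g \<in> ring_hom (matrix_ring k R) (matrix_ring k S)"
  proof (rule ring_hom_memI)
    fix A B assume AB: "A \<in> carrier (matrix_ring k R)" "B \<in> carrier (matrix_ring k R)"
    show "g (A \<otimes>\<^bsub>matrix_ring k R\<^esub> B) = g A \<otimes>\<^bsub>matrix_ring k S\<^esub> g B"
    proof (rule matrix_ring_eqI[of _ k S])
      fix i j assume ij: "i < k" "j < k"
      have "h (\<Oplus>\<^bsub>R\<^esub>l\<in>{..<k}. A (i, l) \<otimes>\<^bsub>R\<^esub> B (l, j)) = (\<Oplus>\<^bsub>S\<^esub>l\<in>{..<k}. h (A (i, l) \<otimes>\<^bsub>R\<^esub> B (l, j)))"
        using AB ij by (subst h.hom_finsum) (auto simp: ent comp_def)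
      also have "\<dots> = (\<Oplus>\<^bsub>S\<^esub>l\<in>{..<k}. g A (i, l) \<otimes>\<^bsub>S\<^esub> g B (l, j))"
        using AB ij by (intro S.finsum_cong') (auto simp: ent g_def)
      finally show "g (A \<otimes>\<^bsub>matrix_ring k R\<^esub> B) (i, j) = (g A \<otimes>\<^bsub>matrix_ring k S\<^esub> g B) (i, j)"
        using ij by (simp add: g_def)
    qed (intro gcl R.matrix_ring_closed S.matrix_ring_closed AB)+
    show "g (A \<oplus>\<^bsub>matrix_ring k R\<^esub> B) = g A \<oplus>\<^bsub>matrix_ring k S\<^esub> g B"
      using AB by (intro matrix_ring_eqI[of _ k S] gcl R.matrix_ring_closed S.matrix_ring_closed)
        (auto simp: g_def ent)
  next
    show "g \<one>\<^bsub>matrix_ring k R\<^esub> = \<one>\<^bsub>matrix_ring k S\<^esub>"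
      by (intro matrix_ring_eqI[of _ k S] gcl R.matrix_ring_units_closed S.matrix_ring_units_closed)
        (auto simp: g_def)
  qed (rule gcl)
  have "bij_betw g (carrier (matrix_ring k R)) (carrier (matrix_ring k S))"
  proof (rule bij_betw_imageI)
    show "inj_on g (carrier (matrix_ring k R))"
    proof (rule inj_onI)
      fix A B assume AB: "A \<in> carrier (matrix_ring k R)" "B \<in> carrier (matrix_ring k R)" "g A = g B"
      show "A = B"
      proof (rule matrix_ring_eqI[OF AB(1,2)])
        fix i j assume ij: "i < k" "j < k"
        have "h (A (i, j)) = h (B (i, j))"
          using fun_cong[OF AB(3), of "(i, j)"] ij by (simp add: g_def)
        then show "A (i, j) = B (i, j)"
          using h(2) ent[OF AB(1) ij] ent[OF AB(2) ij] by (auto simp: bij_betw_def inj_on_def)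
      qed
    qed
    show "g ` carrier (matrix_ring k R) = carrier (matrix_ring k S)"
    proof (intro equalityI subsetI)
      fix B assume B: "B \<in> carrier (matrix_ring k S)"
      define A where "A = (\<lambda>p\<in>{..<k} \<times> {..<k}. inv_into (carrier R) h (B p))"
      have BE: "B p \<in> h ` carrier R" if "p \<in> {..<k} \<times> {..<k}" for p
        using B h(2) that by (auto simp: matrix_ring_def bij_betw_def)
      have A: "A \<in> carrier (matrix_ring k R)"
        using BE by (auto simp: A_def matrix_ring_def inv_into_into)
      have "g A = B"
        by (rule matrix_ring_eqI[OF gcl[OF A] B]) (simp add: g_def A_def f_inv_into_f[OF BE])
      then show "B \<in> g ` carrier (matrix_ring k R)" using A by blast
    qed (use gcl in blast)
  qed
  then show ?thesis
    using hom unfolding is_ring_iso_def ring_iso_def by blast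
qed

text \<open>A ring isomorphism maps centres to centres, and the centre of a matrix ring over a commutative
  ring consists of the scalar matrices.\<close>

lemma matrix_ring_iso_imp_iso:
  assumes R: "cring R" and S: "cring S" and k: "k > 0" and "matrix_ring k R \<simeq> matrix_ring k S"
  shows "R \<simeq> S"
proof -
  interpret R: cring R by fact
  interpret S: cring S by fact
  let ?M = "matrix_ring k R" and ?N = "matrix_ring k S"
  obtain h where h: "h \<in> ring_hom ?M ?N" "bij_betw h (carrier ?M) (carrier ?N)"
    using assms(4) unfolding is_ring_iso_def ring_iso_def by blast
  have img: "h ` carrier ?M = carrier ?N" and inj: "inj_on h (carrier ?M)"
    using h(2) by (auto simp: bij_betw_def)
  have central_R: "R.scalar k x \<otimes>\<^bsub>?M\<^esub> A = A \<otimes>\<^bsub>?M\<^esub> R.scalar k x" if "x \<in> carrier R" "A \<in> carrier ?M" for x A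
    using that by (intro matrix_ring_eqI[of _ k R] R.matrix_ring_closed R.scalar_closed)
      (auto simp: R.scalar_mult_entry R.m_comm matrix_ring_carrierD simp del: matrix_ring_entry)
  have central_S: "S.scalar k x \<otimes>\<^bsub>?N\<^esub> A = A \<otimes>\<^bsub>?N\<^esub> S.scalar k x" if "x \<in> carrier S" "A \<in> carrier ?N" for x A
    using that by (intro matrix_ring_eqI[of _ k S] S.matrix_ring_closed S.scalar_closed)
      (auto simp: S.scalar_mult_entry S.m_comm matrix_ring_carrierD simp del: matrix_ring_entry)
  define g where "g x = h (R.scalar k x) (0, 0)" for x
  have hcl: "h A \<in> carrier ?N" if "A \<in> carrier ?M" for A
    using ring_hom_closed[OF h(1)] that .
  have gcl: "g x \<in> carrier S" if "x \<in> carrier R" for x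
    unfolding g_def using matrix_ring_carrierD[OF hcl[OF R.scalar_closed[OF that]]] k by blast
  have hs: "h (R.scalar k x) = S.scalar k (g x)" if x: "x \<in> carrier R" for x
    unfolding g_def
  proof (rule S.central_matrix_is_scalar[OF hcl[OF R.scalar_closed[OF x]] k])
    fix B assume "B \<in> carrier ?N"
    then obtain A where "A \<in> carrier ?M" "B = h A" using img by blast
    then show "h (R.scalar k x) \<otimes>\<^bsub>?N\<^esub> B = B \<otimes>\<^bsub>?N\<^esub> h (R.scalar k x)"
      using ring_hom_mult[OF h(1)] central_R[OF x] R.scalar_closed[OF x] by metis
  qed
  \<comment> \<open>Entry \<open>(0, 0)\<close> recovers the scalar, so the laws for
    \<open>g\<close> can be checked between scalar matrices, where they follow from those for
    \<open>h\<close>.\<close>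
  have scalar_inj_S: "x = y" if "S.scalar k x = S.scalar k y" for x y
    using fun_cong[OF that, of "(0, 0)"] k by (simp add: S.scalar_def)
  have scalar_inj_R: "x = y" if "R.scalar k x = R.scalar k y" for x y
    using fun_cong[OF that, of "(0, 0)"] k by (simp add: R.scalar_def)
  have "g \<in> ring_hom R S"
  proof (rule ring_hom_memI)
    fix x y assume xy: "x \<in> carrier R" "y \<in> carrier R"
    show "g (x \<otimes>\<^bsub>R\<^esub> y) = g x \<otimes>\<^bsub>S\<^esub> g y"
    proof (rule scalar_inj_S)
      show "S.scalar k (g (x \<otimes>\<^bsub>R\<^esub> y)) = S.scalar k (g x \<otimes>\<^bsub>S\<^esub> g y)"
        using xy by (simp add: hs[symmetric] gcl ring_hom_mult[OF S.scalar_ring_hom]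
            ring_hom_mult[OF R.scalar_ring_hom] ring_hom_mult[OF h(1)] R.scalar_closed)
    qed
    show "g (x \<oplus>\<^bsub>R\<^esub> y) = g x \<oplus>\<^bsub>S\<^esub> g y"
    proof (rule scalar_inj_S)
      show "S.scalar k (g (x \<oplus>\<^bsub>R\<^esub> y)) = S.scalar k (g x \<oplus>\<^bsub>S\<^esub> g y)"
        using xy by (simp add: hs[symmetric] gcl ring_hom_add[OF S.scalar_ring_hom]
            ring_hom_add[OF R.scalar_ring_hom] ring_hom_add[OF h(1)] R.scalar_closed)
    qed
  next
    show "g \<one>\<^bsub>R\<^esub> = \<one>\<^bsub>S\<^esub>"
      by (rule scalar_inj_S)
        (simp add: hs[symmetric] ring_hom_one[OF S.scalar_ring_hom]
          ring_hom_one[OF R.scalar_ring_hom] ring_hom_one[OF h(1)])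
  qed (rule gcl)
  moreover have "bij_betw g (carrier R) (carrier S)"
  proof (rule bij_betw_imageI)
    show "inj_on g (carrier R)"
      using hs scalar_inj_R inj R.scalar_closed unfolding inj_on_def by metis
    show "g ` carrier R = carrier S"
    proof (intro equalityI subsetI)
      fix y assume y: "y \<in> carrier S"
      then obtain A where A: "A \<in> carrier ?M" "h A = S.scalar k y"
        using img S.scalar_closed by (metis imageE)
      \<comment> \<open>\<open>h A\<close> is central, and \<open>h\<close> reflects commutation
        because it is injective, so \<open>A\<close> is central as well.\<close>
      have "A = R.scalar k (A (0, 0))"
      proof (rule R.central_matrix_is_scalar[OF A(1) k])
        fix B assume B: "B \<in> carrier ?M"
        have "h (A \<otimes>\<^bsub>?M\<^esub> B) = h (B \<otimes>\<^bsub>?M\<^esub> A)"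
          using A B central_S[OF y hcl[OF B]] by (simp add: ring_hom_mult[OF h(1)])
        then show "A \<otimes>\<^bsub>?M\<^esub> B = B \<otimes>\<^bsub>?M\<^esub> A"
          using inj A B R.matrix_ring_closed by (meson inj_onD)
      qed
      moreover have "A (0, 0) \<in> carrier R"
        using matrix_ring_carrierD[OF A(1)] k by blast
      ultimately have "g (A (0, 0)) = y"
        using hs A(2) scalar_inj_S by metis
      then show "y \<in> g ` carrier R" using \<open>A (0, 0) \<in> carrier R\<close> by blast
    qed (use gcl in blast)
  qed
  ultimately show ?thesis
    unfolding is_ring_iso_def ring_iso_def by blast
qed

section \<open>Automata on \<open>\<omega>\<^sup>n\<close>\<close>

lemma not_lexn_replicate_0: "(xs, replicate m 0) \<notin> lexn less_than n"
proof (induction n arbitrary: xs m)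
  case (Suc n)
  then show ?case
    by (cases xs; cases m) (auto simp: Cons_in_lexn dest: lexn_length simp del: lexn.simps(2))
qed simp

lemma lexn_append_left:
  "(pre @ xs, pre @ ys) \<in> lexn less_than (length pre + m) \<longleftrightarrow> (xs, ys) \<in> lexn less_than m"
  by (induction pre) (auto simp: Cons_in_lexn dest: lexn_length simp del: lexn.simps(2))

lemma lexn_append_mono:
  assumes "(xs, ys) \<in> lexn less_than m" "length us = l" "length vs = l"
  shows "(xs @ us, ys @ vs) \<in> lexn less_than (m + l)"
  using assms
proof (induction m arbitrary: xs ys)
  case (Suc m)
  obtain x xs' y ys' where [simp]: "xs = x # xs'" "ys = y # ys'"
    using lexn_length[OF Suc.prems(1)] by (auto simp: length_Suc_conv)
  show ?case
    using Suc by (auto simp: Cons_in_lexn simp del: lexn.simps(2))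
qed simp

lemma lexn_total:
  assumes "length xs = n" "length ys = n"
  shows "xs = ys \<or> (xs, ys) \<in> lexn less_than n \<or> (ys, xs) \<in> lexn less_than n"
  using assms
proof (induction n arbitrary: xs ys)
  case (Suc n)
  obtain x xs' y ys' where "xs = x # xs'" "ys = y # ys'" "length xs' = n" "length ys' = n"
    using Suc.prems by (auto simp: length_Suc_conv)
  then show ?case
    using Suc.IH[of xs' ys'] by (auto simp: Cons_in_lexn simp del: lexn.simps(2))
qed simp

lemma lexn_trans:
  "(xs, ys) \<in> lexn less_than n \<Longrightarrow> (ys, zs) \<in> lexn less_than n \<Longrightarrow> (xs, zs) \<in> lexn less_than n"
  by (meson lexn_transI trans_less_than transD)

text \<open>The position following the block of all extensions of \<open>us\<close> in \<open>\<omega>\<^sup>n\<close>, as a position of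
  \<open>\<omega>\<^sup>n + 1\<close>. This enumerates all positions but the first one.\<close>

definition block_end :: "nat \<Rightarrow> nat list \<Rightarrow> nat list option"
  where "block_end n us =
    (if us = [] then None else Some (butlast us @ Suc (last us) # replicate (n - length us) 0))"

text \<open>The end of a block is the next prefix followed by zeros, the least position with that
  prefix. The comparison is therefore decided by the first \<open>length us\<close> entries of
  \<open>p\<close>.\<close>

lemma less_block_end_aux:
  assumes "length p = n" "us \<noteq> []" "length us \<le> n"
  shows "(p, butlast us @ Suc (last us) # replicate (n - length us) 0) \<in> lexn less_than n \<longleftrightarrow>
    (take (length us) p, us) \<in> lexn less_than (length us) \<or> take (length us) p = us"
  using assms
proof (induction us arbitrary: p n)
  case (Cons a us)
  obtain b p' n' where [simp]: "p = b # p'" "n = Suc n'" and p': "length p' = n'"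
    using Cons.prems by (cases p) auto
  show ?case
  proof (cases "us = []")
    case True
    then show ?thesis
      using p' not_lexn_replicate_0[of p'] by (auto simp: Cons_in_lexn simp del: lexn.simps(2))
  next
    case False
    then have "Suc (length us - Suc 0 + n' - length us) = n'"
      using Cons.prems(3) by (cases us) auto
    then show ?thesis
      using False p' Cons.prems Cons.IH[of p' n']
      by (auto simp: Cons_in_lexn simp del: lexn.simps(2))
  qed
qed simp

abbreviation omega_pow1 :: "nat \<Rightarrow> nat list option rel"
  where "omega_pow1 n \<equiv> ord_plus_one (omega_pow n)"

lemma ord_plus_one_omega_pow:
  "(p, q) \<in> omega_pow1 n \<and> p \<noteq> q \<longleftrightarrow>
    (\<exists>xs. p = Some xs \<and> length xs = n \<and> (q = None \<or> (\<exists>ys. q = Some ys \<and> (xs, ys) \<in> lexn less_than n)))"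
proof -
  have "(xs, ys) \<in> omega_pow n \<and> xs \<noteq> ys \<longleftrightarrow> (xs, ys) \<in> lexn less_than n" for xs ys
    using omega_pow_minus_Id[of n] by blast
  then show ?thesis
    unfolding ord_plus_one_def Field_omega_pow by (cases p; cases q) (auto dest: lexn_length)
qed

lemma Field_omega_pow1: "Field (omega_pow1 n) = insert None (Some ` {xs. length xs = n})"
  unfolding ord_plus_one_def Field_omega_pow[symmetric] by (auto simp: Field_def)

lemma less_block_end:
  assumes "length us \<le> n"
  shows "(p, block_end n us) \<in> omega_pow1 n \<and> p \<noteq> block_end n us \<longleftrightarrow>
    (\<exists>xs. p = Some xs \<and> length xs = n \<and>
      ((take (length us) xs, us) \<in> lexn less_than (length us) \<or> take (length us) xs = us))"
  unfolding ord_plus_one_omega_pow using less_block_end_aux[OF _ _ assms]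
  by (auto simp: block_end_def)

lemma block_end_in_Field:
  assumes "length us \<le> n"
  shows "block_end n us \<in> Field (omega_pow1 n)"
  using assms unfolding Field_omega_pow1 block_end_def by (cases us) auto

text \<open>Dropping the trailing zeros leaves \<open>us\<close> with its last entry increased by
  one; this entry is nonzero, so nothing more is dropped. The empty list is the only one whose block
  ends at \<open>None\<close>.\<close>

lemma block_end_inject:
  assumes "block_end n us = block_end n vs"
  shows "us = vs"
proof (cases "us = [] \<or> vs = []")
  case False
  have strip: "dropWhile ((=) 0) (rev (butlast us @ Suc (last us) # replicate m 0)) = Suc (last us) # rev (butlast us)"
    for us :: "nat list" and m
    by (simp add: dropWhile_append)
  have "butlast us @ Suc (last us) # replicate (n - length us) 0 =
      butlast vs @ Suc (last vs) # replicate (n - length vs) 0"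
    using assms False by (simp add: block_end_def)
  from arg_cong[OF this, of "\<lambda>xs. dropWhile ((=) 0) (rev xs)"]
  have "last us = last vs" "butlast us = butlast vs"
    unfolding strip by auto
  then show ?thesis
    using False by (metis append_butlast_last_id)
qed (use assms in \<open>auto simp: block_end_def split: if_splits\<close>)

text \<open>\<open>us\<close> is \<open>q\<close> cut after its last nonzero entry, with that entry
  decreased by one.\<close>

lemma nonzero_list_cases:
  assumes "q \<noteq> replicate (length q) (0 :: nat)"
  shows "\<exists>us. us \<noteq> [] \<and> length us \<le> length q \<and>
    q = butlast us @ Suc (last us) # replicate (length q - length us) 0"
  using assms
proof (induction q rule: rev_induct)
  case (snoc a q)
  show ?case
  proof (cases a)
    case 0
    have "q \<noteq> replicate (length q) 0"
    proof
      assume "q = replicate (length q) 0"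
      then have "q @ [a] = replicate (length q) 0 @ [0]" using 0 by simp
      then show False using snoc.prems by (simp add: replicate_append_same)
    qed
    then obtain us where us: "us \<noteq> []" "length us \<le> length q"
      "q = butlast us @ Suc (last us) # replicate (length q - length us) 0"
      using snoc.IH by blast
    have "q @ [a] = butlast us @ Suc (last us) # (replicate (length q - length us) 0 @ [0])"
      using 0 by (subst us(3)) simp
    also have "replicate (length q - length us) 0 @ [0] = replicate (length (q @ [a]) - length us) (0 :: nat)"
      using us(2) by (simp add: replicate_append_same Suc_diff_le)
    finally have eq: "q @ [a] = butlast us @ Suc (last us) # replicate (length (q @ [a]) - length us) 0" .
    have "length us \<le> length (q @ [a])"
      using us(2) by simp
    with us(1) eq show ?thesis by blast
  next
    case (Suc c)
    then show ?thesis by (intro exI[of _ "q @ [c]"]) simp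
  qed
qed simp

lemma omega_pow1_cases:
  assumes "p \<in> Field (omega_pow1 n)"
  shows "p = Some (replicate n 0) \<or> (\<exists>us. length us \<le> n \<and> p = block_end n us)"
proof (cases p)
  case None
  then show ?thesis by (intro disjI2 exI[of _ "[]"]) (simp add: block_end_def)
next
  case (Some q)
  then have "length q = n"
    using assms by (auto simp: Field_omega_pow1)
  then show ?thesis
    using nonzero_list_cases[of q] Some by (auto simp: block_end_def)
qed

lemma is_first_omega_pow1: "is_first (omega_pow1 n) p \<longleftrightarrow> p = Some (replicate n 0)"
proof -
  have le: "(Some (replicate n 0), q) \<in> omega_pow1 n" if "q \<in> Field (omega_pow1 n)" for q
  proof (cases "q = Some (replicate n 0)")
    case True
    then show ?thesis by (auto simp: ord_plus_one_def omega_pow_def)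
  next
    case False
    have "(Some (replicate n 0), q) \<in> omega_pow1 n \<and> Some (replicate n 0) \<noteq> q"
      unfolding ord_plus_one_omega_pow
      using that False lexn_total[of "replicate n 0" n "the q"] not_lexn_replicate_0[of "the q" n n]
      by (auto simp: Field_omega_pow1)
    then show ?thesis by blast
  qed
  moreover have "p = q" if "(p, q) \<in> omega_pow1 n" "q = Some (replicate n 0)" for q
    using ord_plus_one_omega_pow[of p q n] that not_lexn_replicate_0 by auto
  ultimately show ?thesis
    unfolding is_first_def Field_omega_pow1 by auto
qed

text \<open>Any \<open>d\<close> beyond the entry of \<open>p\<close> at index
  \<open>length us\<close> will do. This provides cofinally many positions below a limit.\<close>

lemma between_blocks:
  assumes "length us < n" "(p, block_end n us) \<in> omega_pow1 n" "p \<noteq> block_end n us"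
  shows "\<exists>c. \<forall>d\<ge>c. (p, Some (us @ d # replicate (n - Suc (length us)) 0)) \<in> omega_pow1 n \<and>
    p \<noteq> Some (us @ d # replicate (n - Suc (length us)) 0)"
proof -
  obtain xs where xs: "p = Some xs" "length xs = n"
    and or: "(take (length us) xs, us) \<in> lexn less_than (length us) \<or> take (length us) xs = us"
    using less_block_end[of us n p] assms by auto
  obtain ys y zs where split: "xs = ys @ y # zs" "length ys = length us" "length zs = n - Suc (length us)"
    using that[OF id_take_nth_drop[of "length us" xs]] xs(2) assms(1) by simp
  have n: "n = length us + Suc (n - Suc (length us))"
    using assms(1) by simp
  have "(xs, us @ d # replicate (n - Suc (length us)) 0) \<in> lexn less_than n" if "d \<ge> Suc y" for d
  proof -
    have "(ys, us) \<in> lexn less_than (length us) \<or> ys = us"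
      using or split by simp
    then show ?thesis
    proof
      assume "(ys, us) \<in> lexn less_than (length us)"
      from lexn_append_mono[OF this, of "y # zs" "Suc (n - Suc (length us))"]
      show ?thesis using split n by simp
    next
      assume "ys = us"
      moreover have "(y # zs, d # replicate (n - Suc (length us)) 0) \<in> lexn less_than (Suc (n - Suc (length us)))"
        using that split by (simp add: Cons_in_lexn del: lexn.simps(2))
      ultimately show ?thesis
        using lexn_append_left[of us "y # zs" _ "Suc (n - Suc (length us))"] n split(1) by metis
    qed
  qed
  then show ?thesis
    unfolding ord_plus_one_omega_pow using xs by blast
qed

text \<open>A list of full length is a block of one position, and a block of one position ends at
  its successor.\<close>

lemma is_next_omega_pow1:
  assumes "length p = n"
  shows "is_next (omega_pow1 n) (Some p) q \<longleftrightarrow> q = block_end n p"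
proof -
  have less: "(Some p, block_end n p) \<in> omega_pow1 n \<and> Some p \<noteq> block_end n p"
    using less_block_end[of p n "Some p"] assms by auto
  have below: "r = p \<or> (r, p) \<in> lexn less_than n" if "(Some r, block_end n p) \<in> omega_pow1 n" "Some r \<noteq> block_end n p" for r
    using less_block_end[of p n "Some r"] assms that by auto
  have nx: "is_next (omega_pow1 n) (Some p) (block_end n p)"
    unfolding is_next_def
  proof (intro conjI notI)
    assume "\<exists>m. (Some p, m) \<in> omega_pow1 n - Id \<and> (m, block_end n p) \<in> omega_pow1 n - Id"
    then obtain m where m: "(Some p, m) \<in> omega_pow1 n \<and> Some p \<noteq> m" "(m, block_end n p) \<in> omega_pow1 n \<and> m \<noteq> block_end n p"
      by auto
    from m(2) obtain r where [simp]: "m = Some r"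
      unfolding ord_plus_one_omega_pow by blast
    have "(p, r) \<in> lexn less_than n"
      using m(1) unfolding ord_plus_one_omega_pow by auto
    then show False
      using below[of r] m(2) lexn_trans lexn_irrefl by (metis \<open>m = Some r\<close>)
  qed (use less in auto)
  moreover have "q = block_end n p" if q: "is_next (omega_pow1 n) (Some p) q"
  proof (rule ccontr)
    assume ne: "q \<noteq> block_end n p"
    have pq: "(Some p, q) \<in> omega_pow1 n \<and> Some p \<noteq> q"
      using q unfolding is_next_def by auto
    have "(q, block_end n p) \<in> omega_pow1 n \<and> q \<noteq> block_end n p \<or> (block_end n p, q) \<in> omega_pow1 n \<and> block_end n p \<noteq> q"
    proof -
      have "q \<in> Field (omega_pow1 n)" "block_end n p \<in> Field (omega_pow1 n)"
        using pq block_end_in_Field[of p n] assms by (auto simp: Field_def)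
      then show ?thesis
        unfolding ord_plus_one_omega_pow using ne lexn_total[of "the q" n "the (block_end n p)"]
        by (auto simp: Field_omega_pow1)
    qed
    then show False
      using q nx less pq unfolding is_next_def by auto
  qed
  ultimately show ?thesis by blast
qed

text \<open>Every position except the first ends exactly one block, and it is a successor precisely
  when this block is a single position.\<close>

lemma is_limit_omega_pow1:
  "is_limit (omega_pow1 n) p \<longleftrightarrow> (\<exists>us. length us < n \<and> p = block_end n us)"
proof
  assume lim: "is_limit (omega_pow1 n) p"
  then have "p \<in> Field (omega_pow1 n)" "p \<noteq> Some (replicate n 0)"
    unfolding is_limit_def is_first_omega_pow1 by auto
  then obtain us where us: "length us \<le> n" "p = block_end n us"
    using omega_pow1_cases by blast
  moreover have "length us \<noteq> n"
    using lim us is_next_omega_pow1[of us n p] unfolding is_limit_def by blast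
  ultimately show "\<exists>us. length us < n \<and> p = block_end n us"
    using le_neq_implies_less by blast
next
  assume "\<exists>us. length us < n \<and> p = block_end n us"
  then obtain us where us: "length us < n" "p = block_end n us" by blast
  have "\<not> is_next (omega_pow1 n) q p" for q
  proof
    assume q: "is_next (omega_pow1 n) q p"
    then have "(q, p) \<in> omega_pow1 n \<and> q \<noteq> p"
      unfolding is_next_def by auto
    then obtain xs where "q = Some xs" "length xs = n"
      unfolding ord_plus_one_omega_pow by blast
    then show False
      using q is_next_omega_pow1[of xs n p] us block_end_inject[of n us xs] by auto
  qed
  moreover have "p \<noteq> Some (replicate n 0)"
  proof
    assume "p = Some (replicate n 0)"
    moreover have "(Some (us @ replicate (n - length us) 0), p) \<in> omega_pow1 n \<and> Some (us @ replicate (n - length us) 0) \<noteq> p"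
      unfolding us(2) less_block_end[OF less_imp_le[OF us(1)]] using us(1) by simp
    ultimately show False
      unfolding ord_plus_one_omega_pow using not_lexn_replicate_0 by blast
  qed
  ultimately show "is_limit (omega_pow1 n) p"
    unfolding is_limit_def is_first_omega_pow1 using us block_end_in_Field[of us n] by auto
qed

text \<open>After the start of block \<open>us @ [c]\<close> and before the end of block
  \<open>us\<close>, every position ends a sub-block \<open>us @ d # vs\<close> with
  \<open>d \<ge> c\<close>. Cofinally often thus becomes: for infinitely many
  \<open>d\<close>.\<close>

lemma cofinal_states_omega_pow1:
  assumes us: "length us < n"
  shows "cofinal_states (omega_pow1 n) x (block_end n us) =
    {q. \<exists>\<^sub>\<infinity>d. \<exists>vs. length us + length vs < n \<and> x (block_end n (us @ d # vs)) = q}"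
proof (intro Set.set_eqI iffI)
  let ?z = "replicate (n - Suc (length us)) (0 :: nat)"
  let ?lt = "\<lambda>p q. (p, q) \<in> omega_pow1 n \<and> p \<noteq> q"
  have n: "n = length us + Suc (n - Suc (length us))"
    using us by simp
  {
    fix q assume q: "q \<in> cofinal_states (omega_pow1 n) x (block_end n us)"
    have "\<exists>d\<ge>c. \<exists>vs. length us + length vs < n \<and> x (block_end n (us @ d # vs)) = q" for c
    proof -
      have "?lt (Some (us @ c # ?z)) (block_end n us)"
        using us by (subst less_block_end) auto
      then obtain v where v: "?lt (Some (us @ c # ?z)) v" "?lt v (block_end n us)" "x v = q"
        using q unfolding cofinal_states_def by auto
      obtain y where y: "v = Some y" "length y = n" "(us @ c # ?z, y) \<in> lexn less_than n"
        using v(1,2) unfolding ord_plus_one_omega_pow by blast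
      have "(take (length us) y, us) \<in> lexn less_than (length us) \<or> take (length us) y = us"
        using v(2) us unfolding less_block_end[OF less_imp_le[OF us]] y(1) by simp
      moreover obtain ys e zs where split: "y = ys @ e # zs" "length ys = length us" "length zs = n - Suc (length us)"
        using that[OF id_take_nth_drop[of "length us" y]] y(2) us by simp
      moreover have "(ys, us) \<notin> lexn less_than (length us)"
      proof
        assume "(ys, us) \<in> lexn less_than (length us)"
        from lexn_append_mono[OF this, of "e # zs" "Suc (n - Suc (length us))" "c # ?z"]
        have "(y, us @ c # ?z) \<in> lexn less_than n"
          using split n by simp
        then show False
          using y(3) lexn_trans lexn_irrefl by blast
      qed
      ultimately have [simp]: "ys = us" by simp
      have ce: "(c # ?z, e # zs) \<in> lexn less_than (Suc (n - Suc (length us)))"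
        using y(3) lexn_append_left[of us _ _ "Suc (n - Suc (length us))"] n split(1) by (metis \<open>ys = us\<close>)
      show ?thesis
      proof (cases "zs = replicate (length zs) 0")
        case True
        \<comment> \<open>An entry \<open>e\<close> followed by zeros marks the end of block
          \<open>us @ [e - 1]\<close>. As \<open>e\<close> exceeds \<open>c\<close>, the index
          \<open>e - 1\<close> is still at least \<open>c\<close>.\<close>
        then have "c < e"
          using ce split(3) lexn_irrefl by (auto simp: Cons_in_lexn simp del: lexn.simps(2))
        then obtain d where d: "e = Suc d" "d \<ge> c"
          by (cases e) auto
        have "block_end n (us @ [d]) = v"
          using True split y(1) d by (simp add: block_end_def)
        then show ?thesis
          using d us v(3) by (intro exI[of _ d] conjI exI[of _ "[]"]) auto
      next
        case False
        from nonzero_list_cases[OF this] obtain vs where vs: "vs \<noteq> []" "length vs \<le> length zs"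
          "zs = butlast vs @ Suc (last vs) # replicate (length zs - length vs) 0"
          by blast
        have "block_end n (us @ e # vs) = v"
          using vs split y(1) by (simp add: block_end_def butlast_append)
        moreover have "e \<ge> c"
          using ce by (auto simp: Cons_in_lexn simp del: lexn.simps(2))
        ultimately show ?thesis
          using v(3) vs(2) split(3) us by (intro exI[of _ e] conjI exI[of _ vs]) auto
      qed
    qed
    then show "q \<in> {q. \<exists>\<^sub>\<infinity>d. \<exists>vs. length us + length vs < n \<and> x (block_end n (us @ d # vs)) = q}"
      by (auto simp: INFM_nat_le)
  }
  {
    fix q assume q: "q \<in> {q. \<exists>\<^sub>\<infinity>d. \<exists>vs. length us + length vs < n \<and> x (block_end n (us @ d # vs)) = q}"
    have "\<exists>v. ?lt m v \<and> ?lt v (block_end n us) \<and> x v = q" if m: "?lt m (block_end n us)" for m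
    proof -
      obtain c where c: "\<And>d. d \<ge> c \<Longrightarrow> ?lt m (Some (us @ d # ?z))"
        using between_blocks[OF us, of m] m by metis
      obtain d vs where d: "d \<ge> c" "length us + length vs < n" "x (block_end n (us @ d # vs)) = q"
        using q unfolding mem_Collect_eq INFM_nat_le by blast
      have vs: "length (us @ d # vs) \<le> n"
        using d(2) by simp
      have "?lt (Some (us @ d # ?z)) (block_end n (us @ d # vs))"
      proof -
        have t: "take (length (us @ d # vs)) (us @ d # ?z) = us @ d # replicate (length vs) 0"
          using d(2) min_absorb1[of "length vs" "n - Suc (length us)"] by simp
        have "(replicate (length vs) 0, vs) \<in> lexn less_than (length vs) \<or> replicate (length vs) 0 = vs"
          using lexn_total[of "replicate (length vs) 0" "length vs" vs] not_lexn_replicate_0 by auto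
        then have "(d # replicate (length vs) 0, d # vs) \<in> lexn less_than (length (d # vs)) \<or> replicate (length vs) 0 = vs"
          by (simp add: Cons_in_lexn del: lexn.simps(2))
        then have "(us @ d # replicate (length vs) 0, us @ d # vs) \<in> lexn less_than (length (us @ d # vs)) \<or>
            us @ d # replicate (length vs) 0 = us @ d # vs"
          by (simp only: length_append lexn_append_left) auto
        then show ?thesis
          unfolding less_block_end[OF vs] using us t by auto
      qed
      moreover have "?lt m (Some (us @ d # ?z))"
        using c d(1) by blast
      ultimately have "?lt m (block_end n (us @ d # vs))"
        unfolding ord_plus_one_omega_pow using lexn_trans by blast
      moreover have "?lt (block_end n (us @ d # vs)) (block_end n us)"
        unfolding less_block_end[OF less_imp_le[OF us]] using d(2)
        by (auto simp: block_end_def butlast_append)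
      ultimately show ?thesis
        using d(3) by blast
    qed
    then show "q \<in> cofinal_states (omega_pow1 n) x (block_end n us)"
      unfolding cofinal_states_def by auto
  }
qed

text \<open>The automaton stores in the state at \<open>block_end n us\<close> the length \<open>\<omega>\<^sup>j\<close> of the block of
  \<open>us\<close> and whether the marked positions of this block have order type \<open>\<omega>\<^sup>j\<close>. The state \<open>0\<close> is
  used at the first position only. At a limit, \<open>j\<close> is found as the largest exponent seen cofinally.\<close>

definition block_state :: "nat \<Rightarrow> bool \<Rightarrow> nat"
  where "block_state j b = Suc (2 * j + of_bool b)"

text \<open>By truncated subtraction the initial state \<open>0\<close> gets exponent 0, and it is
  even like the states of big blocks. This does no harm, since in a run it occurs at the first
  position only and hence never cofinally below a limit.\<close>

definition state_exponent :: "nat \<Rightarrow> nat"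
  where "state_exponent q = (q - 1) div 2"

lemma state_exponent_block_state [simp]: "state_exponent (block_state j b) = j"
  by (simp add: state_exponent_def block_state_def)

lemma even_block_state [simp]: "even (block_state j b) \<longleftrightarrow> b"
  by (simp add: block_state_def)

lemma block_state_inject [simp]: "block_state j b = block_state j' b' \<longleftrightarrow> j = j' \<and> b = b'"
proof
  assume eq: "block_state j b = block_state j' b'"
  show "j = j' \<and> b = b'"
    using arg_cong[OF eq, of state_exponent] arg_cong[OF eq, of even] by simp
qed simp

text \<open>The bound \<open>2 * n + 2\<close> is \<open>block_state n True\<close>, the largest
  state in use; it cuts off limit transitions to exponents above \<open>n\<close>, which words of
  length omega^n never call for.\<close>

definition small_automaton :: "nat \<Rightarrow> 'a set \<Rightarrow> ('a \<Rightarrow> bool) \<Rightarrow> (nat, 'a) ordinal_automaton"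
  where "small_automaton n \<Sigma> \<phi> =
    \<lparr>alphabet = \<Sigma>, states = {..2 * n + 2}, init = 0,
     succ_trans = {(q, a, q'). q \<le> 2 * n + 2 \<and> a \<in> \<Sigma> \<and> q' = block_state 0 (\<phi> a)},
     lim_trans = {(C, q). C \<subseteq> {..2 * n + 2} \<and> q \<le> 2 * n + 2 \<and>
       (let j = Max (state_exponent ` C)
        in q = block_state (Suc j) (\<exists>c\<in>C. state_exponent c = j \<and> even c))},
     final = {block_state n False}\<rparr>"

lemma ordinal_buchi_small_automaton: "finite \<Sigma> \<Longrightarrow> ordinal_buchi (small_automaton n \<Sigma> \<phi>)"
  by (auto simp: ordinal_buchi_def small_automaton_def block_state_def)

lemma big_append_Suc:
  "big (Suc j) {ts. P (us @ ts)} \<longleftrightarrow> (\<exists>\<^sub>\<infinity>d. big j {ts. P ((us @ [d]) @ ts)})"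
  by simp

text \<open>Correctness of the limit rule. Among the proper sub-blocks of \<open>us\<close>, only
  those of the form \<open>us @ [d]\<close> have the exponent \<open>j\<close>. By the pigeonhole
  principle infinitely many of them share a bit, so \<open>j\<close> is the maximal exponent seen
  cofinally; the bit for big is seen iff infinitely many of them are big.\<close>

lemma limit_transition:
  fixes n and P :: "nat list \<Rightarrow> bool"
  defines "val \<equiv> \<lambda>us. block_state (n - length us) (big (n - length us) {ts. P (us @ ts)})"
  assumes us: "length us < n"
    and x: "\<And>d vs. length us + length vs < n \<Longrightarrow> x (block_end n (us @ d # vs)) = val (us @ d # vs)"
  defines "C \<equiv> cofinal_states (omega_pow1 n) x (block_end n us)"
  shows "C \<subseteq> {..2 * n + 2}"
    "block_state (Suc (Max (state_exponent ` C))) (\<exists>c\<in>C. state_exponent c = Max (state_exponent ` C) \<and> even c) = val us"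
proof -
  define j where "j = n - Suc (length us)"
  have j: "n - length us = Suc j"
    using us by (simp add: j_def)
  have C: "C = {q. \<exists>\<^sub>\<infinity>d. \<exists>vs. length us + length vs < n \<and> val (us @ d # vs) = q}"
    unfolding C_def cofinal_states_omega_pow1[OF us] by (simp add: x cong: conj_cong)
  have C_mem: "\<exists>d vs. length us + length vs < n \<and> q = val (us @ d # vs)" if "q \<in> C" for q
    using that unfolding C by (auto dest!: INFM_EX)
  show sub: "C \<subseteq> {..2 * n + 2}"
    using C_mem by (fastforce simp: val_def block_state_def)
  then have fin: "finite C"
    by (rule finite_subset) simp
  have top: "block_state j b \<in> C \<longleftrightarrow> (\<exists>\<^sub>\<infinity>d. big j {ts. P ((us @ [d]) @ ts)} = b)" for b
  proof -
    have "(\<exists>vs. length us + length vs < n \<and> val (us @ d # vs) = block_state j b) \<longleftrightarrow>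
        big j {ts. P ((us @ [d]) @ ts)} = b" for d
    proof
      assume "\<exists>vs. length us + length vs < n \<and> val (us @ d # vs) = block_state j b"
      then obtain vs where vs: "length us + length vs < n" "val (us @ d # vs) = block_state j b"
        by blast
      then have "n - Suc (length us + length vs) = n - Suc (length us)"
        unfolding val_def by (simp add: j_def)
      then have "length vs = 0"
        using vs(1) by linarith
      then show "big j {ts. P ((us @ [d]) @ ts)} = b"
        using vs(2) by (simp add: val_def j_def)
    next
      assume "big j {ts. P ((us @ [d]) @ ts)} = b"
      then show "\<exists>vs. length us + length vs < n \<and> val (us @ d # vs) = block_state j b"
        using us by (intro exI[of _ "[]"]) (simp add: val_def j_def)
    qed
    then show ?thesis
      unfolding C by simp
  qed
  have le: "state_exponent q \<le> j" if "q \<in> C" for q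
    using C_mem[OF that] by (auto simp: val_def j_def)
  have "(\<exists>\<^sub>\<infinity>d. big j {ts. P ((us @ [d]) @ ts)} = True) \<or> (\<exists>\<^sub>\<infinity>d. big j {ts. P ((us @ [d]) @ ts)} = False)"
    unfolding INFM_disj_distrib[symmetric] by (simp add: INFM_nat_le)
  then obtain b where "block_state j b \<in> C"
    using top by blast
  then have "j \<in> state_exponent ` C"
    by force
  then have Max: "Max (state_exponent ` C) = j"
    using fin le by (intro Max_eqI) auto
  have "(\<exists>c\<in>C. state_exponent c = j \<and> even c) \<longleftrightarrow> block_state j True \<in> C"
  proof
    assume "\<exists>c\<in>C. state_exponent c = j \<and> even c"
    then obtain c where c: "c \<in> C" "state_exponent c = j" "even c" by blast
    moreover have "c = block_state (state_exponent c) (even c)"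
      using C_mem[OF c(1)] by (auto simp: val_def)
    ultimately show "block_state j True \<in> C" by simp
  qed (rule bexI[of _ "block_state j True"], simp_all)
  also have "\<dots> \<longleftrightarrow> big (Suc j) {ts. P (us @ ts)}"
    unfolding top big_append_Suc by simp
  finally show "block_state (Suc (Max (state_exponent ` C)))
      (\<exists>c\<in>C. state_exponent c = Max (state_exponent ` C) \<and> even c) = val us"
    unfolding Max val_def j by simp
qed

text \<open>Runs are unique: by induction on the exponent of the block, the state at each block end
  is forced to be \<open>val\<close>. Conversely \<open>val\<close>, completed by \<open>0\<close>
  at the first position, is a run. The last position ends the block of the empty list, that is, the
  whole word.\<close>

lemma language_small_automaton:
  "language (small_automaton n \<Sigma> \<phi>) (omega_pow n) =
    {w \<in> {xs. length xs = n} \<rightarrow>\<^sub>E \<Sigma>. \<not> big n {p. \<phi> (w p)}}"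
proof -
  let ?A = "small_automaton n \<Sigma> \<phi>"
  have iff: "(\<exists>x. is_run ?A (omega_pow n) w x \<and> x None \<in> final ?A) \<longleftrightarrow> \<not> big n {p. \<phi> (w p)}"
    if w: "w \<in> {xs. length xs = n} \<rightarrow>\<^sub>E \<Sigma>" for w
  proof -
    define val where "val us = block_state (n - length us) (big (n - length us) {ts. \<phi> (w (us @ ts))})" for us
    have val_None: "val [] \<in> final ?A \<longleftrightarrow> \<not> big n {p. \<phi> (w p)}"
      by (simp add: val_def small_automaton_def)
    have end_None: "block_end n [] = None"
      by (simp add: block_end_def)
    have val_n: "val us = block_state 0 (\<phi> (w us))" if "length us = n" for us
      using that by (simp add: val_def)
    have run: "x (block_end n us) = val us" if x: "is_run ?A (omega_pow n) w x" and "length us \<le> n" for x us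
      using that(2)
    proof (induction "n - length us" arbitrary: us rule: less_induct)
      case less
      show ?case
      proof (cases "length us = n")
        case True
        then have "(x (Some us), w us, x (block_end n us)) \<in> succ_trans ?A"
          using x is_next_omega_pow1[OF True] unfolding is_run_def Field_omega_pow by blast
        then show ?thesis
          using val_n[OF True] by (simp add: small_automaton_def)
      next
        case False
        then have us: "length us < n" using less.prems by simp
        have "x (block_end n (us @ d # vs)) = val (us @ d # vs)" if "length us + length vs < n" for d vs
          using that us by (intro less.hyps) auto
        note lim = limit_transition[of us n x "\<lambda>p. \<phi> (w p)", folded val_def, OF us this]
        have "(cofinal_states (omega_pow1 n) x (block_end n us), x (block_end n us)) \<in> lim_trans ?A"
          using x is_limit_omega_pow1 us unfolding is_run_def by blast
        then show ?thesis
          using lim(2) by (simp add: small_automaton_def Let_def)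
      qed
    qed
    define x where "x p = (if p = Some (replicate n 0) then 0 else val (THE us. block_end n us = p))" for p
    have first_ne: "block_end n us \<noteq> Some (replicate n 0)" if "length us \<le> n" for us
    proof
      assume first: "block_end n us = Some (replicate n 0)"
      have "(Some (us @ replicate (n - length us) 0), block_end n us) \<in> omega_pow1 n \<and>
          Some (us @ replicate (n - length us) 0) \<noteq> block_end n us"
        unfolding less_block_end[OF that] using that by simp
      then show False
        unfolding ord_plus_one_omega_pow first using not_lexn_replicate_0 by blast
    qed
    have x_end: "x (block_end n us) = val us" if "length us \<le> n" for us
    proof -
      have "(THE vs. block_end n vs = block_end n us) = us"
        using block_end_inject by (intro the_equality) auto
      then show ?thesis
        using first_ne[OF that] by (simp add: x_def)
    qed
    have val_le: "val us \<le> 2 * n + 2" for us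
      unfolding val_def block_state_def by (auto simp: of_bool_def)
    have "is_run ?A (omega_pow n) w x"
      unfolding is_run_def
    proof (intro conjI ballI allI impI)
      fix p assume "p \<in> Field (omega_pow1 n)"
      from omega_pow1_cases[OF this] show "x p \<in> states ?A"
        using x_end val_le by (auto simp: small_automaton_def x_def)
    next
      fix p assume "is_first (omega_pow1 n) p"
      then show "x p = init ?A"
        by (simp add: is_first_omega_pow1 x_def small_automaton_def)
    next
      fix p q assume p: "p \<in> Field (omega_pow n)" and "is_next (omega_pow1 n) (Some p) q"
      then have len: "length p = n" and q: "q = block_end n p"
        using is_next_omega_pow1 by (auto simp: Field_omega_pow)
      have "x (Some p) \<le> 2 * n + 2"
        using omega_pow1_cases[of "Some p" n] len x_end val_le by (auto simp: Field_omega_pow1 x_def)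
      moreover have "w p \<in> \<Sigma>"
        using w len by auto
      ultimately show "(x (Some p), w p, x q) \<in> succ_trans ?A"
        using len x_end[of p] val_n[OF len] unfolding q by (simp add: small_automaton_def)
    next
      fix p assume "is_limit (omega_pow1 n) p"
      then obtain us where us: "length us < n" and p: "p = block_end n us"
        unfolding is_limit_omega_pow1 by blast
      have "x (block_end n (us @ d # vs)) = val (us @ d # vs)" if "length us + length vs < n" for d vs
        using that by (intro x_end) auto
      note lim = limit_transition[of us n x "\<lambda>p. \<phi> (w p)", folded val_def, OF us this]
      show "(cofinal_states (omega_pow1 n) x p, x p) \<in> lim_trans ?A"
        using lim x_end[of us] us val_le[of us] unfolding p by (simp add: small_automaton_def Let_def)
    qed
    moreover have "y None = val []" if "is_run ?A (omega_pow n) w y" for y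
      using run[OF that, of "[]"] end_None by simp
    ultimately show ?thesis
      using val_None by metis
  qed
  show ?thesis
    unfolding language_def Field_omega_pow using iff by (auto simp: small_automaton_def)
qed

lemma regular_small:
  assumes "finite \<Sigma>"
  shows "regular (omega_pow n) \<Sigma> {w \<in> {xs. length xs = n} \<rightarrow>\<^sub>E \<Sigma>. \<not> big n {p. \<phi> (w p)}}"
  unfolding regular_def
  by (intro exI[of _ "small_automaton n \<Sigma> \<phi>"])
    (simp add: ordinal_buchi_small_automaton assms language_small_automaton, simp add: small_automaton_def)

section \<open>Presentation of the matrix rings by words\<close>

lemma omega_class_cong:
  "(\<And>p. length p = n \<Longrightarrow> p \<in> A \<longleftrightarrow> p \<in> B) \<Longrightarrow> omega_class n A = omega_class n B"
  unfolding omega_class_def by (rule arg_cong[of _ _ "\<lambda>X. omega_equiv n `` {X}"]) auto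

lemma finsum_omega_class:
  "finite A \<Longrightarrow> (\<Oplus>\<^bsub>omega_ring n\<^esub>l\<in>A. omega_class n (X l)) = omega_class n {p. odd (card {l \<in> A. p \<in> X l})}"
proof (induction A rule: finite_induct)
  case empty
  interpret cring "omega_ring n" by (rule cring_omega_ring)
  show ?case by simp
next
  case (insert a A)
  interpret cring "omega_ring n" by (rule cring_omega_ring)
  have "{l \<in> insert a A. p \<in> X l} = (if p \<in> X a then insert a {l \<in> A. p \<in> X l} else {l \<in> A. p \<in> X l})" for p
    by auto
  then have "card {l \<in> insert a A. p \<in> X l} = card {l \<in> A. p \<in> X l} + (if p \<in> X a then 1 else 0)" for p
    using insert.hyps by simp
  then have "{p. odd (card {l \<in> insert a A. p \<in> X l})} = sym_diff (X a) {p. odd (card {l \<in> A. p \<in> X l})}"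
    by auto
  moreover have "(\<Oplus>\<^bsub>omega_ring n\<^esub>l\<in>insert a A. omega_class n (X l)) =
      omega_class n (X a) \<oplus>\<^bsub>omega_ring n\<^esub> (\<Oplus>\<^bsub>omega_ring n\<^esub>l\<in>A. omega_class n (X l))"
    using insert.hyps by (intro finsum_insert) auto
  ultimately show ?case
    by (simp add: insert.IH)
qed

lemma finite_product_alphabet: "finite \<Sigma> \<Longrightarrow> finite (product_alphabet m \<Sigma>)"
  using finite_lists_length_eq[of \<Sigma> m] by (simp add: product_alphabet_def conj_commute)

text \<open>Each relation of the presentation says that the positions violating some condition on
  single letters form a small set, so the one automaton above, with \<open>\<phi>\<close> marking
  violations, recognises them all.\<close>

lemma regular_convolution:
  assumes "finite \<Sigma>"
    and Q: "\<And>us. length us = m \<Longrightarrow> set us \<subseteq> {xs. length xs = n} \<rightarrow>\<^sub>E \<Sigma> \<Longrightarrow>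
      Q us \<longleftrightarrow> \<not> big n {p. length p = n \<and> \<phi> (map (\<lambda>u. u p) us)}"
  shows "regular (omega_pow n) (product_alphabet m \<Sigma>)
    {convolution (omega_pow n) us | us. length us = m \<and> set us \<subseteq> {xs. length xs = n} \<rightarrow>\<^sub>E \<Sigma> \<and> Q us}"
proof -
  let ?W = "{xs :: nat list. length xs = n}"
  let ?c = "convolution (omega_pow n) :: (nat list \<Rightarrow> 'a) list \<Rightarrow> _"
  have c: "?c us p = map (\<lambda>u. u p) us" if "length p = n" for us p
    using that by (simp add: convolution_def Field_omega_pow)
  have big_c: "big n {p. \<phi> (?c us p)} \<longleftrightarrow> big n {p. length p = n \<and> \<phi> (map (\<lambda>u. u p) us)}" for us
  proof -
    have "{p. \<phi> (?c us p)} \<inter> ?W = {p. length p = n \<and> \<phi> (map (\<lambda>u. u p) us)}"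
      using c by auto
    then show ?thesis by (metis big_Int_lists)
  qed
  have "{?c us | us. length us = m \<and> set us \<subseteq> ?W \<rightarrow>\<^sub>E \<Sigma> \<and> Q us} =
      {w \<in> ?W \<rightarrow>\<^sub>E product_alphabet m \<Sigma>. \<not> big n {p. \<phi> (w p)}}" (is "?lhs = ?rhs")
  proof (intro equalityI subsetI)
    fix w assume "w \<in> ?lhs"
    then obtain us where us: "w = ?c us" "length us = m" "set us \<subseteq> ?W \<rightarrow>\<^sub>E \<Sigma>" "Q us"
      by blast
    have "w \<in> ?W \<rightarrow>\<^sub>E product_alphabet m \<Sigma>"
      unfolding us(1) convolution_def Field_omega_pow using us(2,3)
      by (auto simp: product_alphabet_def PiE_iff)
    then show "w \<in> ?rhs"
      using us Q[OF us(2,3)] big_c[of us] by simp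
  next
    fix w assume w: "w \<in> ?rhs"
    define us where "us = map (\<lambda>i. \<lambda>p\<in>?W. w p ! i) [0..<m]"
    have wp: "length (w p) = m" "set (w p) \<subseteq> \<Sigma>" if "length p = n" for p
      using w that by (auto simp: product_alphabet_def PiE_iff)
    have len: "length us = m" by (simp add: us_def)
    have sub: "set us \<subseteq> ?W \<rightarrow>\<^sub>E \<Sigma>"
    proof -
      have "w p ! i \<in> \<Sigma>" if "length p = n" "i < m" for p i
        using wp[OF that(1)] nth_mem[of i "w p"] that(2) by auto
      then show ?thesis
        by (simp add: us_def image_subset_iff restrict_PiE_iff)
    qed
    have "?c us = w"
    proof (rule ext)
      fix p
      show "?c us p = w p"
      proof (cases "length p = n")
        case True
        then show ?thesis
          using wp(1)[OF True] by (simp add: c us_def comp_def) (metis map_nth)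
      next
        case False
        then show ?thesis
          using w by (auto simp: convolution_def Field_omega_pow PiE_iff extensional_def)
      qed
    qed
    moreover have "Q us"
      using Q[OF len sub] w big_c[of us] \<open>?c us = w\<close> by simp
    ultimately show "w \<in> ?lhs"
      using len sub by blast
  qed
  then show ?thesis
    using regular_small[OF finite_product_alphabet[OF assms(1)], of n m \<phi>] by simp
qed

text \<open>Modulo \<open>I\<close>, a matrix over \<open>\<R>\<^sub>n\<close> is a word of length \<open>\<omega>\<^sup>n\<close> over the finite ring of
  \<open>k \<times> k\<close> matrices over the two-element field, here given by the sets of their nonzero entries.\<close>

lemma automatic_omega_matrix_ring: "automatic_ring (omega_pow n) (omega_matrix_ring k n)"
proof -
  let ?W = "{xs :: nat list. length xs = n}"
  let ?K = "{..<k} \<times> {..<k}"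
  let ?R = "omega_matrix_ring k n"
  interpret R: cring "omega_ring n" by (rule cring_omega_ring)
  obtain g :: "(nat \<times> nat) set \<Rightarrow> nat" where g: "inj_on g (Pow ?K)"
    using finite_imp_inj_to_nat_seg[of "Pow ?K"] by auto
  define \<Sigma> where "\<Sigma> = g ` Pow ?K"
  define dec where "dec = inv_into (Pow ?K) g"
  have fin: "finite \<Sigma>" by (simp add: \<Sigma>_def)
  have dec_g: "dec (g A) = A" if "A \<subseteq> ?K" for A
    using g that by (simp add: dec_def)
  have g_in: "g A \<in> \<Sigma>" if "A \<subseteq> ?K" for A
    using that by (simp add: \<Sigma>_def)
  have dec_sub: "dec a \<subseteq> ?K" and g_dec: "g (dec a) = a" if "a \<in> \<Sigma>" for a
    using that dec_g unfolding \<Sigma>_def by auto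
  let ?L = "?W \<rightarrow>\<^sub>E \<Sigma>"
  define ent where "ent u q = {p. q \<in> dec (u p)}" for u :: "nat list \<Rightarrow> nat" and q
  define F where "F u = (\<lambda>q\<in>?K. omega_class n (ent u q))" for u
  have F_closed: "F u \<in> carrier ?R" for u
    by (auto simp: F_def omega_matrix_ring_def matrix_ring_def)
  have F_surj: "\<exists>u\<in>?L. F u = A" if A: "A \<in> carrier ?R" for A
  proof -
    have "\<forall>q\<in>?K. \<exists>X. A q = omega_class n X"
      using A by (auto simp: omega_matrix_ring_def matrix_ring_def carrier_omega_ring_eq)
    then obtain X where X: "\<And>q. q \<in> ?K \<Longrightarrow> A q = omega_class n (X q)"
      by metis
    define u where "u = (\<lambda>p\<in>?W. g {q \<in> ?K. p \<in> X q})"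
    have "g {q \<in> ?K. p \<in> X q} \<in> \<Sigma>" for p
      by (rule g_in) blast
    then have "u \<in> ?L"
      by (simp add: u_def restrict_PiE_iff)
    moreover have "F u = A"
    proof (rule matrix_ring_eqI[of _ k "omega_ring n"])
      fix i j assume ij: "i < k" "j < k"
      have "dec (u p) = {q \<in> ?K. p \<in> X q}" if "length p = n" for p
        using that dec_g[of "{q \<in> ?K. p \<in> X q}"] unfolding u_def by (simp add: subset_iff)
      then have "omega_class n (ent u (i, j)) = omega_class n (X (i, j))"
        using ij by (intro omega_class_cong) (auto simp: ent_def)
      then show "F u (i, j) = A (i, j)"
        using X ij by (simp add: F_def)
    qed (use F_closed A in \<open>auto simp: omega_matrix_ring_def\<close>)
    ultimately show ?thesis by blast
  qed
  have F_eq: "F u = F v \<longleftrightarrow> \<not> big n {p. length p = n \<and> u p \<noteq> v p}" if uv: "u \<in> ?L" "v \<in> ?L" for u v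
  proof -
    have "F u = F v \<longleftrightarrow> (\<forall>q\<in>?K. omega_class n (ent u q) = omega_class n (ent v q))"
    proof
      assume eq: "F u = F v"
      show "\<forall>q\<in>?K. omega_class n (ent u q) = omega_class n (ent v q)"
      proof
        fix q assume "q \<in> ?K"
        then show "omega_class n (ent u q) = omega_class n (ent v q)"
          using fun_cong[OF eq, of q] by (simp add: F_def)
      qed
    next
      assume "\<forall>q\<in>?K. omega_class n (ent u q) = omega_class n (ent v q)"
      then show "F u = F v"
        unfolding F_def by (intro restrict_ext) blast
    qed
    also have "\<dots> \<longleftrightarrow> \<not> big n (\<Union>q\<in>?K. sym_diff (ent u q) (ent v q))"
      by (simp only: omega_class_eq_iff big_UN[OF finite_cartesian_product[OF finite_lessThan finite_lessThan]]) blast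
    also have "big n (\<Union>q\<in>?K. sym_diff (ent u q) (ent v q)) \<longleftrightarrow>
        big n ((\<Union>q\<in>?K. sym_diff (ent u q) (ent v q)) \<inter> ?W)"
      by (simp only: big_Int_lists)
    also have "(\<Union>q\<in>?K. sym_diff (ent u q) (ent v q)) \<inter> ?W = {p. length p = n \<and> u p \<noteq> v p}"
    proof -
      have "(\<exists>q\<in>?K. (q \<in> dec (u p)) \<noteq> (q \<in> dec (v p))) \<longleftrightarrow> u p \<noteq> v p" if "length p = n" for p
      proof -
        have in_\<Sigma>: "u p \<in> \<Sigma>" "v p \<in> \<Sigma>"
          using uv that by auto
        have "(\<exists>q\<in>?K. (q \<in> dec (u p)) \<noteq> (q \<in> dec (v p))) \<longleftrightarrow> dec (u p) \<noteq> dec (v p)"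
          using dec_sub[OF in_\<Sigma>(1)] dec_sub[OF in_\<Sigma>(2)] by blast
        also have "\<dots> \<longleftrightarrow> u p \<noteq> v p"
          using g_dec[OF in_\<Sigma>(1)] g_dec[OF in_\<Sigma>(2)] by metis
        finally show ?thesis .
      qed
      then show ?thesis
        unfolding ent_def by blast
    qed
    finally show ?thesis .
  qed
  \<comment> \<open>The ring operations are pointwise modulo the ideal, so matrix operations can be
    computed letter by letter over the two-element field.\<close>
  define pw where "pw f u v = (\<lambda>p\<in>?W. g (f (dec (u p)) (dec (v p))))"
    for f :: "(nat \<times> nat) set \<Rightarrow> (nat \<times> nat) set \<Rightarrow> (nat \<times> nat) set" and u v :: "nat list \<Rightarrow> nat"
  have L_dec: "dec (u p) \<subseteq> ?K" if "u \<in> ?L" "length p = n" for u p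
    using that by (intro dec_sub) auto
  have pw_L: "pw f u v \<in> ?L" if "\<And>A B. A \<subseteq> ?K \<Longrightarrow> B \<subseteq> ?K \<Longrightarrow> f A B \<subseteq> ?K" "u \<in> ?L" "v \<in> ?L" for f u v
    unfolding pw_def restrict_PiE_iff using that L_dec by (simp add: g_in)
  have ent_pw: "p \<in> ent (pw f u v) q \<longleftrightarrow> q \<in> f (dec (u p)) (dec (v p))"
    if "\<And>A B. A \<subseteq> ?K \<Longrightarrow> B \<subseteq> ?K \<Longrightarrow> f A B \<subseteq> ?K" "u \<in> ?L" "v \<in> ?L" "length p = n" for f u v p q
    using that L_dec by (simp add: pw_def ent_def dec_g)
  have add_K: "sym_diff A B \<subseteq> ?K" if "A \<subseteq> ?K" "B \<subseteq> ?K" for A B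
    using that by blast
  have F_add: "F (pw sym_diff u v) = F u \<oplus>\<^bsub>?R\<^esub> F v" if uv: "u \<in> ?L" "v \<in> ?L" for u v
    unfolding omega_matrix_ring_def
  proof (rule matrix_ring_eqI[of _ k "omega_ring n"])
    fix i j assume ij: "i < k" "j < k"
    have "omega_class n (ent (pw sym_diff u v) (i, j)) = omega_class n (sym_diff (ent u (i, j)) (ent v (i, j)))"
      using ent_pw[of sym_diff, OF add_K uv] by (intro omega_class_cong) (auto simp: ent_def)
    then show "F (pw sym_diff u v) (i, j) = (F u \<oplus>\<^bsub>matrix_ring k (omega_ring n)\<^esub> F v) (i, j)"
      using ij by (simp add: F_def)
  qed (use F_closed in \<open>auto simp: omega_matrix_ring_def intro!: R.matrix_ring_closed\<close>)
  \<comment> \<open>Over the two-element field, an entry of a product is the parity of the number of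
    nonzero summands.\<close>
  define mul where "mul A B = {q \<in> ?K. odd (card {l \<in> {..<k}. (fst q, l) \<in> A \<and> (l, snd q) \<in> B})}"
    for A B :: "(nat \<times> nat) set"
  have mul_K: "mul A B \<subseteq> ?K" for A B
    by (auto simp: mul_def)
  have F_mult: "F (pw mul u v) = F u \<otimes>\<^bsub>?R\<^esub> F v" if uv: "u \<in> ?L" "v \<in> ?L" for u v
    unfolding omega_matrix_ring_def
  proof (rule matrix_ring_eqI[of _ k "omega_ring n"])
    fix i j assume ij: "i < k" "j < k"
    have "(\<Oplus>\<^bsub>omega_ring n\<^esub>l\<in>{..<k}. F u (i, l) \<otimes>\<^bsub>omega_ring n\<^esub> F v (l, j)) =
        (\<Oplus>\<^bsub>omega_ring n\<^esub>l\<in>{..<k}. omega_class n (ent u (i, l) \<inter> ent v (l, j)))"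
      using ij by (intro R.finsum_cong') (auto simp: F_def)
    also have "\<dots> = omega_class n {p. odd (card {l \<in> {..<k}. p \<in> ent u (i, l) \<inter> ent v (l, j)})}"
      by (simp add: finsum_omega_class)
    also have "\<dots> = omega_class n (ent (pw mul u v) (i, j))"
      using ent_pw[of mul, OF mul_K uv] ij by (intro omega_class_cong) (simp add: ent_def mul_def)
    finally show "F (pw mul u v) (i, j) = (F u \<otimes>\<^bsub>matrix_ring k (omega_ring n)\<^esub> F v) (i, j)"
      using ij by (simp add: F_def)
  qed (use F_closed in \<open>auto simp: omega_matrix_ring_def intro!: R.matrix_ring_closed\<close>)
  define E where "E = {(u, v). u \<in> ?L \<and> v \<in> ?L \<and> F u = F v}"
  define f where "f C = F (SOME u. u \<in> C)" for C
  have f_class: "f (E `` {u}) = F u" if "u \<in> ?L" for u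
  proof -
    have "u \<in> E `` {u}" using that by (simp add: E_def)
    then have "(SOME v. v \<in> E `` {u}) \<in> E `` {u}" by (rule someI[of "\<lambda>v. v \<in> E `` {u}"])
    moreover have "F v = F u" if "v \<in> E `` {u}" for v
      using that by (simp add: E_def)
    ultimately show ?thesis
      unfolding f_def by blast
  qed
  have equiv: "equiv ?L E"
    by (auto simp: equiv_def refl_on_def sym_def trans_def E_def)
  have bij: "bij_betw f (?L // E) (carrier ?R)"
  proof (rule bij_betw_imageI)
    show "inj_on f (?L // E)"
    proof (rule inj_onI)
      fix C D assume "C \<in> ?L // E" "D \<in> ?L // E" and eq: "f C = f D"
      then obtain u v where "u \<in> ?L" "C = E `` {u}" "v \<in> ?L" "D = E `` {v}"
        by (auto elim!: quotientE)
      then show "C = D"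
        using eq f_class by (auto simp: E_def)
    qed
    have "f ` (?L // E) = F ` ?L"
    proof (intro equalityI subsetI)
      fix y assume "y \<in> f ` (?L // E)"
      then obtain u where "u \<in> ?L" "y = f (E `` {u})" by (auto elim!: quotientE)
      then show "y \<in> F ` ?L" using f_class by simp
    next
      fix y assume "y \<in> F ` ?L"
      then obtain u where u: "u \<in> ?L" "y = F u" by blast
      then show "y \<in> f ` (?L // E)"
        by (intro image_eqI[OF _ quotientI[OF u(1)]]) (simp add: f_class)
    qed
    also have "F ` ?L = carrier ?R"
    proof (intro equalityI subsetI)
      fix A assume "A \<in> carrier ?R"
      then show "A \<in> F ` ?L" using F_surj by blast
    qed (use F_closed in blast)
    finally show "f ` (?L // E) = carrier ?R" .
  qed
  \<comment> \<open>With no letter marked, every word is accepted.\<close>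
  have reg_L: "regular (omega_pow n) \<Sigma> ?L"
    using regular_small[OF fin, of n "\<lambda>_. False"] by simp
  have "{convolution (omega_pow n) [u, v] | u v. (u, v) \<in> E} =
      {convolution (omega_pow n) us | us. length us = 2 \<and> set us \<subseteq> ?L \<and> F (us ! 0) = F (us ! 1)}" (is "?lhs = ?rhs")
  proof (intro equalityI subsetI)
    fix w assume "w \<in> ?lhs"
    then obtain u v where "w = convolution (omega_pow n) [u, v]" "(u, v) \<in> E" by blast
    then show "w \<in> ?rhs"
      by (intro CollectI exI[of _ "[u, v]"]) (simp add: E_def)
  next
    fix w assume "w \<in> ?rhs"
    then obtain us where us: "w = convolution (omega_pow n) us" "length us = 2" "set us \<subseteq> ?L" "F (us ! 0) = F (us ! 1)"
      by blast
    then obtain u v where "us = [u, v]"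
      by (auto simp: numeral_2_eq_2 length_Suc_conv)
    then show "w \<in> ?lhs" using us by (auto simp: E_def)
  qed
  also have "regular (omega_pow n) (product_alphabet 2 \<Sigma>) \<dots>"
  proof (rule regular_convolution[OF fin, where \<phi> = "\<lambda>as. as ! 0 \<noteq> as ! 1"])
    fix us :: "(nat list \<Rightarrow> nat) list" assume "length us = 2" "set us \<subseteq> ?L"
    then obtain u v where "us = [u, v]" "u \<in> ?L" "v \<in> ?L"
      by (auto simp: numeral_2_eq_2 length_Suc_conv)
    then show "F (us ! 0) = F (us ! 1) \<longleftrightarrow> \<not> big n {p. length p = n \<and> map (\<lambda>u. u p) us ! 0 \<noteq> map (\<lambda>u. u p) us ! 1}"
      using F_eq[of u v] by simp
  qed
  finally have reg_E: "regular (omega_pow n) (product_alphabet 2 \<Sigma>) {convolution (omega_pow n) [u, v] | u v. (u, v) \<in> E}" .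
  have reg_op: "regular (omega_pow n) (product_alphabet 3 \<Sigma>)
      {convolution (omega_pow n) us | us. length us = 3 \<and> set us \<subseteq> ?L \<and>
        map (\<lambda>u. f (E `` {u})) us \<in> {[x, y, h x y] | x y. x \<in> carrier ?R \<and> y \<in> carrier ?R}}"
    if op_K: "\<And>A B. A \<subseteq> ?K \<Longrightarrow> B \<subseteq> ?K \<Longrightarrow> op A B \<subseteq> ?K"
      and h: "\<And>u v. u \<in> ?L \<Longrightarrow> v \<in> ?L \<Longrightarrow> F (pw op u v) = h (F u) (F v)" for op h
  \<comment> \<open>The marked positions are those where the third letter differs from the result
    computed from the first two.\<close>
  proof (rule regular_convolution[OF fin, where \<phi> = "\<lambda>as. as ! 2 \<noteq> g (op (dec (as ! 0)) (dec (as ! 1)))"])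
    fix us :: "(nat list \<Rightarrow> nat) list" assume "length us = 3" "set us \<subseteq> ?L"
    then obtain u v t where us: "us = [u, v, t]" "u \<in> ?L" "v \<in> ?L" "t \<in> ?L"
      by (auto simp: numeral_3_eq_3 length_Suc_conv)
    have "map (\<lambda>u. f (E `` {u})) us \<in> {[x, y, h x y] | x y. x \<in> carrier ?R \<and> y \<in> carrier ?R} \<longleftrightarrow> F t = F (pw op u v)"
      using us F_closed h[OF us(2,3)] by (auto simp: f_class)
    also have "\<dots> \<longleftrightarrow> \<not> big n {p. length p = n \<and> t p \<noteq> pw op u v p}"
      using us op_K by (intro F_eq pw_L)
    also have "{p. length p = n \<and> t p \<noteq> pw op u v p} =
        {p. length p = n \<and> map (\<lambda>u. u p) us ! 2 \<noteq> g (op (dec (map (\<lambda>u. u p) us ! 0)) (dec (map (\<lambda>u. u p) us ! 1)))}"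
      using us by (auto simp: pw_def)
    finally show "map (\<lambda>u. f (E `` {u})) us \<in> {[x, y, h x y] | x y. x \<in> carrier ?R \<and> y \<in> carrier ?R} \<longleftrightarrow>
        \<not> big n {p. length p = n \<and> map (\<lambda>u. u p) us ! 2 \<noteq> g (op (dec (map (\<lambda>u. u p) us ! 0)) (dec (map (\<lambda>u. u p) us ! 1)))}" .
  qed
  define e1 where "e1 = (\<lambda>p\<in>?W. g {q \<in> ?K. fst q = snd q})"
  have "g {q \<in> ?K. fst q = snd q} \<in> \<Sigma>"
    by (rule g_in) blast
  then have e1: "e1 \<in> ?L"
    by (simp add: e1_def restrict_PiE_iff)
  have F_e1: "F e1 = \<one>\<^bsub>?R\<^esub>"
    unfolding omega_matrix_ring_def
  proof (rule matrix_ring_eqI[of _ k "omega_ring n"])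
    fix i j assume ij: "i < k" "j < k"
    have "{q \<in> ?K. fst q = snd q} \<subseteq> ?K" by blast
    then have "dec (e1 p) = {q \<in> ?K. fst q = snd q}" if "length p = n" for p
      using that by (simp add: e1_def dec_g)
    then have "omega_class n (ent e1 (i, j)) = omega_class n (if i = j then UNIV else {})"
      using ij by (intro omega_class_cong) (auto simp: ent_def)
    then show "F e1 (i, j) = \<one>\<^bsub>matrix_ring k (omega_ring n)\<^esub> (i, j)"
      using ij by (simp add: F_def)
  qed (use F_closed in \<open>auto simp: omega_matrix_ring_def intro!: R.matrix_ring_units_closed\<close>)
  have reg_one: "regular (omega_pow n) (product_alphabet 1 \<Sigma>)
      {convolution (omega_pow n) us | us. length us = 1 \<and> set us \<subseteq> ?L \<and>
        map (\<lambda>u. f (E `` {u})) us \<in> {[\<one>\<^bsub>?R\<^esub>]}}"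
  proof (rule regular_convolution[OF fin, where \<phi> = "\<lambda>as. as ! 0 \<noteq> g {q \<in> ?K. fst q = snd q}"])
    fix us :: "(nat list \<Rightarrow> nat) list" assume "length us = 1" "set us \<subseteq> ?L"
    then obtain u where us: "us = [u]" "u \<in> ?L"
      by (auto simp: length_Suc_conv)
    have "map (\<lambda>u. f (E `` {u})) us \<in> {[\<one>\<^bsub>?R\<^esub>]} \<longleftrightarrow> F u = F e1"
      using us by (simp add: f_class F_e1)
    also have "\<dots> \<longleftrightarrow> \<not> big n {p. length p = n \<and> u p \<noteq> e1 p}"
      by (rule F_eq[OF us(2) e1])
    also have "{p. length p = n \<and> u p \<noteq> e1 p} =
        {p. length p = n \<and> map (\<lambda>u. u p) us ! 0 \<noteq> g {q \<in> ?K. fst q = snd q}}"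
      using us by (auto simp: e1_def)
    finally show "map (\<lambda>u. f (E `` {u})) us \<in> {[\<one>\<^bsub>?R\<^esub>]} \<longleftrightarrow>
        \<not> big n {p. length p = n \<and> map (\<lambda>u. u p) us ! 0 \<noteq> g {q \<in> ?K. fst q = snd q}}" .
  qed
  show ?thesis
    unfolding automatic_ring_def automatic_structure_def
  proof (intro exI[of _ \<Sigma>] exI[of _ ?L] exI[of _ E] exI[of _ f] conjI reg_L equiv reg_E bij)
  qed (simp only: list.set ball_simps case_prod_conv simp_thms reg_op[OF add_K F_add]
      reg_op[OF mul_K F_mult] reg_one)
qed

section \<open>Isomorphisms under CH\<close>

text \<open>\<open>\<pi>\<close> will be \<open>fst\<close> or \<open>snd\<close>: with the pairs
  themselves as indices, corresponding atoms on the two sides have the same \<open>F\<close> and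
  \<open>G\<close>.\<close>

definition atom :: "('q \<Rightarrow> 'p set) \<Rightarrow> 'q set \<Rightarrow> 'q set \<Rightarrow> 'p set"
  where "atom \<pi> F G = {p. \<forall>q\<in>F. p \<in> \<pi> q \<longleftrightarrow> q \<in> G}"

text \<open>The pairs in \<open>P\<close> generate an isomorphism between subalgebras of \<open>\<R>\<^sub>m\<close> and \<open>\<R>\<^sub>n\<close>.\<close>

definition partial_iso :: "nat \<Rightarrow> nat \<Rightarrow> (nat list set \<times> nat list set) set \<Rightarrow> bool"
  where "partial_iso m n P \<longleftrightarrow>
    (\<forall>F G. finite F \<and> F \<subseteq> P \<longrightarrow> big m (atom fst F G) = big n (atom snd F G))"

lemma atom_insert:
  "atom \<pi> (insert q F) G = (if q \<in> G then atom \<pi> F G \<inter> \<pi> q else atom \<pi> F G - \<pi> q)"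
  by (auto simp: atom_def)

lemma atom_decompose:
  assumes "F \<subseteq> F'"
  shows "atom \<pi> F G = (\<Union>G'\<in>{G'\<in>Pow F'. \<forall>q\<in>F. q \<in> G' \<longleftrightarrow> q \<in> G}. atom \<pi> F' G')"
proof (intro equalityI subsetI)
  fix p assume "p \<in> atom \<pi> F G"
  then show "p \<in> (\<Union>G'\<in>{G'\<in>Pow F'. \<forall>q\<in>F. q \<in> G' \<longleftrightarrow> q \<in> G}. atom \<pi> F' G')"
    using assms by (intro UN_I[of "{q\<in>F'. p \<in> \<pi> q}"]) (auto simp: atom_def)
qed (use assms in \<open>auto simp: atom_def\<close>)

text \<open>The combination is a finite union of atoms over the three pairs. Three are enough for a
  binary operation: two arguments and the value.\<close>

lemma partial_iso_Boolean:
  assumes "partial_iso m n P" "q1 \<in> P" "q2 \<in> P" "q3 \<in> P"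
  shows "big m {p. B (p \<in> fst q1) (p \<in> fst q2) (p \<in> fst q3)} \<longleftrightarrow>
    big n {p. B (p \<in> snd q1) (p \<in> snd q2) (p \<in> snd q3)}"
proof -
  let ?F = "{q1, q2, q3}"
  let ?I = "{G \<in> Pow ?F. B (q1 \<in> G) (q2 \<in> G) (q3 \<in> G)}"
  have eq: "{p. B (p \<in> \<pi> q1) (p \<in> \<pi> q2) (p \<in> \<pi> q3)} = (\<Union>G\<in>?I. atom \<pi> ?F G)"
    for \<pi> :: "nat list set \<times> nat list set \<Rightarrow> nat list set"
  proof (intro equalityI subsetI)
    fix p assume "p \<in> {p. B (p \<in> \<pi> q1) (p \<in> \<pi> q2) (p \<in> \<pi> q3)}"
    then show "p \<in> (\<Union>G\<in>?I. atom \<pi> ?F G)"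
      by (intro UN_I[of "{q\<in>?F. p \<in> \<pi> q}"]) (auto simp: atom_def)
  next
    fix p assume "p \<in> (\<Union>G\<in>?I. atom \<pi> ?F G)"
    then obtain G where "B (q1 \<in> G) (q2 \<in> G) (q3 \<in> G)" "p \<in> atom \<pi> ?F G" by blast
    moreover from this have "p \<in> \<pi> q1 \<longleftrightarrow> q1 \<in> G" "p \<in> \<pi> q2 \<longleftrightarrow> q2 \<in> G" "p \<in> \<pi> q3 \<longleftrightarrow> q3 \<in> G"
      by (auto simp: atom_def)
    ultimately show "p \<in> {p. B (p \<in> \<pi> q1) (p \<in> \<pi> q2) (p \<in> \<pi> q3)}" by simp
  qed
  have fin: "finite ?I" by simp
  have "big m (atom fst ?F G) = big n (atom snd ?F G)" for G
    using assms unfolding partial_iso_def by simp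
  then show ?thesis
    unfolding eq big_UN[OF fin] by simp
qed

lemma partial_iso_converse:
  assumes "partial_iso m n P"
  shows "partial_iso n m (prod.swap ` P)"
  unfolding partial_iso_def
proof (intro allI impI)
  fix F G assume F: "finite F \<and> F \<subseteq> prod.swap ` P"
  have swap: "atom fst F G = atom snd (prod.swap ` F) (prod.swap ` G)"
    "atom snd F G = atom fst (prod.swap ` F) (prod.swap ` G)"
    unfolding atom_def by (auto simp: inj_image_mem_iff)
  have "finite (prod.swap ` F)" "prod.swap ` F \<subseteq> P"
    using F by auto
  then show "big n (atom fst F G) = big m (atom snd F G)"
    unfolding swap using assms by (simp add: partial_iso_def)
qed

text \<open>The condition is of finite character, and a finite subset of the union of a chain lies
  in one member.\<close>

lemma partial_iso_chain:
  assumes "subset.chain UNIV C" "C \<noteq> {}" "\<And>P. P \<in> C \<Longrightarrow> partial_iso m n P"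
  shows "partial_iso m n (\<Union>C)"
  unfolding partial_iso_def
proof (intro allI impI)
  fix F G assume F: "finite F \<and> F \<subseteq> \<Union>C"
  then obtain P where "P \<in> C" "F \<subseteq> P"
    using finite_subset_Union_chain[of F C UNIV] assms(1,2) by blast
  then show "big m (atom fst F G) = big n (atom snd F G)"
    using assms(3) F unfolding partial_iso_def by blast
qed

lemma partial_iso_empty: "partial_iso m n {}"
proof -
  have "big n UNIV" for n
    using big_mono[OF big_lists] by blast
  then show ?thesis
    by (simp add: partial_iso_def atom_def)
qed

text \<open>The reduced product \<open>\<R>\<^sub>n\<close> is countably saturated. The new set \<open>Y\<close> is determined block by block:
  in the \<open>s\<close>-th window of blocks, only the first \<open>s\<close> pairs in \<open>P\<close> are taken into account.\<close>

lemma partial_iso_extend: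
  assumes P: "partial_iso m (Suc n) P" and "countable P"
  shows "\<exists>Y. partial_iso m (Suc n) (insert (X, Y) P)"
proof -
  obtain e :: "nat \<Rightarrow> nat list set \<times> nat list set" where e: "P \<subseteq> range e"
    using \<open>countable P\<close> by (metis subset_range_from_nat_into)
  define F where "F s = P \<inter> e ` {..<s}" for s
  have F: "finite (F s)" "F s \<subseteq> P" for s
    by (auto simp: F_def)
  have F_mono: "F s \<subseteq> F t" if "s \<le> t" for s t
    using that by (auto simp: F_def)
  have F_cover: "\<exists>s. F' \<subseteq> F s" if "finite F'" "F' \<subseteq> P" for F'
    using that
  proof (induction F' rule: finite_induct)
    case (insert q F')
    then obtain s t where "F' \<subseteq> F s" "q = e t" using e by blast
    then have "insert q F' \<subseteq> F (max s (Suc t))"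
      using insert.prems F_mono[of s "max s (Suc t)"] by (auto simp: F_def)
    then show ?case by blast
  qed simp
  define hit where "hit i A = big n {xs. i # xs \<in> A}" for i A
  have big_hit: "big (Suc n) A \<longleftrightarrow> (\<exists>\<^sub>\<infinity>i. hit i A)" for A
    by (simp add: hit_def)
  have hit_mono: "hit i B" if "hit i A" "\<And>p. p \<in> A \<Longrightarrow> p \<noteq> [] \<Longrightarrow> hd p = i \<Longrightarrow> p \<in> B" for i A B
    using that unfolding hit_def by (elim big_mono) auto
  let ?a = "\<lambda>s G. atom fst (F s) G" and ?b = "\<lambda>s G. atom snd (F s) G"
  have ab: "big m (?a s G) \<longleftrightarrow> big (Suc n) (?b s G)" for s G
    using P F unfolding partial_iso_def by blast
  \<comment> \<open>Two hits of each big atom leave one block for \<open>Y\<close> and one for its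
    complement. The last condition keeps the small atoms of stage \<open>s + 1\<close> without hits
    from the next window on.\<close>
  define window where "window s b b' \<longleftrightarrow> b < b' \<and>
    (\<forall>G\<in>Pow (F s). big (Suc n) (?b s G) \<longrightarrow> (\<exists>i i'. b \<le> i \<and> i < i' \<and> i' < b' \<and> hit i (?b s G) \<and> hit i' (?b s G))) \<and>
    (\<forall>G\<in>Pow (F (Suc s)). \<not> big (Suc n) (?b (Suc s) G) \<longrightarrow> (\<forall>i\<ge>b'. \<not> hit i (?b (Suc s) G)))" for s b b'
  have "\<exists>b'. window s b b'" for s b
  proof -
    have "\<forall>\<^sub>F b' in sequentially. \<forall>G\<in>Pow (F s). big (Suc n) (?b s G) \<longrightarrow>
        (\<exists>i i'. b \<le> i \<and> i < i' \<and> i' < b' \<and> hit i (?b s G) \<and> hit i' (?b s G))"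
    proof (intro eventually_ball_finite ballI)
      fix G
      show "\<forall>\<^sub>F b' in sequentially. big (Suc n) (?b s G) \<longrightarrow>
          (\<exists>i i'. b \<le> i \<and> i < i' \<and> i' < b' \<and> hit i (?b s G) \<and> hit i' (?b s G))"
      proof (cases "big (Suc n) (?b s G)")
        case True
        then obtain i i' where "b \<le> i" "hit i (?b s G)" "i < i'" "hit i' (?b s G)"
          unfolding big_hit INFM_nat_le by (meson Suc_le_eq)
        then show ?thesis
          by (intro eventually_sequentiallyI[of "Suc i'"]) (auto simp: Suc_le_eq)
      qed (simp del: big.simps)
    qed (use F in simp)
    moreover have "\<forall>\<^sub>F b' in sequentially. \<forall>G\<in>Pow (F (Suc s)). \<not> big (Suc n) (?b (Suc s) G) \<longrightarrow>
        (\<forall>i\<ge>b'. \<not> hit i (?b (Suc s) G))"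
    proof (intro eventually_ball_finite ballI)
      fix G
      show "\<forall>\<^sub>F b' in sequentially. \<not> big (Suc n) (?b (Suc s) G) \<longrightarrow> (\<forall>i\<ge>b'. \<not> hit i (?b (Suc s) G))"
      proof (cases "big (Suc n) (?b (Suc s) G)")
        case False
        then obtain c where "\<And>i. i \<ge> c \<Longrightarrow> \<not> hit i (?b (Suc s) G)"
          unfolding big_hit INFM_nat_le by blast
        then show ?thesis
          by (intro eventually_sequentiallyI[of c]) auto
      qed (simp del: big.simps)
    qed (use F in simp)
    ultimately have "\<forall>\<^sub>F b' in sequentially. window s b b'"
      unfolding window_def using eventually_gt_at_top[of b] by eventually_elim blast
    then show ?thesis
      by (rule eventually_happens'[OF sequentially_bot])
  qed
  then obtain next_window where next_window: "\<And>s b. window s b (next_window s b)"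
    by metis
  define N where "N = rec_nat 0 next_window"
  have N: "window s (N s) (N (Suc s))" for s
    using next_window by (simp add: N_def)
  have N_strict: "strict_mono N"
    using N unfolding window_def strict_mono_Suc_iff by blast
  define stage where "stage i = (LEAST s. i < N (Suc s))" for i
  have stage: "stage i = s" if "N s \<le> i" "i < N (Suc s)" for i s
    unfolding stage_def
  proof (rule Least_equality)
    show "s \<le> t" if "i < N (Suc t)" for t
    proof (rule ccontr)
      assume "\<not> s \<le> t"
      then have "N (Suc t) \<le> N s"
        using strict_mono_less_eq[OF N_strict] by simp
      then show False using that \<open>N s \<le> i\<close> by simp
    qed
  qed fact
  have stage_ge: "\<exists>t\<ge>s. N t \<le> i \<and> i < N (Suc t)" if "N s \<le> i" for i s
  proof -
    have "i < N (Suc i)"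
      using strict_mono_imp_increasing[OF N_strict, of "Suc i"] by simp
    then have "i < N (Suc (stage i))"
      unfolding stage_def by (rule LeastI)
    moreover have "\<not> i < N (stage i)" if "stage i = Suc t" for t
      using not_less_Least[of t "\<lambda>s. i < N (Suc s)"] that by (simp add: stage_def)
    then have "N (stage i) \<le> i"
      using \<open>i < N (Suc i)\<close> by (cases "stage i") (auto simp: N_def not_less)
    moreover have "stage i \<ge> s"
    proof (rule ccontr)
      assume "\<not> s \<le> stage i"
      then have "N (Suc (stage i)) \<le> N s"
        using strict_mono_less_eq[OF N_strict] by simp
      then show False using \<open>i < N (Suc (stage i))\<close> that by simp
    qed
    ultimately show ?thesis by blast
  qed
  define first where "first s G = (LEAST i. N s \<le> i \<and> hit i (?b s G))" for s G
  \<comment> \<open>Inside window \<open>s\<close>, the atom of \<open>G\<close> avoids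
    \<open>Y\<close> if \<open>?a s G \<inter> X\<close> is small. Otherwise it lies in
    \<open>Y\<close> if \<open>?a s G - X\<close> is small, and contributes only the block of its
    first hit if both parts are big.\<close>
  define Y where "Y = {p. p \<noteq> [] \<and> (let s = stage (hd p); G = {q \<in> F s. p \<in> snd q} in
    big m (?a s G \<inter> X) \<and> (big m (?a s G - X) \<longrightarrow> hd p = first s G))}"
  have Y_iff: "p \<in> Y \<longleftrightarrow> big m (?a s G \<inter> X) \<and> (big m (?a s G - X) \<longrightarrow> hd p = first s G)"
    if "p \<noteq> []" "N s \<le> hd p" "hd p < N (Suc s)" "p \<in> ?b s G" "G \<subseteq> F s" for p s G
  proof -
    have "stage (hd p) = s" using stage that by blast
    moreover have "{q \<in> F s. p \<in> snd q} = G"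
      using that(4,5) by (auto simp: atom_def)
    ultimately show ?thesis
      using that(1) unfolding Y_def by (simp add: Let_def)
  qed
  have hits: "\<exists>i'. N s \<le> first s G \<and> first s G < i' \<and> i' < N (Suc s) \<and> hit (first s G) (?b s G) \<and> hit i' (?b s G)"
    if "big m (?a s G)" "G \<subseteq> F s" for s G
  proof -
    have G: "G \<in> Pow (F s)" "big (Suc n) (?b s G)"
      using that ab[of s G] by (simp_all del: big.simps)
    from mp[OF bspec[OF N[of s, unfolded window_def, THEN conjunct2, THEN conjunct1] G(1)] G(2)]
    obtain i i' where i: "N s \<le> i" "i < i'" "i' < N (Suc s)" "hit i (?b s G)" "hit i' (?b s G)"
      by (elim exE conjE)
    have "N s \<le> first s G \<and> hit (first s G) (?b s G)"
      unfolding first_def by (rule LeastI[of _ i]) (use i in simp)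
    moreover have "first s G \<le> i"
      unfolding first_def by (rule Least_le) (use i in simp)
    ultimately show ?thesis
      using i by (intro exI[of _ i']) auto
  qed
  \<comment> \<open>Splitting both atoms into atoms of a late stage \<open>s\<close> reduces the
    equivalences to the rule for \<open>Y\<close> in window \<open>s\<close>.\<close>
  have key: "(big m (atom fst F' G' \<inter> X) \<longleftrightarrow> big (Suc n) (atom snd F' G' \<inter> Y)) \<and>
      (big m (atom fst F' G' - X) \<longleftrightarrow> big (Suc n) (atom snd F' G' - Y))" if F': "finite F'" "F' \<subseteq> P" for F' G'
  proof -
    let ?A = "atom fst F' G'" and ?B = "atom snd F' G'"
    obtain s0 where s0: "F' \<subseteq> F s0"
      using F_cover F' by blast
    then have sub: "F' \<subseteq> F s" if "s \<ge> s0" for s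
      using F_mono[OF that] by blast
    let ?I = "\<lambda>s. {G\<in>Pow (F s). \<forall>q\<in>F'. q \<in> G \<longleftrightarrow> q \<in> G'}"
    have fin: "finite (?I s)" for s
      using F by simp
    have A: "?A = (\<Union>G\<in>?I s. ?a s G)" and B: "?B = (\<Union>G\<in>?I s. ?b s G)" if "s \<ge> s0" for s
      by (rule atom_decompose[OF sub[OF that]])+
    have bigA: "\<exists>G\<in>?I s. big m (?a s G \<inter> Z)" if "big m (?A \<inter> Z)" "s \<ge> s0" for s Z
    proof -
      have "?A \<inter> Z = (\<Union>G\<in>?I s. ?a s G \<inter> Z)"
        unfolding A[OF that(2)] by blast
      then show ?thesis
        using that(1) unfolding big_UN[OF fin, symmetric] by simp
    qed
    have inf: "big (Suc n) C" if hits_C: "\<And>s. s \<ge> s0 \<Longrightarrow> \<exists>i\<ge>N s. hit i C" for C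
      unfolding big_hit INFM_nat_le
    proof
      fix b
      have "b \<le> N (max b s0)"
        using strict_mono_imp_increasing[OF N_strict, of "max b s0"] by simp
      moreover obtain i where "i \<ge> N (max b s0)" "hit i C"
        using hits_C[of "max b s0"] by auto
      ultimately show "\<exists>i\<ge>b. hit i C"
        by (intro exI[of _ i]) auto
    qed
    have fin_hit: "\<not> big (Suc n) C" if "\<And>s i. s \<ge> s0 \<Longrightarrow> N s \<le> i \<Longrightarrow> i < N (Suc s) \<Longrightarrow> \<not> hit i C" for C
    proof
      assume "big (Suc n) C"
      then obtain i where i: "N s0 \<le> i" "hit i C"
        unfolding big_hit INFM_nat_le by blast
      then show False
        using stage_ge[OF i(1)] that by blast
    qed
    have "big (Suc n) (?B \<inter> Y)" if "big m (?A \<inter> X)"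
    proof (rule inf)
      fix s assume s: "s \<ge> s0"
      obtain G where G: "G \<in> ?I s" "big m (?a s G \<inter> X)"
        using bigA[OF \<open>big m (?A \<inter> X)\<close> s] by blast
      have "big m (?a s G)" using G(2) big_mono by blast
      then obtain i' where i': "N s \<le> first s G" "first s G < i'" "i' < N (Suc s)" "hit (first s G) (?b s G)"
        using hits[of s G] G(1) by blast
      have "hit (first s G) (?B \<inter> Y)"
        using i'(4)
      proof (rule hit_mono)
        fix p assume p: "p \<in> ?b s G" "p \<noteq> []" "hd p = first s G"
        then have "p \<in> Y"
          using Y_iff[of p s G] G i' by auto
        moreover have "p \<in> ?B" unfolding B[OF s] using p(1) G(1) by blast
        ultimately show "p \<in> ?B \<inter> Y" by blast
      qed
      then show "\<exists>i\<ge>N s. hit i (?B \<inter> Y)" using i'(1) by blast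
    qed
    moreover have "big (Suc n) (?B - Y)" if "big m (?A - X)"
    proof (rule inf)
      fix s assume s: "s \<ge> s0"
      have "big m (?A \<inter> - X)"
        using that by (simp only: Diff_eq)
      then obtain G where G: "G \<in> ?I s" "big m (?a s G - X)"
        using bigA[OF _ s] unfolding Diff_eq by blast
      have "big m (?a s G)" using G(2) big_mono by blast
      then obtain i' where i': "N s \<le> first s G" "first s G < i'" "i' < N (Suc s)" "hit i' (?b s G)"
        using hits[of s G] G(1) by blast
      have "hit i' (?B - Y)"
        using i'(4)
      proof (rule hit_mono)
        fix p assume p: "p \<in> ?b s G" "p \<noteq> []" "hd p = i'"
        then have "p \<notin> Y"
          using Y_iff[of p s G] G i' by auto
        moreover have "p \<in> ?B" unfolding B[OF s] using p(1) G(1) by blast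
        ultimately show "p \<in> ?B - Y" by blast
      qed
      then show "\<exists>i\<ge>N s. hit i (?B - Y)" using i'(1,2) by (intro exI[of _ i']) auto
    qed
    moreover have "\<not> big (Suc n) (?B \<inter> Y)" if notbig: "\<not> big m (?A \<inter> X)"
    proof (rule fin_hit)
      fix s i assume s: "s \<ge> s0" "N s \<le> i" "i < N (Suc s)"
      show "\<not> hit i (?B \<inter> Y)"
      proof
        assume "hit i (?B \<inter> Y)"
        then have "hit i {}"
        proof (rule hit_mono)
          fix p assume p: "p \<in> ?B \<inter> Y" "p \<noteq> []" "hd p = i"
          then obtain G where G: "G \<in> ?I s" "p \<in> ?b s G"
            using B[OF s(1)] by blast
          have "?a s G \<inter> X \<subseteq> ?A \<inter> X"
            unfolding A[OF s(1)] using G(1) by blast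
          then have "\<not> big m (?a s G \<inter> X)" using notbig big_mono by blast
          then show "p \<in> {}" using Y_iff[of p s G] p G s by auto
        qed
        then show False by (simp add: hit_def)
      qed
    qed
    moreover have "\<not> big (Suc n) (?B - Y)" if notbig: "\<not> big m (?A - X)"
    proof (rule fin_hit)
      fix s i assume s: "s \<ge> s0" "N s \<le> i" "i < N (Suc s)"
      let ?J = "{G \<in> Pow (F s). \<not> big (Suc n) (?b s G)}"
      show "\<not> hit i (?B - Y)"
      proof
        assume "hit i (?B - Y)"
        \<comment> \<open>Outside \<open>Y\<close> only points of small stage atoms remain, and the
          choice of the preceding window excludes hits of these.\<close>
        then have "hit i (\<Union>G\<in>?J. ?b s G)"
        proof (rule hit_mono)
          fix p assume p: "p \<in> ?B - Y" "p \<noteq> []" "hd p = i"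
          then obtain G where G: "G \<in> ?I s" "p \<in> ?b s G"
            using B[OF s(1)] by blast
          have "?a s G - X \<subseteq> ?A - X"
            unfolding A[OF s(1)] using G(1) by blast
          then have small: "\<not> big m (?a s G - X)" using notbig big_mono by blast
          then have "\<not> big m (?a s G \<inter> X)" using Y_iff[of p s G] p G s by auto
          then have "\<not> big m (?a s G)"
            using small big_Un[of m "?a s G \<inter> X" "?a s G - X"] by (simp add: Int_Diff_Un)
          then show "p \<in> (\<Union>G\<in>?J. ?b s G)"
            using ab G by blast
        qed
        moreover have "{xs. i # xs \<in> (\<Union>G\<in>?J. ?b s G)} = (\<Union>G\<in>?J. {xs. i # xs \<in> ?b s G})"
          by blast
        moreover have "finite ?J"
          using F by simp
        ultimately obtain G where G: "G \<in> ?J" "hit i (?b s G)"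
          unfolding hit_def by (simp only: big_UN) blast
        show False
        \<comment> \<open>Window 0 has no predecessor, but its only atom is \<open>UNIV\<close>,
          which is big.\<close>
        proof (cases s)
          case 0
          have "G = {}" "?b s G = UNIV"
            using G(1) 0 by (auto simp: F_def atom_def)
          moreover have "big (Suc n) UNIV"
            using big_mono[OF big_lists] by blast
          ultimately show ?thesis using G(1) by simp
        next
          case (Suc t)
          then show ?thesis
            using bspec[OF N[of t, unfolded window_def, THEN conjunct2, THEN conjunct2], of G] G s(2)
            by (simp del: big.simps)
        qed
      qed
    qed
    ultimately show ?thesis by blast
  qed
  have "partial_iso m (Suc n) (insert (X, Y) P)"
    unfolding partial_iso_def
  proof (intro allI impI)
    fix F' G' assume F': "finite F' \<and> F' \<subseteq> insert (X, Y) P"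
    show "big m (atom fst F' G') = big (Suc n) (atom snd F' G')"
    proof (cases "(X, Y) \<in> F'")
      case True
      let ?F = "F' - {(X, Y)}"
      have F'': "finite ?F" "?F \<subseteq> P" using F' by auto
      have "atom fst F' G' = (if (X, Y) \<in> G' then atom fst ?F G' \<inter> X else atom fst ?F G' - X)"
        "atom snd F' G' = (if (X, Y) \<in> G' then atom snd ?F G' \<inter> Y else atom snd ?F G' - Y)"
        using atom_insert[of fst "(X, Y)" ?F G'] atom_insert[of snd "(X, Y)" ?F G'] insert_Diff[OF True]
        by simp_all
      then show ?thesis using key[OF F'', of G'] by simp
    next
      case False
      then have "F' \<subseteq> P" using F' by blast
      then show ?thesis using P F' unfolding partial_iso_def by blast
    qed
  qed
  then show ?thesis by blast
qed

text \<open>The back step is the forth step for the converse relation.\<close>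

lemma partial_iso_extend_left:
  assumes P: "partial_iso (Suc m) n P" and "countable P"
  shows "\<exists>X. partial_iso (Suc m) n (insert (X, Y) P)"
proof -
  have "countable (prod.swap ` P)"
    using assms(2) by simp
  then obtain X where X: "partial_iso n (Suc m) (insert (Y, X) (prod.swap ` P))"
    using partial_iso_extend[OF partial_iso_converse[OF P]] by blast
  have "prod.swap ` insert (Y, X) (prod.swap ` P) = insert (X, Y) P"
    by (simp add: image_image)
  then show ?thesis
    using partial_iso_converse[OF X] by auto
qed

text \<open>The stages are indexed by the sets of naturals in a well-order of least type. Under CH
  its proper initial segments are countable, so only countably many pairs have been collected before
  any given stage, and the extension step applies.\<close>

lemma CH_imp_total_partial_iso:
  assumes CH
  shows "\<exists>P. partial_iso (Suc m) (Suc n) P \<and> (\<forall>X. \<exists>Y. (X, Y) \<in> P) \<and> (\<forall>Y. \<exists>X. (X, Y) \<in> P)"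
proof -
  let ?r = "|UNIV :: nat set set|"
  let ?iso = "partial_iso (Suc m) (Suc n)"
  have r: "Card_order ?r" "Field ?r = UNIV"
    by (rule card_of_Card_order, rule Field_card_of)
  have wo: "Well_order ?r" and wf: "wf (?r - Id)"
    using card_of_Well_order by (auto simp: well_order_on_def)
  have countable_below: "countable (underS ?r \<alpha>)" for \<alpha>
  proof -
    have "|underS ?r \<alpha>| <o ?r"
      using card_of_underS[OF r(1), of \<alpha>] r(2) by simp
    then have "|underS ?r \<alpha>| <o cardSuc |UNIV :: nat set|"
      using assms unfolding CH_def by (rule ordLess_ordIso_trans)
    then show ?thesis
      unfolding countable_card_of_nat
      using cardSuc_ordLeq_ordLess[OF card_of_Card_order card_of_Card_order] by blast
  qed
  \<comment> \<open>The index of a stage also names the set treated there: every set of lists is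
    some \<open>e \<alpha>\<close>, which \<open>fwd\<close> puts into the domain and
    \<open>bwd\<close> into the range.\<close>
  define e :: "nat set \<Rightarrow> nat list set" where "e = image from_nat"
  have e_surj: "\<exists>\<alpha>. e \<alpha> = X" for X
    by (intro exI[of _ "to_nat ` X"]) (simp add: e_def image_image)
  define fwd where "fwd \<alpha> Q = (e \<alpha>, SOME Y. ?iso (insert (e \<alpha>, Y) Q))" for \<alpha> Q
  define bwd where "bwd \<alpha> Q = (SOME X. ?iso (insert (X, e \<alpha>) Q), e \<alpha>)" for \<alpha> Q
  define step where "step \<alpha> Q = {fwd \<alpha> Q, bwd \<alpha> (insert (fwd \<alpha> Q) Q)}" for \<alpha> Q
  define H where "H = wfrec (?r - Id) (\<lambda>h \<alpha>. step \<alpha> (\<Union>\<beta>\<in>underS ?r \<alpha>. h \<beta>))"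
  define U where "U \<alpha> = (\<Union>\<beta>\<in>underS ?r \<alpha>. H \<beta>)" for \<alpha>
  have H: "H \<alpha> = step \<alpha> (U \<alpha>)" for \<alpha>
  proof -
    have "(\<Union>\<beta>\<in>underS ?r \<alpha>. cut H (?r - Id) \<alpha> \<beta>) = U \<alpha>"
      unfolding U_def by (rule SUP_cong) (auto simp: cut_def underS_def)
    then show ?thesis
      using wfrec[OF wf, of "\<lambda>h \<alpha>. step \<alpha> (\<Union>\<beta>\<in>underS ?r \<alpha>. h \<beta>)" \<alpha>, folded H_def] by simp
  qed
  have U_mono: "U \<beta> \<union> H \<beta> \<subseteq> U \<alpha>" if "\<beta> \<in> underS ?r \<alpha>" for \<alpha> \<beta>
  proof -
    have "underS ?r \<beta> \<subseteq> underS ?r \<alpha>"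
      using wo that underS_incl_iff[of ?r \<beta> \<alpha>] r(2)
      by (auto simp: well_order_on_def underS_def)
    then show ?thesis
      using that by (auto simp: U_def)
  qed
  have tot: "\<beta> = \<gamma> \<or> \<beta> \<in> underS ?r \<gamma> \<or> \<gamma> \<in> underS ?r \<beta>" for \<beta> \<gamma>
    using wo r(2) unfolding well_order_on_def linear_order_on_def total_on_def underS_def by auto
  have chain: "subset.chain UNIV ((\<lambda>\<beta>. U \<beta> \<union> H \<beta>) ` A)" for A
    unfolding subset_chain_def
  proof (intro conjI ballI)
    fix P Q assume "P \<in> (\<lambda>\<beta>. U \<beta> \<union> H \<beta>) ` A" "Q \<in> (\<lambda>\<beta>. U \<beta> \<union> H \<beta>) ` A"
    then obtain \<beta> \<gamma> where "P = U \<beta> \<union> H \<beta>" "Q = U \<gamma> \<union> H \<gamma>" by blast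
    then show "P \<subseteq> Q \<or> Q \<subseteq> P"
      using tot[of \<beta> \<gamma>] U_mono[of \<beta> \<gamma>] U_mono[of \<gamma> \<beta>] by blast
  qed simp
  have union_iso: "?iso (\<Union>\<beta>\<in>A. U \<beta> \<union> H \<beta>)" if "\<And>\<beta>. \<beta> \<in> A \<Longrightarrow> ?iso (U \<beta> \<union> H \<beta>)" for A
  proof (cases "A = {}")
    case True
    then show ?thesis by (simp add: partial_iso_empty)
  next
    case False
    then show ?thesis
      using that by (intro partial_iso_chain[OF chain]) auto
  qed
  have good: "?iso (U \<alpha> \<union> H \<alpha>)" for \<alpha>
    using wf
  proof (induction \<alpha> rule: wf_induct_rule)
    case (less \<alpha>)
    have "U \<alpha> = (\<Union>\<beta>\<in>underS ?r \<alpha>. U \<beta> \<union> H \<beta>)"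
    proof (rule equalityI)
      show "U \<alpha> \<subseteq> (\<Union>\<beta>\<in>underS ?r \<alpha>. U \<beta> \<union> H \<beta>)"
        unfolding U_def[of \<alpha>] by blast
      show "(\<Union>\<beta>\<in>underS ?r \<alpha>. U \<beta> \<union> H \<beta>) \<subseteq> U \<alpha>"
        using U_mono by blast
    qed
    moreover have "?iso (\<Union>\<beta>\<in>underS ?r \<alpha>. U \<beta> \<union> H \<beta>)"
      using less by (intro union_iso) (auto simp: underS_def)
    ultimately have U: "?iso (U \<alpha>)" by simp
    have cU: "countable (U \<alpha>)"
      unfolding U_def using countable_below by (intro countable_UN) (auto simp: H step_def)
    have f: "?iso (insert (fwd \<alpha> (U \<alpha>)) (U \<alpha>))"
      unfolding fwd_def using partial_iso_extend[OF U cU] by (rule someI_ex)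
    have "?iso (insert (bwd \<alpha> (insert (fwd \<alpha> (U \<alpha>)) (U \<alpha>))) (insert (fwd \<alpha> (U \<alpha>)) (U \<alpha>)))"
      unfolding bwd_def using partial_iso_extend_left[OF f] cU by (intro someI_ex[of "\<lambda>X. ?iso (insert (X, e \<alpha>) _)"]) simp
    then show ?case
      unfolding H step_def by (simp add: insert_commute)
  qed
  have "?iso (\<Union>\<alpha>. U \<alpha> \<union> H \<alpha>)"
    using good by (intro union_iso) simp
  moreover have "\<exists>Y. (X, Y) \<in> (\<Union>\<alpha>. U \<alpha> \<union> H \<alpha>)" for X
  proof -
    obtain \<alpha> where "e \<alpha> = X" using e_surj by blast
    then have "fst (fwd \<alpha> (U \<alpha>)) = X" "fwd \<alpha> (U \<alpha>) \<in> H \<alpha>"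
      by (simp_all add: fwd_def H step_def)
    then show ?thesis by (metis UN_iff UNIV_I UnI2 prod.collapse)
  qed
  moreover have "\<exists>X. (X, Y) \<in> (\<Union>\<alpha>. U \<alpha> \<union> H \<alpha>)" for Y
  proof -
    obtain \<alpha> where "e \<alpha> = Y" using e_surj by blast
    then have "snd (bwd \<alpha> (insert (fwd \<alpha> (U \<alpha>)) (U \<alpha>))) = Y" "bwd \<alpha> (insert (fwd \<alpha> (U \<alpha>)) (U \<alpha>)) \<in> H \<alpha>"
      by (simp_all add: bwd_def H step_def)
    then show ?thesis by (metis UN_iff UNIV_I UnI2 prod.collapse)
  qed
  ultimately show ?thesis by blast
qed

lemma total_partial_iso_imp_ring_iso:
  assumes P: "partial_iso m n P" and total: "\<And>X. \<exists>Y. (X, Y) \<in> P" and onto: "\<And>Y. \<exists>X. (X, Y) \<in> P"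
  shows "omega_ring m \<simeq> omega_ring n"
proof -
  obtain H where H: "\<And>X. (X, H X) \<in> P"
    using total by metis
  have sd: "sym_diff A B = {p. (p \<in> A) \<noteq> (p \<in> B)}" for A B :: "nat list set"
    by blast
  note Bool = partial_iso_Boolean[OF P]
  \<comment> \<open>\<open>P\<close> need not be a function on sets, but on classes it is: this
    equivalence gives well-definedness and injectivity at once.\<close>
  have cong: "omega_class m X = omega_class m X' \<longleftrightarrow> omega_class n Y = omega_class n Y'"
    if "(X, Y) \<in> P" "(X', Y') \<in> P" for X X' Y Y'
    using Bool[OF that that(2), of "\<lambda>x y z. x \<noteq> y"]
    unfolding omega_class_eq_iff sd by simp
  define \<phi> where "\<phi> C = omega_class n (H (SOME X. omega_class m X = C))" for C
  have \<phi>: "\<phi> (omega_class m X) = omega_class n (H X)" for X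
  proof -
    have "omega_class m (SOME X'. omega_class m X' = omega_class m X) = omega_class m X"
      by (rule someI) simp
    then show ?thesis
      unfolding \<phi>_def using cong[OF H H] by blast
  qed
  have "\<phi> \<in> ring_hom (omega_ring m) (omega_ring n)"
  proof (rule ring_hom_memI)
    fix x assume "x \<in> carrier (omega_ring m)"
    then show "\<phi> x \<in> carrier (omega_ring n)"
      by (simp add: \<phi>_def)
  next
    fix x y assume "x \<in> carrier (omega_ring m)" "y \<in> carrier (omega_ring m)"
    then obtain X Y where [simp]: "x = omega_class m X" "y = omega_class m Y"
      unfolding carrier_omega_ring_eq by blast
    have "\<not> big m {p. (p \<in> X \<inter> Y) \<noteq> (p \<in> X \<and> p \<in> Y)}" by simp
    then have "\<not> big n (sym_diff (H (X \<inter> Y)) (H X \<inter> H Y))"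
      using Bool[OF H[of "X \<inter> Y"] H[of X] H[of Y], of "\<lambda>x y z. x \<noteq> (y \<and> z)"] unfolding sd by simp
    then show "\<phi> (x \<otimes>\<^bsub>omega_ring m\<^esub> y) = \<phi> x \<otimes>\<^bsub>omega_ring n\<^esub> \<phi> y"
      by (simp add: \<phi> omega_class_eq_iff)
    have "\<not> big m {p. (p \<in> sym_diff X Y) \<noteq> ((p \<in> X) \<noteq> (p \<in> Y))}"
      unfolding sd by simp
    then have "\<not> big n (sym_diff (H (sym_diff X Y)) (sym_diff (H X) (H Y)))"
      using Bool[OF H[of "sym_diff X Y"] H[of X] H[of Y], of "\<lambda>x y z. x \<noteq> (y \<noteq> z)"]
      unfolding sd[of "H X"] sd[of "H (sym_diff X Y)"] by simp
    then show "\<phi> (x \<oplus>\<^bsub>omega_ring m\<^esub> y) = \<phi> x \<oplus>\<^bsub>omega_ring n\<^esub> \<phi> y"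
      unfolding omega_ring_simps \<phi> \<open>x = _\<close> \<open>y = _\<close> omega_class_eq_iff .
  next
    have "\<not> big n {p. p \<notin> H UNIV}"
      using Bool[OF H[of UNIV] H[of UNIV] H[of UNIV], of "\<lambda>x y z. \<not> x"] by simp
    then show "\<phi> \<one>\<^bsub>omega_ring m\<^esub> = \<one>\<^bsub>omega_ring n\<^esub>"
      by (simp add: \<phi> omega_class_eq_iff set_diff_eq)
  qed
  moreover have "bij_betw \<phi> (carrier (omega_ring m)) (carrier (omega_ring n))"
  proof (rule bij_betw_imageI)
    show "inj_on \<phi> (carrier (omega_ring m))"
      unfolding carrier_omega_ring_eq using cong[OF H H] by (auto simp: inj_on_def \<phi>)
    show "\<phi> ` carrier (omega_ring m) = carrier (omega_ring n)"
    proof (intro equalityI subsetI)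
      fix y assume "y \<in> carrier (omega_ring n)"
      then obtain Y where Y: "y = omega_class n Y"
        unfolding carrier_omega_ring_eq by blast
      obtain X where "(X, Y) \<in> P" using onto by blast
      then have "\<phi> (omega_class m X) = y"
        unfolding \<phi> Y using cong[OF H] by blast
      then show "y \<in> \<phi> ` carrier (omega_ring m)"
        by (metis imageI omega_class_closed)
    qed (auto simp: \<phi>_def)
  qed
  ultimately show ?thesis
    unfolding is_ring_iso_def ring_iso_def by blast
qed

lemma CH_imp_omega_ring_iso:
  assumes CH "m \<ge> 1" "n \<ge> 1"
  shows "omega_ring m \<simeq> omega_ring n"
proof -
  obtain m' n' where [simp]: "m = Suc m'" "n = Suc n'"
    using assms(2,3) by (cases m; cases n) auto
  obtain P where "partial_iso m n P" "\<And>X. \<exists>Y. (X, Y) \<in> P" "\<And>Y. \<exists>X. (X, Y) \<in> P"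
    using CH_imp_total_partial_iso[OF assms(1), of m' n'] by auto
  then show ?thesis
    by (rule total_partial_iso_imp_ring_iso)
qed

section \<open>Continuous reductions between the ideals\<close>

text \<open>These are the clopen sets of the product topology on the powerset. A map
  \<open>f\<close> between powersets is continuous iff all predicates \<open>p \<in> f X\<close> are
  of this kind.\<close>

definition finitely_determined :: "('a set \<Rightarrow> bool) \<Rightarrow> bool"
  where "finitely_determined Q \<longleftrightarrow> (\<exists>S. finite S \<and> (\<forall>X Y. X \<inter> S = Y \<inter> S \<longrightarrow> Q X = Q Y))"

lemma finitely_determined_const [simp]: "finitely_determined (\<lambda>_. c)"
  unfolding finitely_determined_def by (intro exI[of _ "{}"]) simp

lemma finitely_determined_comp2:
  assumes "finitely_determined Q" "finitely_determined R"
  shows "finitely_determined (\<lambda>X. b (Q X) (R X))"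
proof -
  obtain S where S: "finite S \<and> (\<forall>X Y. X \<inter> S = Y \<inter> S \<longrightarrow> Q X = Q Y)"
    using assms(1) unfolding finitely_determined_def by (rule exE)
  obtain T where T: "finite T \<and> (\<forall>X Y. X \<inter> T = Y \<inter> T \<longrightarrow> R X = R Y)"
    using assms(2) unfolding finitely_determined_def by (rule exE)
  show ?thesis
    unfolding finitely_determined_def
  proof (intro exI[of _ "S \<union> T"] conjI allI impI)
    show "finite (S \<union> T)" using S T by blast
    fix X Y assume "X \<inter> (S \<union> T) = Y \<inter> (S \<union> T)"
    then have "X \<inter> S = Y \<inter> S" "X \<inter> T = Y \<inter> T" by blast+
    then show "b (Q X) (R X) = b (Q Y) (R Y)"
      using S[THEN conjunct2, rule_format, of X Y] T[THEN conjunct2, rule_format, of X Y] by simp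
  qed
qed

lemma finitely_determined_ball:
  assumes "finite I" "\<And>i. i \<in> I \<Longrightarrow> finitely_determined (Q i)"
  shows "finitely_determined (\<lambda>X. \<forall>i\<in>I. Q i X)"
  using assms
proof (induction I rule: finite_induct)
  case (insert i I)
  then show ?case
    using finitely_determined_comp2[of "Q i" "\<lambda>X. \<forall>i\<in>I. Q i X" "(\<and>)"] by simp
qed simp

text \<open>The pointclass of the sets continuously reducible to the complement of \<open>I\<close> in \<open>\<omega>\<^sup>n\<close>.\<close>

primrec reducible :: "nat \<Rightarrow> ('a set \<Rightarrow> bool) \<Rightarrow> bool"
  where
    "reducible 0 Q \<longleftrightarrow> finitely_determined Q"
  | "reducible (Suc n) Q \<longleftrightarrow>
      (\<exists>R. (\<forall>b. reducible n (R b)) \<and> (\<forall>X. Q X \<longleftrightarrow> (\<exists>\<^sub>\<infinity>b :: nat. R b X)))"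

lemma reducible_SucI:
  assumes "\<And>b. reducible n (R b)" "\<And>X. Q X \<longleftrightarrow> (\<exists>\<^sub>\<infinity>b :: nat. R b X)"
  shows "reducible (Suc n) Q"
  using assms by (subst reducible.simps(2)) blast

lemma reducible_const: "reducible n (\<lambda>_. c)"
proof (induction n)
  case (Suc n)
  then show ?case
    by (rule reducible_SucI) (simp add: INFM_nat_le)
qed simp

text \<open>The witnesses for the existential quantifiers are chosen minimal, hence unique.
  Only this makes it possible to express \<open>\<exists>\<close> by \<open>\<exists>\<^sub>\<infinity>\<close>.\<close>

lemma reducible_forall:
  assumes "\<And>a :: nat. reducible n (Q a)" "\<And>a. reducible n (Q' a)"
  shows "reducible (Suc n) (\<lambda>X. \<forall>a. \<not> Q a X \<and> Q' a X)"
  using assms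
proof (induction n arbitrary: Q Q')
  case 0
  have "finitely_determined (\<lambda>X. \<forall>a\<in>{..t}. \<not> Q a X \<and> Q' a X)" for t
    using 0 by (intro finitely_determined_ball finitely_determined_comp2[where b = "\<lambda>x y. \<not> x \<and> y"]) auto
  \<comment> \<open>A universal statement holds iff its initial segments hold infinitely often, and
    each of these is clopen.\<close>
  moreover have "(\<forall>a. \<not> Q a X \<and> Q' a X) \<longleftrightarrow> (\<exists>\<^sub>\<infinity>t. \<forall>a\<in>{..t}. \<not> Q a X \<and> Q' a X)" for X
    unfolding INFM_nat_le by auto
  ultimately show ?case
    by (intro reducible_SucI[where R = "\<lambda>t X. \<forall>a\<in>{..t}. \<not> Q a X \<and> Q' a X"]) simp_all
next
  case (Suc n)
  have "\<exists>q. \<forall>a. (\<forall>b. reducible n (q a b)) \<and> (\<forall>X. Q a X \<longleftrightarrow> (\<exists>\<^sub>\<infinity>b :: nat. q a b X))"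
    by (intro choice allI) (rule Suc.prems(1)[unfolded reducible.simps])
  then obtain q where q: "\<And>a (b :: nat). reducible n (q a b)" "\<And>a X. Q a X \<longleftrightarrow> (\<exists>\<^sub>\<infinity>b. q a b X)"
    by blast
  have "\<exists>q. \<forall>a. (\<forall>b. reducible n (q a b)) \<and> (\<forall>X. Q' a X \<longleftrightarrow> (\<exists>\<^sub>\<infinity>b :: nat. q a b X))"
    by (intro choice allI) (rule Suc.prems(2)[unfolded reducible.simps])
  then obtain q' where q': "\<And>a (b :: nat). reducible n (q' a b)" "\<And>a X. Q' a X \<longleftrightarrow> (\<exists>\<^sub>\<infinity>b. q' a b X)"
    by blast
  \<comment> \<open>\<open>low\<close> makes the witness for the failure of \<open>Q i\<close>
    unique, being the least point from which \<open>q i\<close> fails throughout; \<open>nxt\<close>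
    makes the witness for a hit of \<open>q' i\<close> from \<open>k\<close> on unique.\<close>
  define low where "low N i X \<longleftrightarrow> (\<forall>b\<ge>N. \<not> q i b X) \<and> (N = 0 \<or> q i (N - 1) X)" for N i X
  define nxt where "nxt k L i X \<longleftrightarrow> k \<le> L \<and> q' i L X \<and> (\<forall>b. k \<le> b \<and> b < L \<longrightarrow> \<not> q' i b X)" for k L i X
  \<comment> \<open>A list of length \<open>k\<close> holds the witnesses for all
    \<open>i < k\<close>. Starting the search for \<open>q'\<close> at \<open>k\<close> makes
    arbitrarily long lists yield infinitely many hits of each \<open>q' i\<close>.\<close>
  define V where "V l X \<longleftrightarrow> (\<forall>i<length l. low (fst (l ! i)) i X \<and> nxt (length l) (snd (l ! i)) i X)"
    for l :: "(nat \<times> nat) list" and X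
  have V_class: "reducible (Suc n) (V l)" for l
  proof -
    \<comment> \<open>The induction hypothesis wants one negated and one positive family over the
      naturals. All conditions in \<open>V l\<close> are packed into these, with a Boolean tag
      telling \<open>low\<close> from \<open>nxt\<close> and constants as padding.\<close>
    define neg where "neg a = (case from_nat a of (t, i, b) \<Rightarrow>
      if i < length l \<and> t \<and> fst (l ! i) \<le> b then q i b
      else if i < length l \<and> \<not> t \<and> length l \<le> b \<and> b < snd (l ! i) then q' i b
      else (\<lambda>_. False))" for a
    define pos where "pos a = (case from_nat a of (t, i) \<Rightarrow>
      if i < length l \<and> t \<and> fst (l ! i) \<noteq> 0 then q i (fst (l ! i) - 1)
      else if i < length l \<and> \<not> t then (if length l \<le> snd (l ! i) then q' i (snd (l ! i)) else (\<lambda>_. False))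
      else (\<lambda>_. True))" for a
    have cl: "reducible n (neg a)" "reducible n (pos a)" for a
      using q(1) q'(1) reducible_const by (auto simp: neg_def pos_def split: prod.split)
    have all_neg: "(\<forall>a. \<not> neg a X) \<longleftrightarrow> (\<forall>i<length l. (\<forall>b\<ge>fst (l ! i). \<not> q i b X) \<and>
        (\<forall>b. length l \<le> b \<and> b < snd (l ! i) \<longrightarrow> \<not> q' i b X))" (is "?L \<longleftrightarrow> ?R") for X
    proof
      assume L: ?L
      show ?R
      proof (intro allI impI conjI)
        fix i b assume "i < length l" "fst (l ! i) \<le> b"
        then show "\<not> q i b X"
          using L[rule_format, of "to_nat (True, i, b)"] by (simp add: neg_def)
      next
        fix i b assume "i < length l" "length l \<le> b \<and> b < snd (l ! i)"
        then show "\<not> q' i b X"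
          using L[rule_format, of "to_nat (False, i, b)"] by (simp add: neg_def)
      qed
    next
      assume ?R
      then show ?L
        by (auto simp: neg_def split: prod.split)
    qed
    have all_pos: "(\<forall>a. pos a X) \<longleftrightarrow> (\<forall>i<length l. (fst (l ! i) = 0 \<or> q i (fst (l ! i) - 1) X) \<and>
        length l \<le> snd (l ! i) \<and> q' i (snd (l ! i)) X)" (is "?L \<longleftrightarrow> ?R") for X
    proof
      assume L: ?L
      show ?R
      proof (intro allI impI)
        fix i assume "i < length l"
        then show "(fst (l ! i) = 0 \<or> q i (fst (l ! i) - 1) X) \<and> length l \<le> snd (l ! i) \<and> q' i (snd (l ! i)) X"
          using L[rule_format, of "to_nat (True, i)"] L[rule_format, of "to_nat (False, i)"]
          by (simp add: pos_def split: if_splits)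
      qed
    next
      assume ?R
      then show ?L
        by (auto simp: pos_def split: prod.split)
    qed
    have "V l X \<longleftrightarrow> (\<forall>a. \<not> neg a X) \<and> (\<forall>a. pos a X)" for X
      unfolding V_def low_def nxt_def all_neg all_pos by blast
    then have "V l = (\<lambda>X. \<forall>a. \<not> neg a X \<and> pos a X)"
      by auto
    then show ?thesis
      using Suc.IH[of neg pos, OF cl] by simp
  qed
  \<comment> \<open>A number outside the range of \<open>to_nat\<close> could decode to a list that
    already has a code and would count it again, so it is made to fail.\<close>
  define W where "W s = (if s \<in> range (to_nat :: (nat \<times> nat) list \<Rightarrow> nat) then V (from_nat s) else (\<lambda>_. False))" for s
  have W_class: "reducible (Suc n) (W s)" for s
    using V_class reducible_const[of "Suc n" False] by (simp only: W_def split: if_split) blast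
  have low_unique: "N = N'" if "low N i X" "low N' i X" for N N' i X
  proof (rule ccontr)
    assume "N \<noteq> N'"
    then have "N' - 1 \<ge> N \<and> N' \<noteq> 0 \<or> N - 1 \<ge> N' \<and> N \<noteq> 0" by linarith
    then show False using that unfolding low_def by blast
  qed
  have nxt_unique: "L = L'" if "nxt k L i X" "nxt k L' i X" for k L L' i X
    using that unfolding nxt_def by (meson linorder_neqE_nat)
  \<comment> \<open>With at most one valid list of each length, infinitely many valid codes mean
    valid lists of unbounded length.\<close>
  have V_unique: "l = l'" if "V l X" "V l' X" "length l = length l'" for l l' X
  proof (rule nth_equalityI)
    fix i assume "i < length l"
    then show "l ! i = l' ! i"
      using that low_unique[of "fst (l ! i)" i X "fst (l' ! i)"] nxt_unique[of "length l" "snd (l ! i)" i X "snd (l' ! i)"]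
      unfolding V_def by (simp add: prod_eq_iff)
  qed fact
  have "(\<forall>a. \<not> Q a X \<and> Q' a X) \<longleftrightarrow> (\<exists>\<^sub>\<infinity>s. W s X)" for X
  proof
    assume all: "\<forall>a. \<not> Q a X \<and> Q' a X"
    have "\<exists>N. low N i X" for i
    proof -
      have "\<exists>N. \<forall>b\<ge>N. \<not> q i b X"
        using all q(2)[of i X] by (auto simp: INFM_nat_le)
      then obtain N where N: "\<forall>b\<ge>N. \<not> q i b X" "\<And>M. M < N \<Longrightarrow> \<not> (\<forall>b\<ge>M. \<not> q i b X)"
        using exists_least_iff[of "\<lambda>N. \<forall>b\<ge>N. \<not> q i b X"] by blast
      have "N = 0 \<or> q i (N - 1) X"
      proof (rule ccontr)
        assume *: "\<not> (N = 0 \<or> q i (N - 1) X)"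
        have "\<not> q i b X" if "b \<ge> N - 1" for b
          using * N(1) that by (cases "b = N - 1") auto
        then show False using N(2)[of "N - 1"] * by simp
      qed
      then show ?thesis using N(1) by (auto simp: low_def)
    qed
    then obtain N where N: "\<And>i. low (N i) i X" by metis
    have "\<exists>L. nxt k L i X" for k i
    proof -
      have "\<exists>L. k \<le> L \<and> q' i L X"
        using all q'(2)[of i X] by (auto simp: INFM_nat_le)
      then show ?thesis
        using exists_least_iff[of "\<lambda>L. k \<le> L \<and> q' i L X"] unfolding nxt_def by blast
    qed
    then obtain L where L: "\<And>k i. nxt k (L k i) i X" by metis
    define s where "s k = to_nat (map (\<lambda>i. (N i, L k i)) [0..<k])" for k
    have "W (s k) X" for k
      using N L by (simp add: s_def V_def W_def)
    then have "range s \<subseteq> {s. W s X}" by blast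
    moreover have "inj s"
    proof (rule injI)
      fix k k' assume "s k = s k'"
      then have "length (map (\<lambda>i. (N i, L k i)) [0..<k]) = length (map (\<lambda>i. (N i, L k' i)) [0..<k'])"
        unfolding s_def by (metis from_nat_to_nat)
      then show "k = k'" by simp
    qed
    ultimately show "\<exists>\<^sub>\<infinity>s. W s X"
      unfolding Inf_many_def using finite_subset range_inj_infinite by blast
  next
    assume inf: "\<exists>\<^sub>\<infinity>s. W s X"
    let ?S = "{s. W s X}" and ?len = "\<lambda>s. length (from_nat s :: (nat \<times> nat) list)"
    have "inj_on ?len ?S"
    proof (rule inj_onI)
      fix s t assume st: "s \<in> ?S" "t \<in> ?S" "?len s = ?len t"
      then have "from_nat s = (from_nat t :: (nat \<times> nat) list)"
        using V_unique by (auto simp: W_def split: if_splits)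
      then show "s = t"
        using st(1,2) by (auto simp: W_def split: if_splits)
    qed
    then have "infinite (?len ` ?S)"
      using inf unfolding Inf_many_def by (simp add: finite_image_iff)
    then have long: "\<exists>l. V l X \<and> K \<le> length l" for K
      unfolding infinite_nat_iff_unbounded_le by (auto simp: W_def split: if_splits)
    show "\<forall>a. \<not> Q a X \<and> Q' a X"
    proof (intro allI conjI)
      fix a
      obtain l where l: "V l X" "Suc a \<le> length l" using long by blast
      then have "\<forall>b\<ge>fst (l ! a). \<not> q a b X"
        unfolding V_def low_def by simp
      then show "\<not> Q a X"
        unfolding q(2) INFM_nat_le by blast
      show "Q' a X"
        unfolding q'(2) INFM_nat_le
      proof
        fix M
        obtain l where l: "V l X" "max (Suc a) M \<le> length l" using long by blast
        then have "nxt (length l) (snd (l ! a)) a X"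
          unfolding V_def by simp
        then show "\<exists>b\<ge>M. q' a b X"
          using l(2) unfolding nxt_def by (intro exI[of _ "snd (l ! a)"]) auto
      qed
    qed
  qed
  then show ?case
    by (rule reducible_SucI[OF W_class])
qed

text \<open>A constant family in \<open>reducible_forall\<close> leaves only a positive or only a
  negated predicate.\<close>

lemma reducible_Suc:
  assumes "reducible n Q"
  shows "reducible (Suc n) Q" "reducible (Suc n) (\<lambda>X. \<not> Q X)"
  using reducible_forall[of n "\<lambda>_ _. False" "\<lambda>_. Q", OF reducible_const assms]
    reducible_forall[of n "\<lambda>_. Q" "\<lambda>_ _. True", OF assms reducible_const]
  by (simp_all del: reducible.simps)

lemma reducible_not:
  assumes "n < m" "reducible n Q"
  shows "reducible m (\<lambda>X. \<not> Q X)"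
  using Suc_leI[OF assms(1)]
proof (induction m rule: dec_induct)
  case base
  show ?case by (rule reducible_Suc(2)[OF assms(2)])
next
  case (step m)
  show ?case by (rule reducible_Suc(1)[OF step.IH])
qed

lemma reducible_big:
  assumes "\<And>p. finitely_determined (\<lambda>X. p \<in> f X)"
  shows "reducible n (\<lambda>X. big n (f X))"
  using assms
proof (induction n arbitrary: f)
  case (Suc n)
  have "reducible n (\<lambda>X. big n {xs. b # xs \<in> f X})" for b
    using Suc.prems by (intro Suc.IH) simp
  then show ?case
    by (rule reducible_SucI) simp
qed simp

text \<open>\<open>big n\<close> is complete for its class: the nested quantifiers range over the
  entries of a list, and \<open>T X\<close> collects the lists whose entries satisfy the innermost
  clopen condition.\<close>

lemma reducible_imp_reduction:
  assumes "reducible n Q"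
  shows "\<exists>T. (\<forall>p. finitely_determined (\<lambda>X. p \<in> T X)) \<and> (\<forall>X. Q X \<longleftrightarrow> big n (T X))"
  using assms
proof (induction n arbitrary: Q)
  case 0
  then have "finitely_determined (\<lambda>X. p = [] \<and> Q X)" for p :: "nat list"
    using finitely_determined_comp2[of Q Q "\<lambda>x _. p = [] \<and> x"] by simp
  then show ?case
    by (intro exI[of _ "\<lambda>X. {p. p = [] \<and> Q X}"]) simp
next
  case (Suc n)
  then obtain R where R: "\<And>b. reducible n (R b)" "\<And>X. Q X \<longleftrightarrow> (\<exists>\<^sub>\<infinity>b :: nat. R b X)"
    by (subst (asm) reducible.simps(2)) blast
  obtain T where T: "\<And>b p. finitely_determined (\<lambda>X. p \<in> T b X)" "\<And>b X. R b X \<longleftrightarrow> big n (T b X)"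
    using Suc.IH[OF R(1)] by metis
  have "finitely_determined (\<lambda>X. p \<in> {p. p \<noteq> [] \<and> tl p \<in> T (hd p) X})" for p
    using T(1) by (cases p) simp_all
  moreover have "Q X \<longleftrightarrow> big (Suc n) {p. p \<noteq> [] \<and> tl p \<in> T (hd p) X}" for X
    using R(2) T(2) by simp
  ultimately show ?case
    by (intro exI[of _ "\<lambda>X. {p. p \<noteq> [] \<and> tl p \<in> T (hd p) X}"] conjI allI)
qed

section \<open>Fixed points of delayed reductions\<close>

definition map_last :: "(nat list \<Rightarrow> nat \<Rightarrow> nat) \<Rightarrow> nat list \<Rightarrow> nat list"
  where "map_last g p = butlast p @ [g (butlast p) (last p)]"

text \<open>All coordinates but the last stay fixed, so only the innermost quantifier is affected,
  and an injection maps infinite sets to infinite sets.\<close>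

lemma big_map_last:
  assumes "\<And>us. inj (g us)" "Z \<subseteq> {p. length p = Suc n}"
  shows "big (Suc n) (map_last g ` Z) \<longleftrightarrow> big (Suc n) Z"
  using assms
proof (induction n arbitrary: g Z)
  case 0
  have "[c] \<in> map_last g ` Z \<longleftrightarrow> c \<in> g [] ` {a. [a] \<in> Z}" for c
    using 0(2) by (force simp: map_last_def length_Suc_conv)
  then have "{c. [c] \<in> map_last g ` Z} = g [] ` {a. [a] \<in> Z}" by blast
  then show ?case
    using 0(1)[of "[]"] by (simp add: Inf_many_def finite_image_iff inj_on_subset)
next
  case (Suc n)
  have "a # xs \<in> map_last g ` Z \<longleftrightarrow> xs \<in> map_last (\<lambda>us. g (a # us)) ` {xs. a # xs \<in> Z}" for a xs
  proof
    assume "a # xs \<in> map_last g ` Z"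
    then obtain p where p: "p \<in> Z" "a # xs = map_last g p" by blast
    moreover obtain b ps where "p = b # ps" "ps \<noteq> []"
      using p(1) Suc.prems(2) by (auto simp: length_Suc_conv)
    ultimately show "xs \<in> map_last (\<lambda>us. g (a # us)) ` {xs. a # xs \<in> Z}"
      by (intro image_eqI[of _ _ ps]) (auto simp: map_last_def)
  next
    assume "xs \<in> map_last (\<lambda>us. g (a # us)) ` {xs. a # xs \<in> Z}"
    then obtain ps where ps: "a # ps \<in> Z" "xs = map_last (\<lambda>us. g (a # us)) ps" by blast
    then have "ps \<noteq> []" using Suc.prems(2) by auto
    then show "a # xs \<in> map_last g ` Z"
      using ps by (intro image_eqI[of _ _ "a # ps"]) (auto simp: map_last_def)
  qed
  then have sec: "{xs. a # xs \<in> map_last g ` Z} = map_last (\<lambda>us. g (a # us)) ` {xs. a # xs \<in> Z}" for a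
    by blast
  have "big (Suc n) {xs. a # xs \<in> map_last g ` Z} \<longleftrightarrow> big (Suc n) {xs. a # xs \<in> Z}" for a
    unfolding sec using Suc.prems by (intro Suc.IH) auto
  then show ?case
    by (subst (1 2) big.simps(2)) simp
qed

text \<open>Delaying \<open>T\<close> along the last coordinate makes it a contraction without changing the order types,
  and a fixed point of the delayed map contradicts the equivalence.\<close>

lemma no_reduction_to_complement:
  assumes fd: "\<And>p. finitely_determined (\<lambda>X. p \<in> T X)"
  shows "\<exists>X \<subseteq> {p. length p = Suc n}. big (Suc n) X \<longleftrightarrow> big (Suc n) (T X)"
proof -
  have "\<exists>S. \<forall>p. finite (S p) \<and> (\<forall>X Y. X \<inter> S p = Y \<inter> S p \<longrightarrow> (p \<in> T X) = (p \<in> T Y))"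
    by (intro choice allI) (rule fd[unfolded finitely_determined_def])
  then obtain S where S': "\<forall>p. finite (S p) \<and> (\<forall>X Y. X \<inter> S p = Y \<inter> S p \<longrightarrow> (p \<in> T X) = (p \<in> T Y))"
    by (rule exE)
  have S: "finite (S p)" "X \<inter> S p = Y \<inter> S p \<Longrightarrow> p \<in> T X \<longleftrightarrow> p \<in> T Y" for p X Y
    using S' by (blast, blast)
  \<comment> \<open>The sum over all \<open>b \<le> a\<close> makes \<open>g us\<close> increasing,
    and its last summand dominates the last entries of all positions consulted for
    \<open>us @ [a]\<close>. The \<open>Suc\<close> makes both inequalities strict.\<close>
  define g where "g us a = (\<Sum>b\<le>a. Suc (\<Sum>s\<in>S (us @ [b]). last s))" for us a
  have g_mono: "g us a < g us b" if "a < b" for us a b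
  proof -
    have "g us a < g us (Suc a)" by (simp add: g_def)
    also have "\<dots> \<le> g us b"
      unfolding g_def using that by (intro sum_mono2) auto
    finally show ?thesis .
  qed
  then have g_inj: "inj (g us)" for us
    by (intro strict_mono_imp_inj_on strict_monoI)
  have g_less: "last s < g us a" if "s \<in> S (us @ [a])" for us a s
  proof -
    have "last s \<le> (\<Sum>s\<in>S (us @ [a]). last s)"
      using that S(1) by (intro member_le_sum) auto
    also have "Suc \<dots> \<le> g us a"
      unfolding g_def by (rule member_le_sum) auto
    finally show ?thesis by simp
  qed
  define \<psi> where "\<psi> = map_last g"
  have \<psi>_less: "last s < last (\<psi> p)" if "s \<in> S p" "p \<noteq> []" for s p
    using g_less[of s "butlast p" "last p"] that by (simp add: \<psi>_def map_last_def)
  \<comment> \<open>By \<open>\<psi>_less\<close>, deciding \<open>p \<in> T X\<close> takes only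
    elements of \<open>X\<close> whose last entry is below that of \<open>\<psi> p\<close>. Hence a
    set \<open>X\<close> that is the image of \<open>T X\<close> under \<open>\<psi>\<close> can be
    defined by recursion on the last entry.\<close>
  define chi where "chi = wfrec (measure last)
    (\<lambda>h q. \<exists>p. length p = Suc n \<and> q = \<psi> p \<and> p \<in> T {s. last s < last q \<and> h s})"
  define X where "X = {q. chi q}"
  have chi: "chi q \<longleftrightarrow> (\<exists>p. length p = Suc n \<and> q = \<psi> p \<and> p \<in> T {s. last s < last q \<and> chi s})" for q
  proof -
    have "{s. last s < last q \<and> cut chi (measure last) q s} = {s. last s < last q \<and> chi s}"
      by (auto simp: cut_def)
    then show ?thesis
      using wfrec[of "measure last", OF wf_measure, of _ q, folded chi_def, of
        "\<lambda>h q. \<exists>p. length p = Suc n \<and> q = \<psi> p \<and> p \<in> T {s. last s < last q \<and> h s}"]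
      unfolding chi_def by simp
  qed
  have T_X: "p \<in> T {s. last s < last (\<psi> p) \<and> chi s} \<longleftrightarrow> p \<in> T X" if "length p = Suc n" for p
  proof (rule S(2))
    have "p \<noteq> []" using that by auto
    then show "{s. last s < last (\<psi> p) \<and> chi s} \<inter> S p = X \<inter> S p"
      using \<psi>_less[of _ p] unfolding X_def by blast
  qed
  have "q \<in> X \<longleftrightarrow> (\<exists>p. length p = Suc n \<and> q = \<psi> p \<and> p \<in> T X)" for q
  proof -
    have "q \<in> X \<longleftrightarrow> (\<exists>p. length p = Suc n \<and> q = \<psi> p \<and> p \<in> T {s. last s < last q \<and> chi s})"
      unfolding X_def mem_Collect_eq by (rule chi)
    also have "\<dots> \<longleftrightarrow> (\<exists>p. length p = Suc n \<and> q = \<psi> p \<and> p \<in> T X)"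
      using T_X by blast
    finally show ?thesis .
  qed
  then have X: "X = \<psi> ` (T X \<inter> {p. length p = Suc n})"
    by blast
  have "big (Suc n) X \<longleftrightarrow> big (Suc n) (\<psi> ` (T X \<inter> {p. length p = Suc n}))"
    using X by (rule arg_cong)
  also have "\<dots> \<longleftrightarrow> big (Suc n) (T X \<inter> {p. length p = Suc n})"
    unfolding \<psi>_def by (rule big_map_last[OF g_inj]) blast
  finally have "big (Suc n) X \<longleftrightarrow> big (Suc n) (T X)"
    by (simp only: big_Int_lists)
  moreover have "X \<subseteq> {p. length p = Suc n}"
    by (subst X) (auto simp: \<psi>_def map_last_def)
  ultimately show ?thesis by blast
qed

text \<open>If \<open>f\<close> preserved and reflected bigness, the negation of
  \<open>big n (f X)\<close> would be that of \<open>big m X\<close>. As it belongs to the class for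
  \<open>m\<close>, it reduces to \<open>big m\<close> by some \<open>T\<close>, and
  \<open>T\<close> would reduce \<open>big m\<close> to its own negation.\<close>

lemma no_continuous_reduction:
  assumes "n < m" and fd: "\<And>p. finitely_determined (\<lambda>X. p \<in> f X)"
  shows "\<exists>X \<subseteq> {p. length p = m}. \<not> (big m X \<longleftrightarrow> big n (f X))"
proof -
  obtain m' where m: "m = Suc m'"
    using assms(1) by (cases m) auto
  have "reducible m (\<lambda>X. \<not> big n (f X))"
    by (rule reducible_not[OF assms(1) reducible_big[OF fd]])
  from reducible_imp_reduction[OF this] obtain T where
    T: "\<And>p. finitely_determined (\<lambda>X. p \<in> T X)" "\<And>X. \<not> big n (f X) \<longleftrightarrow> big m (T X)"
    by blast
  from no_reduction_to_complement[of T m', OF T(1)] show ?thesis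
    unfolding m[symmetric] using T(2) by blast
qed

section \<open>Non-isomorphism under AT\<close>

text \<open>Compactness: near each point, membership of \<open>j\<close> in the image depends on
  finitely many coordinates only, and finitely many of these neighbourhoods cover the powerset of
  \<open>A\<close>.\<close>

lemma continuous_on_powerset_imp_finitely_determined:
  assumes "continuous_on_powerset A F"
  shows "\<exists>S. finite S \<and> (\<forall>X Y. X \<subseteq> A \<longrightarrow> Y \<subseteq> A \<longrightarrow> X \<inter> S = Y \<inter> S \<longrightarrow> (j \<in> F X \<longleftrightarrow> j \<in> F Y))"
proof -
  let ?K = "char_fun ` Pow A"
  \<comment> \<open>As a product, with the factor \<open>{False}\<close> outside \<open>A\<close>,
    the set is compact by Tychonoff's theorem.\<close>
  have K: "?K = (\<Pi>\<^sub>E i\<in>UNIV. if i \<in> A then UNIV else {False})"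
  proof (intro equalityI subsetI)
    fix x assume "x \<in> (\<Pi>\<^sub>E i\<in>UNIV. if i \<in> A then UNIV else {False})"
    then have x: "\<not> x i" if "i \<notin> A" for i
      using that by (auto simp: PiE_iff split: if_splits dest: spec[of _ i])
    show "x \<in> ?K"
      by (rule image_eqI[of _ _ "{i. x i}"]) (use x in \<open>auto simp: char_fun_def\<close>)
  qed (auto simp: char_fun_def)
  have "compact ?K"
  proof -
    have "compact (if i \<in> A then UNIV else {False})" for i
      by (simp add: finite_imp_compact)
    then have "compactin (product_topology (\<lambda>i. euclidean) UNIV) ?K"
      unfolding K compactin_PiE by simp
    then show ?thesis
      by (simp add: euclidean_product_topology)
  qed
  define g where "g x = char_fun (F {i. x i})" for x
  have cont: "continuous_on ?K (\<lambda>x. g x j)"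
    using assms unfolding continuous_on_powerset_def g_def
    by (rule continuous_on_product_then_coordinatewise)
  have "\<forall>x\<in>?K. \<exists>S. finite S \<and> (\<forall>y\<in>?K. (\<forall>i\<in>S. y i = x i) \<longrightarrow> g y j = g x j)"
  proof
    fix x assume x: "x \<in> ?K"
    have "open {g x j}" by (simp add: open_discrete)
    from continuous_on_open_invariant[THEN iffD1, OF cont, rule_format, OF this]
    obtain U where U: "open U" "U \<inter> ?K = (\<lambda>x. g x j) -` {g x j} \<inter> ?K"
      by (elim exE conjE)
    have "x \<in> U" using U(2) x by blast
    have "openin (product_topology (\<lambda>i. euclidean) UNIV) U"
      using U(1) by (simp add: open_fun_def)
    from product_topology_open_contains_basis[OF this \<open>x \<in> U\<close>]
    obtain B where B: "x \<in> Pi\<^sub>E UNIV B" "finite {i. B i \<noteq> topspace euclidean}" "Pi\<^sub>E UNIV B \<subseteq> U"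
      by (elim exE conjE)
    show "\<exists>S. finite S \<and> (\<forall>y\<in>?K. (\<forall>i\<in>S. y i = x i) \<longrightarrow> g y j = g x j)"
    proof (intro exI[of _ "{i. B i \<noteq> UNIV}"] conjI ballI impI)
      show "finite {i. B i \<noteq> UNIV}" using B(2) by simp
      fix y assume y: "y \<in> ?K" "\<forall>i\<in>{i. B i \<noteq> UNIV}. y i = x i"
      have "y i \<in> B i" for i
        using y(2) B(1) by (cases "B i = UNIV") (auto simp: PiE_iff)
      then have "y \<in> U" using B(3) by (auto simp: PiE_iff)
      then show "g y j = g x j" using U(2) y(1) by blast
    qed
  qed
  from bchoice[OF this] obtain S where
    S': "\<forall>x\<in>?K. finite (S x) \<and> (\<forall>y\<in>?K. (\<forall>i\<in>S x. y i = x i) \<longrightarrow> g y j = g x j)"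
    by (rule exE)
  have S: "finite (S x)" if "x \<in> ?K" for x
    by (rule bspec[OF S' that, THEN conjunct1])
  have S_eq: "g y j = g x j" if "x \<in> ?K" "y \<in> ?K" "\<forall>i\<in>S x. y i = x i" for x y
    by (rule mp[OF bspec[OF bspec[OF S' that(1), THEN conjunct2] that(2)] that(3)])
  have op: "open {y. \<forall>i\<in>S x. y i \<in> {x i}}" if "x \<in> ?K" for x
    using S[OF that] by (intro product_topology_basis'[where x = "\<lambda>i. i"]) (auto simp: open_discrete)
  have cover: "?K \<subseteq> (\<Union>x\<in>?K. {y. \<forall>i\<in>S x. y i \<in> {x i}})" by blast
  obtain D where D: "D \<subseteq> ?K" "finite D" "?K \<subseteq> (\<Union>x\<in>D. {y. \<forall>i\<in>S x. y i \<in> {x i}})"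
    by (rule compactE_image[of ?K ?K "\<lambda>x. {y. \<forall>i\<in>S x. y i \<in> {x i}}", OF \<open>compact ?K\<close> op cover])
  show ?thesis
  proof (intro exI[of _ "\<Union>x\<in>D. S x"] conjI allI impI)
    show "finite (\<Union>x\<in>D. S x)" using D(1,2) S by (intro finite_UN_I) auto
    fix X Y assume XY: "X \<subseteq> A" "Y \<subseteq> A" "X \<inter> (\<Union>x\<in>D. S x) = Y \<inter> (\<Union>x\<in>D. S x)"
    have mem: "char_fun X \<in> ?K" "char_fun Y \<in> ?K" using XY by auto
    from D(3) mem(1) have "char_fun X \<in> (\<Union>x\<in>D. {y. \<forall>i\<in>S x. y i \<in> {x i}})"
      by (rule subsetD)
    then obtain x where x: "x \<in> D" "\<forall>i\<in>S x. char_fun X i = x i"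
      by auto
    have "\<forall>i\<in>S x. char_fun Y i = x i"
    proof
      fix i assume i: "i \<in> S x"
      then have "i \<in> X \<longleftrightarrow> i \<in> Y" using XY(3) x(1) by blast
      then show "char_fun Y i = x i" using bspec[OF x(2) i] by (simp add: char_fun_def)
    qed
    moreover have "x \<in> ?K" using x(1) D(1) by (rule subsetD[rotated])
    ultimately have "g (char_fun X) j = g (char_fun Y) j"
      using S_eq[OF _ mem(1) x(2)] S_eq[OF _ mem(2)] by metis
    then show "j \<in> F X \<longleftrightarrow> j \<in> F Y"
      by (simp add: g_def char_fun_def)
  qed
qed

text \<open>Smallness asks for a bound on the first entry, beyond it a bound on the second depending
  on the first, and so on; \<open>g\<close> gathers these bounds as a function of the prefix. A
  single existential quantifier over functions is the shape that \<open>Sigma11\<close>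
  demands.\<close>

lemma not_big_iff_Skolem:
  "\<not> big n A \<longleftrightarrow> (\<exists>g. \<forall>p. length p = n \<and> (\<forall>i<n. g (take i p) \<le> p ! i) \<longrightarrow> p \<notin> A)"
proof (induction n arbitrary: A)
  case (Suc n)
  have "\<not> big (Suc n) A \<longleftrightarrow> (\<exists>N. \<forall>a\<ge>N. \<not> big n {xs. a # xs \<in> A})"
    by (simp add: MOST_nat_le)
  also have "\<dots> \<longleftrightarrow> (\<exists>g. \<forall>p. length p = Suc n \<and> (\<forall>i<Suc n. g (take i p) \<le> p ! i) \<longrightarrow> p \<notin> A)" (is "?L \<longleftrightarrow> ?R")
  proof
    assume ?L
    then obtain N where "\<forall>a\<ge>N. \<exists>g. \<forall>p. length p = n \<and> (\<forall>i<n. g (take i p) \<le> p ! i) \<longrightarrow> p \<notin> {xs. a # xs \<in> A}"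
      unfolding Suc.IH by blast
    then obtain g where g: "\<And>a p. N \<le> a \<Longrightarrow> length p = n \<Longrightarrow> \<forall>i<n. g a (take i p) \<le> p ! i \<Longrightarrow> a # p \<notin> A"
      by (metis mem_Collect_eq)
    define h where "h us = (case us of [] \<Rightarrow> N | a # us \<Rightarrow> g a us)" for us
    show ?R
    proof (intro exI[of _ h] allI impI)
      fix p assume p: "length p = Suc n \<and> (\<forall>i<Suc n. h (take i p) \<le> p ! i)"
      then obtain a q where q: "p = a # q" "length q = n"
        by (cases p) auto
      then have "N \<le> a" "\<forall>i<n. g a (take i q) \<le> q ! i"
        using p unfolding All_less_Suc2 by (auto simp: h_def)
      then show "p \<notin> A" using g q by blast
    qed
  next
    assume ?R
    then obtain g where g: "\<And>p. length p = Suc n \<Longrightarrow> \<forall>i<Suc n. g (take i p) \<le> p ! i \<Longrightarrow> p \<notin> A"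
      by blast
    show ?L
      unfolding Suc.IH
    proof (intro exI[of _ "g []"] allI impI)
      fix a assume a: "g [] \<le> a"
      show "\<exists>g. \<forall>p. length p = n \<and> (\<forall>i<n. g (take i p) \<le> p ! i) \<longrightarrow> p \<notin> {xs. a # xs \<in> A}"
      proof (intro exI[of _ "\<lambda>us. g (a # us)"] allI impI)
        fix p assume "length p = n \<and> (\<forall>i<n. g (a # take i p) \<le> p ! i)"
        then have "a # p \<notin> A"
          using a by (intro g) (auto simp: All_less_Suc2)
        then show "p \<notin> {xs. a # xs \<in> A}" by simp
      qed
    qed
  qed
  finally show ?case .
qed simp

text \<open>AT speaks of subsets of the naturals, so subsets of omega^n are coded by
  \<open>to_nat\<close>. Numbers that code no list of length \<open>n\<close> are ignored and always
  form a small set.\<close>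

definition decode_lists :: "nat \<Rightarrow> nat set \<Rightarrow> nat list set"
  where "decode_lists n S = {p. length p = n \<and> to_nat p \<in> S}"

lemma decode_lists_simps:
  "decode_lists n (S \<union> T) = decode_lists n S \<union> decode_lists n T"
  "decode_lists n (S \<inter> T) = decode_lists n S \<inter> decode_lists n T"
  "decode_lists n (S - T) = decode_lists n S - decode_lists n T"
  "decode_lists n (to_nat ` X) = X \<inter> {p. length p = n}"
  by (auto simp: decode_lists_def)

lemma set_ideal_small: "set_ideal {S. \<not> big n (decode_lists n S)}"
  unfolding set_ideal_def
proof (intro conjI ballI allI impI)
  show "{} \<in> {S. \<not> big n (decode_lists n S)}" by (simp add: decode_lists_def)
next
  fix X Y assume "X \<in> {S. \<not> big n (decode_lists n S)}" "Y \<in> {S. \<not> big n (decode_lists n S)}"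
  then show "X \<union> Y \<in> {S. \<not> big n (decode_lists n S)}" by (simp add: decode_lists_simps big_Un)
next
  fix X Y assume "X \<in> {S. \<not> big n (decode_lists n S)}" "Y \<subseteq> X"
  moreover from this have "decode_lists n Y \<subseteq> decode_lists n X" by (auto simp: decode_lists_def)
  ultimately show "Y \<in> {S. \<not> big n (decode_lists n S)}" using big_mono by blast
qed

text \<open>The Baire component is a Skolem function for smallness. For each \<open>p\<close> the
  condition involves finitely many coordinates of the pair, so \<open>C\<close> is an intersection
  of clopen sets.\<close>

lemma Sigma11_small: "Sigma11 (char_fun ` {S. \<not> big n (decode_lists n S)})"
proof -
  define C where "C = {(x :: nat \<Rightarrow> bool, g :: nat \<Rightarrow> nat).
    \<forall>p. length p = n \<and> (\<forall>i<n. g (to_nat (take i p)) \<le> p ! i) \<longrightarrow> \<not> x (to_nat p)}"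
  have "closed C"
  proof -
    have cl: "closed {z :: (nat \<Rightarrow> bool) \<times> (nat \<Rightarrow> nat). P (fst z k)}" for P k
    proof -
      have "continuous_on UNIV (\<lambda>z :: (nat \<Rightarrow> bool) \<times> (nat \<Rightarrow> nat). fst z k)"
        by (rule continuous_on_product_then_coordinatewise[OF continuous_on_fst[OF continuous_on_id]])
      then have "closed ((\<lambda>z :: (nat \<Rightarrow> bool) \<times> (nat \<Rightarrow> nat). fst z k) -` {b. P b})"
        by (rule closed_vimage[rotated]) (simp add: closed_def open_discrete)
      then show ?thesis by (simp add: vimage_def)
    qed
    have cl': "closed {z :: (nat \<Rightarrow> bool) \<times> (nat \<Rightarrow> nat). P (snd z k)}" for P k
    proof -
      have "continuous_on UNIV (\<lambda>z :: (nat \<Rightarrow> bool) \<times> (nat \<Rightarrow> nat). snd z k)"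
        by (rule continuous_on_product_then_coordinatewise[OF continuous_on_snd[OF continuous_on_id]])
      then have "closed ((\<lambda>z :: (nat \<Rightarrow> bool) \<times> (nat \<Rightarrow> nat). snd z k) -` {b. P b})"
        by (rule closed_vimage[rotated]) (simp add: closed_def open_discrete)
      then show ?thesis by (simp add: vimage_def)
    qed
    have "C = (\<Inter>p\<in>{p. length p = n}. (\<Union>i\<in>{..<n}. {z. \<not> snd z (to_nat (take i p)) \<le> p ! i}) \<union> {z. \<not> fst z (to_nat p)})"
      unfolding C_def by (rule Set.set_eqI) (simp add: case_prod_beta Bex_def, blast)
    moreover have "closed (\<Inter>p\<in>{p. length p = n}. (\<Union>i\<in>{..<n}. {z :: (nat \<Rightarrow> bool) \<times> (nat \<Rightarrow> nat). \<not> snd z (to_nat (take i p)) \<le> p ! i}) \<union> {z. \<not> fst z (to_nat p)})"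
      by (intro closed_INT ballI closed_Un closed_UN finite_lessThan cl cl')
    ultimately show ?thesis by simp
  qed
  moreover have "char_fun ` {S. \<not> big n (decode_lists n S)} = fst ` C"
  proof (intro equalityI subsetI)
    fix x assume "x \<in> char_fun ` {S. \<not> big n (decode_lists n S)}"
    then obtain S where S: "x = char_fun S" "\<not> big n (decode_lists n S)" by blast
    then obtain g where g: "\<And>p. length p = n \<Longrightarrow> \<forall>i<n. g (take i p) \<le> p ! i \<Longrightarrow> p \<notin> decode_lists n S"
      unfolding not_big_iff_Skolem by blast
    have "(x, \<lambda>k. g (from_nat k)) \<in> C"
      using g unfolding C_def S(1) by (auto simp: decode_lists_def char_fun_def)
    then show "x \<in> fst ` C" by force
  next
    fix x assume "x \<in> fst ` C"
    then obtain g where g: "(x, g) \<in> C" by auto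
    have "\<not> big n (decode_lists n {k. x k})"
      unfolding not_big_iff_Skolem using g
      by (intro exI[of _ "\<lambda>us. g (to_nat us)"]) (auto simp: C_def decode_lists_def)
    moreover have "x = char_fun {k. x k}" by (simp add: char_fun_def)
    ultimately show "x \<in> char_fun ` {S. \<not> big n (decode_lists n S)}" by blast
  qed
  ultimately show ?thesis
    unfolding Sigma11_def by blast
qed

section \<open>An almost disjoint family of big sets\<close>

lemma big_lists_over:
  assumes "infinite B"
  shows "big n {p. length p = n \<and> set p \<subseteq> B}"
proof (induction n)
  case (Suc n)
  have "{xs. a # xs \<in> {p. length p = Suc n \<and> set p \<subseteq> B}} = {p. length p = n \<and> set p \<subseteq> B}" if "a \<in> B" for a
    using that by auto
  then have "B \<subseteq> {a. big n {xs. a # xs \<in> {p. length p = Suc n \<and> set p \<subseteq> B}}}"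
    using Suc.IH by auto
  then show ?case
    unfolding big.simps Inf_many_def using assms finite_subset by blast
qed simp

text \<open>The branches of the binary tree, coded by their initial segments, are infinite and
  pairwise almost disjoint. So are the sets of lists of length \<open>n\<close> over them, as a
  finite alphabet has only finitely many such lists, and these sets are big.\<close>

lemma uncountable_almost_disjoint_family:
  assumes "n > 0"
  shows "\<exists>\<A>. uncountable \<A> \<and> (\<forall>A\<in>\<A>. infinite A \<and> big n (decode_lists n A)) \<and>
    (\<forall>A\<in>\<A>. \<forall>B\<in>\<A>. A \<noteq> B \<longrightarrow> finite (A \<inter> B))"
proof -
  define b where "b x k = to_nat (map x [0..<k])" for x :: "nat \<Rightarrow> bool" and k
  have b_eq: "k = l \<and> (\<forall>i<k. x i = y i)" if "b x k = b y l" for x y k l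
  proof -
    have eq: "map x [0..<k] = map y [0..<l]"
      using that unfolding b_def by simp
    from arg_cong[OF eq, of length] have "k = l" by simp
    with eq show ?thesis by auto
  qed
  have inf: "infinite (range (b x))" for x
    by (rule range_inj_infinite) (use b_eq in \<open>auto intro!: injI\<close>)
  have fin: "finite (range (b x) \<inter> range (b y))" if "x \<noteq> y" for x y
  proof -
    obtain j where j: "x j \<noteq> y j" using \<open>x \<noteq> y\<close> by (auto simp: fun_eq_iff)
    have "range (b x) \<inter> range (b y) \<subseteq> b x ` {..j}"
    proof
      fix c assume "c \<in> range (b x) \<inter> range (b y)"
      then obtain k l where "c = b x k" "b x k = b y l" by auto
      moreover from this have "k \<le> j" using b_eq[of x k y l] j by (metis not_le_imp_less)
      ultimately show "c \<in> b x ` {..j}" by blast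
    qed
    then show ?thesis by (rule finite_subset) simp
  qed
  define L where "L x = {p. length p = n \<and> set p \<subseteq> range (b x)}" for x
  have L_big: "big n (L x)" for x
    unfolding L_def by (rule big_lists_over[OF inf])
  have L_inf: "infinite (L x)" for x
    using L_big not_big_finite assms by blast
  have L_fin: "finite (L x \<inter> L y)" if "x \<noteq> y" for x y
  proof -
    have "L x \<inter> L y \<subseteq> {p. set p \<subseteq> range (b x) \<inter> range (b y) \<and> length p = n}"
      unfolding L_def by blast
    then show ?thesis
      by (rule finite_subset) (rule finite_lists_length_eq[OF fin[OF that]])
  qed
  let ?\<A> = "range (\<lambda>x. to_nat ` L x)"
  have "inj (\<lambda>x. to_nat ` L x)"
  proof (rule injI, rule ccontr)
    fix x y assume "to_nat ` L x = to_nat ` L y" "x \<noteq> y"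
    then have "L x = L y" by (simp add: inj_image_eq_iff)
    then show False using L_fin[OF \<open>x \<noteq> y\<close>] L_inf[of x] by simp
  qed
  moreover have "uncountable (UNIV :: (nat \<Rightarrow> bool) set)"
  proof
    assume "countable (UNIV :: (nat \<Rightarrow> bool) set)"
    then obtain f :: "nat \<Rightarrow> nat \<Rightarrow> bool" where f: "range f = UNIV"
      by (metis UNIV_not_empty range_from_nat_into)
    then obtain i where "f i = (\<lambda>k. \<not> f k k)" by (metis UNIV_I imageE)
    then show False by (metis (full_types))
  qed
  ultimately have unc: "uncountable ?\<A>"
    using countable_image_inj_eq by blast
  have pos: "infinite A \<and> big n (decode_lists n A)" if A: "A \<in> ?\<A>" for A
  proof -
    obtain x where [simp]: "A = to_nat ` L x" using A by blast
    have "L x \<inter> {p. length p = n} = L x" by (auto simp: L_def)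
    then show ?thesis
      using L_inf[of x] L_big[of x] by (simp add: decode_lists_simps finite_image_iff)
  qed
  have ad: "finite (A \<inter> B)" if AB: "A \<in> ?\<A>" "B \<in> ?\<A>" "A \<noteq> B" for A B
  proof -
    obtain x y where [simp]: "A = to_nat ` L x" "B = to_nat ` L y" using AB by blast
    have "x \<noteq> y" using AB(3) by auto
    have "A \<inter> B = to_nat ` (L x \<inter> L y)" by (auto simp: image_Int)
    then show ?thesis using L_fin[OF \<open>x \<noteq> y\<close>] by simp
  qed
  show ?thesis
    using unc pos ad by (intro exI[of _ ?\<A>]) simp
qed

text \<open>The family consists of big sets, so one of the finitely many pieces given by AT is big.
  Along an order copy of omega^m inside it, the continuous lifting becomes a continuous map that
  preserves bigness both ways.\<close>

lemma AT_imp_not_iso_less: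
  assumes AT: AT and nm: "n < m"
  shows "\<not> omega_ring m \<simeq> omega_ring n"
proof
  assume "omega_ring m \<simeq> omega_ring n"
  then obtain \<phi> where \<phi>: "\<phi> \<in> ring_hom (omega_ring m) (omega_ring n)"
    "bij_betw \<phi> (carrier (omega_ring m)) (carrier (omega_ring n))"
    unfolding is_ring_iso_def ring_iso_def by blast
  have inj: "omega_class m X = omega_class m Y" if "\<phi> (omega_class m X) = \<phi> (omega_class m Y)" for X Y
    by (rule inj_onD[OF bij_betw_imp_inj_on[OF \<phi>(2)] that]) simp_all
  have "\<exists>Y. \<phi> (omega_class m X) = omega_class n Y" for X
    using ring_hom_closed[OF \<phi>(1) omega_class_closed[of m X]] unfolding carrier_omega_ring_eq by blast
  then have "\<exists>K. \<forall>X. \<phi> (omega_class m X) = omega_class n (K X)"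
    by (intro choice allI)
  then obtain K where K: "\<And>X. \<phi> (omega_class m X) = omega_class n (K X)"
    by blast
  have "omega_class n (K {}) \<oplus>\<^bsub>omega_ring n\<^esub> omega_class n (K {}) = omega_class n (K {})"
    using ring_hom_add[OF \<phi>(1), of "omega_class m {}" "omega_class m {}"] by (simp add: K)
  then have K0: "omega_class n (K {}) = omega_class n {}"
    by simp
  \<comment> \<open>This needs of \<open>\<phi>\<close> only that it is injective and maps zero to
    zero.\<close>
  have K_big: "big n (K X) \<longleftrightarrow> big m X" for X
  proof -
    have "\<not> big n (K X) \<longleftrightarrow> omega_class n (K X) = omega_class n (K {})"
      unfolding K0 by (simp add: omega_class_eq_iff)
    also have "\<dots> \<longleftrightarrow> omega_class m X = omega_class m {}"
      using inj[of X "{}"] K by metis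
    also have "\<dots> \<longleftrightarrow> \<not> big m X"
      by (simp add: omega_class_eq_iff)
    finally show ?thesis by blast
  qed
  define I where "I = {S. \<not> big n (decode_lists n S)}"
  define H where "H S = to_nat ` K (decode_lists m S)" for S :: "nat set"
  have I_H: "sym_diff S T \<in> I \<longleftrightarrow> omega_class n (decode_lists n S) = omega_class n (decode_lists n T)" for S T
    by (simp add: I_def decode_lists_simps omega_class_eq_iff)
  have class_decode_H: "omega_class n (decode_lists n (H S)) = \<phi> (omega_class m (decode_lists m S))" for S
  proof -
    have "omega_class n (X \<inter> {p. length p = n}) = omega_class n X" for X
      by (simp add: omega_class_def)
    then show ?thesis
      by (simp add: H_def decode_lists_simps K)
  qed
  have "preserves_inter_mod I H"
    unfolding preserves_inter_mod_def
  proof (intro conjI allI impI)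
    fix X Y :: "nat set" assume fin: "finite (sym_diff X Y)"
    have "finite (decode_lists m (sym_diff X Y))"
    proof -
      have "to_nat ` decode_lists m (sym_diff X Y) \<subseteq> sym_diff X Y" by (auto simp: decode_lists_def)
      then show ?thesis using fin by (meson finite_imageD finite_subset inj_on_to_nat)
    qed
    \<comment> \<open>Here \<open>m > 0\<close> matters: the finite set \<open>{[]}\<close> is big
      for exponent 0.\<close>
    then have "\<not> big m (decode_lists m (sym_diff X Y))"
      using nm by (intro not_big_finite) auto
    then have "omega_class m (decode_lists m X) = omega_class m (decode_lists m Y)"
      by (simp add: omega_class_eq_iff decode_lists_simps)
    then show "sym_diff (H X) (H Y) \<in> I"
      unfolding I_H class_decode_H by simp
  next
    fix X Y :: "nat set"
    have "\<phi> (omega_class m (decode_lists m (X \<inter> Y))) =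
        \<phi> (omega_class m (decode_lists m X)) \<otimes>\<^bsub>omega_ring n\<^esub> \<phi> (omega_class m (decode_lists m Y))"
      by (subst ring_hom_mult[OF \<phi>(1), symmetric]) (simp_all add: decode_lists_simps)
    then show "sym_diff (H (X \<inter> Y)) (H X \<inter> H Y) \<in> I"
      unfolding I_H class_decode_H[symmetric] decode_lists_simps(2)[of n "H X"] by simp
  qed
  obtain \<A> where \<A>: "uncountable \<A>" "\<forall>A\<in>\<A>. infinite A \<and> big m (decode_lists m A)"
    "\<forall>A\<in>\<A>. \<forall>B\<in>\<A>. A \<noteq> B \<longrightarrow> finite (A \<inter> B)"
    using uncountable_almost_disjoint_family[OF le_less_trans[OF le0 nm]] by (elim exE conjE)
  have "set_ideal I" "Sigma11 (char_fun ` I)"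
    unfolding I_def by (rule set_ideal_small, rule Sigma11_small)
  then have "set_ideal I \<and> Sigma11 (char_fun ` I) \<and> preserves_inter_mod I H \<and> uncountable \<A> \<and>
      (\<forall>A\<in>\<A>. infinite A) \<and> (\<forall>A\<in>\<A>. \<forall>B\<in>\<A>. A \<noteq> B \<longrightarrow> finite (A \<inter> B))"
    using \<open>preserves_inter_mod I H\<close> \<A> by blast
  from AT[unfolded AT_def, THEN spec, THEN spec, THEN spec, THEN mp, OF this]
  obtain A and M :: nat and As Fs where A: "A \<in> \<A>" "A = (\<Union>i<M. As i)"
    and Fs': "\<forall>i<M. continuous_on_powerset (As i) (Fs i) \<and> (\<forall>X\<subseteq>As i. sym_diff (Fs i X) (H X) \<in> I)"
    by (elim bexE exE conjE)
  have Fs: "continuous_on_powerset (As i) (Fs i)" "X \<subseteq> As i \<Longrightarrow> sym_diff (Fs i X) (H X) \<in> I"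
    if "i < M" for i X
    using Fs' that by blast+
  have "decode_lists m A = (\<Union>i<M. decode_lists m (As i))"
    unfolding A(2) by (auto simp: decode_lists_def)
  then obtain i where i: "i < M" "big m (decode_lists m (As i))"
    using bspec[OF \<A>(2) A(1)] big_UN[of "{..<M}" m "\<lambda>i. decode_lists m (As i)"] by auto
  obtain f where f: "\<And>x. length x = m \<Longrightarrow> f x \<in> decode_lists m (As i)"
    "\<And>x y. (x, y) \<in> lexn less_than m \<Longrightarrow> (f x, f y) \<in> lexn less_than m"
    "\<And>X. X \<subseteq> {xs. length xs = m} \<Longrightarrow> big m (f ` X) = big m X"
    using big_imp_embedding[OF i(2)] by (elim exE conjE) (rule that; blast)
  have f_inj: "inj_on f {xs. length xs = m}"
  proof (rule inj_onI, rule ccontr)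
    fix x y assume xy: "x \<in> {xs. length xs = m}" "y \<in> {xs. length xs = m}" "f x = f y" "x \<noteq> y"
    have "(x, y) \<in> omega_pow m \<or> (y, x) \<in> omega_pow m"
      using Well_order_omega_pow[of m] xy Field_omega_pow[of m]
      unfolding well_order_on_def linear_order_on_def total_on_def by auto
    then have "(x, y) \<in> lexn less_than m \<or> (y, x) \<in> lexn less_than m"
      using xy(4) omega_pow_minus_Id[of m] by blast
    then have "(f x, f x) \<in> lexn less_than m"
      using f(2) xy(3) by metis
    then show False using lexn_irrefl by blast
  qed
  let ?W = "{xs :: nat list. length xs = m}"
  \<comment> \<open>\<open>E\<close> carries a subset of omega^m along the order copy into the piece
    \<open>As i\<close>, coded by numbers.\<close>
  define E where "E X = to_nat ` f ` (X \<inter> ?W)" for X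
  have E_sub: "E X \<subseteq> As i" for X
    using f(1) by (auto simp: E_def decode_lists_def)
  have E_decode: "decode_lists m (E X) = f ` (X \<inter> ?W)" for X
  proof -
    have "f ` (X \<inter> ?W) \<subseteq> {p. length p = m}"
      using f(1) by (auto simp: decode_lists_def)
    then show ?thesis
      unfolding E_def decode_lists_simps(4) by (rule Int_absorb2)
  qed
  define T where "T X = decode_lists n (Fs i (E X))" for X
  have "big n (T X) \<longleftrightarrow> big m X" if "X \<subseteq> ?W" for X
  proof -
    have "omega_class n (T X) = omega_class n (K (f ` (X \<inter> ?W)))"
      using Fs(2)[OF i(1) E_sub[of X]] unfolding I_H class_decode_H T_def K E_decode .
    then have "big n (T X) \<longleftrightarrow> big n (K (f ` (X \<inter> ?W)))"
      using omega_class_eq_iff[of n "T X" "{}"] omega_class_eq_iff[of n "K (f ` (X \<inter> ?W))" "{}"] by simp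
    also have "\<dots> \<longleftrightarrow> big m (f ` X)"
      using that by (simp add: K_big Int_absorb2)
    also have "\<dots> \<longleftrightarrow> big m X"
      by (rule f(3)[OF that])
    finally show ?thesis .
  qed
  moreover have "finitely_determined (\<lambda>X. q \<in> T X)" for q
  proof -
    obtain S where S: "finite S" "\<And>X Y. X \<subseteq> As i \<Longrightarrow> Y \<subseteq> As i \<Longrightarrow> X \<inter> S = Y \<inter> S \<Longrightarrow>
        (to_nat q \<in> Fs i X \<longleftrightarrow> to_nat q \<in> Fs i Y)"
      using continuous_on_powerset_imp_finitely_determined[OF Fs(1)[OF i(1)], of "to_nat q"]
      by (elim exE conjE) (rule that; blast)
    \<comment> \<open>The finitely many relevant numbers are pulled back along an injective map, so
      only finitely many positions of \<open>X\<close> matter.\<close>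
    let ?S = "{p \<in> ?W. to_nat (f p) \<in> S}"
    show ?thesis
      unfolding finitely_determined_def
    proof (intro exI[of _ ?S] conjI allI impI)
      have "inj_on (\<lambda>p. to_nat (f p)) ?W"
        using f_inj by (auto simp: inj_on_def)
      then have "inj_on (\<lambda>p. to_nat (f p)) ?S"
        by (rule inj_on_subset) blast
      moreover have "(\<lambda>p. to_nat (f p)) ` ?S \<subseteq> S" by blast
      ultimately show "finite ?S"
        using S(1) by (meson finite_imageD finite_subset)
      fix X Y assume XY: "X \<inter> ?S = Y \<inter> ?S"
      have "E X \<inter> S = E Y \<inter> S"
      proof -
        have "E Z \<inter> S = (\<lambda>p. to_nat (f p)) ` (Z \<inter> ?S)" for Z
          unfolding E_def by blast
        then show ?thesis by (simp only: XY)
      qed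
      from S(2)[OF E_sub E_sub this] show "(q \<in> T X) = (q \<in> T Y)"
        by (simp add: T_def decode_lists_def)
    qed
  qed
  ultimately show False
    using no_continuous_reduction[OF nm, of T] by blast
qed

lemma AT_imp_not_iso:
  assumes AT "m \<noteq> n"
  shows "\<not> omega_ring m \<simeq> omega_ring n"
proof
  assume iso: "omega_ring m \<simeq> omega_ring n"
  have "ring (omega_ring m)"
    using cring_omega_ring by (rule cring.axioms(1))
  from ring_iso_sym[OF this iso] have "omega_ring n \<simeq> omega_ring m" .
  then show False
    using iso AT_imp_not_iso_less[OF assms(1)] assms(2) by (cases "m < n") auto
qed

theorem theorem6p7:
  fixes k :: nat
  assumes "k \<ge> 2"
  shows "(\<forall>n\<ge>1. ring (omega_matrix_ring k n) \<and>
            (\<exists>x\<in>carrier (omega_matrix_ring k n). \<exists>y\<in>carrier (omega_matrix_ring k n).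
               x \<otimes>\<^bsub>omega_matrix_ring k n\<^esub> y \<noteq> y \<otimes>\<^bsub>omega_matrix_ring k n\<^esub> x) \<and>
            automatic_ring (omega_pow n) (omega_matrix_ring k n)) \<and>
         (CH \<longrightarrow> (\<forall>m\<ge>1. \<forall>n\<ge>1. omega_matrix_ring k m \<simeq> omega_matrix_ring k n)) \<and>
         (AT \<longrightarrow> (\<forall>m\<ge>1. \<forall>n\<ge>1. m \<noteq> n \<longrightarrow>
            \<not> (omega_matrix_ring k m \<simeq> omega_matrix_ring k n)))"
proof (intro conjI allI impI)
  fix n :: nat
  interpret cring "omega_ring n" by (rule cring_omega_ring)
  show "ring (omega_matrix_ring k n)"
    unfolding omega_matrix_ring_def by (rule matrix_ring_is_ring)
  show "\<exists>x\<in>carrier (omega_matrix_ring k n). \<exists>y\<in>carrier (omega_matrix_ring k n).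
      x \<otimes>\<^bsub>omega_matrix_ring k n\<^esub> y \<noteq> y \<otimes>\<^bsub>omega_matrix_ring k n\<^esub> x"
    unfolding omega_matrix_ring_def by (rule matrix_ring_noncommutative[OF assms omega_ring_nontrivial])
  show "automatic_ring (omega_pow n) (omega_matrix_ring k n)"
    by (rule automatic_omega_matrix_ring)
next
  fix m n :: nat
  assume "CH" "m \<ge> 1" "n \<ge> 1"
  then show "omega_matrix_ring k m \<simeq> omega_matrix_ring k n"
    unfolding omega_matrix_ring_def
    by (intro matrix_ring_iso cring_omega_ring CH_imp_omega_ring_iso)
next
  fix m n :: nat
  assume "AT" "m \<noteq> n"
  then have "\<not> omega_ring m \<simeq> omega_ring n"
    by (rule AT_imp_not_iso)
  then show "\<not> omega_matrix_ring k m \<simeq> omega_matrix_ring k n"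
    using matrix_ring_iso_imp_iso[OF cring_omega_ring cring_omega_ring, of k m n] assms
    unfolding omega_matrix_ring_def by auto
qed

end
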